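(* Let $F=F(x,y,\lambda)$ be an affine frame of the associated family of proper indefinite affine spheres of a nowhere vanishing smooth real solution $h$ of the Tzitzéica equation on a connected open set $D\subset\mathbb{R}^2$, with third column $X=X_\lambda$. For $i=1,2$ let $\alpha_i\in\mathbb{R}\setminus\{0\}$ with $\alpha_1^3\neq\pm\alpha_2^3$, let $\ell_i=\mathbb{R}\cdot l_i$, $l_i=(a_i,b_i,1)$, be real lines not contained in $\Delta_0$, and suppose that neither $\tilde\ell_1:=\ell_1\,g_{\alpha_2,\ell_2}(\alpha_1)^{-1}$ nor $\tilde\ell_2:=\ell_2\,g_{\alpha_1,\ell_1}(\alpha_2)^{-1}$ is contained in $\Delta_0$, so that $g_{\alpha_2,\tilde\ell_2}\,g_{\alpha_1,\ell_1}=g_{\alpha_1,\tilde\ell_1}\,g_{\alpha_2,\ell_2}$. Put $F_1:=g_{\alpha_1,\ell_1}\ast F$ and $F_2:=g_{\alpha_2,\ell_2}\ast F$, where $\ast$ is the dressing action, and assume that these and the dressing actions $g_{\alpha_2,\tilde\ell_2}\ast F_1$, $g_{\alpha_1,\tilde\ell_1}\ast F_2$ are defined, in the sense that the lines $\ell_i F(x,y,\alpha_i)$ $(i=1,2)$, $\tilde\ell_2F_1(x,y,\alpha_2)$ and $\tilde\ell_1F_2(x,y,\alpha_1)$ are not contained in $\Delta_0$ for any $(x,y)\in D$. Then $$F_{12}:=g_{\alpha_2,\tilde\ell_2}\ast F_1=(g_{\alpha_2,\tilde\ell_2}\,g_{\alpha_1,\ell_1})\ast F=(g_{\alpha_1,\tilde\ell_1}\,g_{\alpha_2,\ell_2})\ast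 F=g_{\alpha_1,\tilde\ell_1}\ast F_2=:F_{21}.$$ This implies the classical permutability theorem: with $\gamma_i=\alpha_i^3$ and $\phi_i=l_i\,X_{\alpha_i}$, for every $\lambda\in\mathbb{R}\setminus\{0\}$ with $\lambda^3\neq-\alpha_1^3,-\alpha_2^3$ the two-step Tzitzéica transforms satisfy $X_{12}=X_{21}$ and $h_{12}=h_{21}$.
   Context: Affine spheres and frames. For a solution $h$ of the Tzitzéica equation $h_{xy}h-h_xh_y=h^3-1$ and $\gamma\in\mathbb{R}\setminus\{0\}$ consider $$(\ast_\gamma)\quad X_{xx}=\tfrac{h_x}{h}X_x+\tfrac{\gamma}{h}X_y,\qquad X_{xy}=hX,\qquad X_{yy}=\tfrac{1}{\gamma h}X_x+\tfrac{h_y}{h}X_y ,$$ whose $\mathbb{R}^3$-valued solutions with independent components describe proper indefinite affine spheres. An affine frame of the associated family is a smooth map $F$ from $D$ to $\Lambda_+^{\tau,\sigma}\mathrm{SL}(3,\mathbb{C})$ with $$F^{-1}F_x=\begin{pmatrix}h_x/h&0&\lambda\\ \lambda&-h_x/h&0\\0&\lambda&0\end{pmatrix},\qquad F^{-1}F_y=\lambda^{-1}\begin{pmatrix}0&h^{-2}&0\\0&0&h\\ h&0&0\end{pmatrix}.$$ Its third column $X_\lambda$ solves $(\ast_{\lambda^3})$ for real $\lambda$. Tzitzéica transform. If $X$ solves $(\ast_\gamma)$ for $h$ and $\phi$ is a nowhere zero scalar solution of $(\ast_{\delta})$ for $h$, the transform of $(h,X)$ via $(\phi,\delta)$ is $$\Big(h-2(\ln\phi)_{xy},\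 \frac{(\gamma-\delta)hX-2\gamma(\ln\phi)_xX_y+2\delta(\ln\phi)_yX_x}{(\gamma+\delta)h}\Big),\qquad (\ln\phi)_x=\phi_x/\phi\ \text{etc.}$$ Two-step transforms: with $\gamma=\lambda^3$ and $X=X_\lambda$, let $(h_i,X_i)$ be the transform of $(h,X)$ via $(\phi_i,\gamma_i)$. For $\{i,j\}=\{1,2\}$ put $$\phi_{ij}=\frac{(\gamma_j-\gamma_i)h\phi_j-2\gamma_j(\ln\phi_i)_x(\phi_j)_y+2\gamma_i(\ln\phi_i)_y(\phi_j)_x}{(\gamma_j+\gamma_i)h},$$ a scalar solution of $(\ast_{\gamma_j})$ for $h_i$, and let $(h_{ij},X_{ij})$ be the transform of $(h_i,X_i)$ via $(\phi_{ij},\gamma_j)$. Loop groups. $\mathbb{C}_*=\mathbb{C}\setminus\{0\}$, $\epsilon=e^{\pi i/3}$, $\mathcal{O}_r=\{|\lambda|<r\}$, $\mathcal{O}_{1/r}=\{\lambda\in\mathbb{C}\cup\{\infty\}:|\lambda|>1/r\}$ with $0<r<1$ sufficiently small. $\Lambda_+G$ is the set of holomorphic maps $\mathbb{C}_*\to G$; $\Lambda_-G$ is the set of holomorphic maps $f:\mathcal{O}_r\cup\mathcal{O}_{1/r}\to G$ with $f(\infty)=I$. The superscript $\tau,\sigma$ denotes the subgroup of those $g$ with $\overline{g(\bar\lambda)}=g(\lambda)$ and $\sigma(g(\lambda))=g(\epsilon\lambda)$, where $\sigma(g)=T(g^t)^{-1}T^{-1}$, $T=\begin{pmatrix}0&1&0\\-\epsilon&0&0\\0&0&\epsilon^2\end{pmatrix}$.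 Dressing action. For $g\in\Lambda_-^{\tau,\sigma}\mathrm{GL}(3,\mathbb{C})$, if for each $(x,y)$ one can factor $g(\lambda)F(x,y,\lambda)=\tilde F(x,y,\lambda)\tilde g(x,y,\lambda)$ with $\tilde F(x,y,\cdot)\in\Lambda_+^{\tau,\sigma}\mathrm{SL}(3,\mathbb{C})$ and $\tilde g(x,y,\cdot)\in\Lambda_-^{\tau,\sigma}\mathrm{GL}(3,\mathbb{C})$, then $g\ast F:=\tilde F$. Simple elements of rank 1 type. $\Delta_0=\{(z_1,z_2,z_3)\in\mathbb{R}^3:2z_1z_2=z_3^2\text{ or }z_3=0\}$; lines consist of row vectors, multiplied on the right by matrices. For $\alpha\in\mathbb{R}\setminus\{0\}$ and $\ell=\mathbb{R}\cdot(a,b,1)\nsubseteq\Delta_0$ (i.e. $2ab\ne1$): $$g_{\alpha,\ell}(\lambda)=I+\frac{2}{\lambda^3-\alpha^3}\begin{pmatrix}\frac{\alpha^3ab}{2ab-1}&\frac{\alpha\lambda^2b^2}{2ab-1}&\frac{\alpha^2\lambda b}{2ab-1}\\ \alpha^2\lambda a^2&\alpha^3ab&\alpha\lambda^2a\\ \alpha\lambda^2a&\alpha^2\lambda b&\alpha^3\end{pmatrix}.$$ *)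

theory Defs
  imports "HOL-Complex_Analysis.Complex_Analysis"
begin

primrec Ck_on :: "nat \<Rightarrow> ('a::real_normed_vector \<Rightarrow> 'b::real_normed_vector) \<Rightarrow> 'a set \<Rightarrow> bool" where
  "Ck_on 0 f S \<longleftrightarrow> continuous_on S f"
| "Ck_on (Suc k) f S \<longleftrightarrow>
     (\<forall>x\<in>S. f differentiable (at x)) \<and> (\<forall>v. Ck_on k (\<lambda>x. frechet_derivative f (at x) v) S)"

text \<open>Real smoothness, used on open sets only.\<close>

definition smooth_on :: "'a::real_normed_vector set \<Rightarrow> ('a \<Rightarrow> 'b::real_normed_vector) \<Rightarrow> bool" where
  "smooth_on S f \<longleftrightarrow> (\<forall>k. Ck_on k f S)"

definition dx :: "(real \<times> real \<Rightarrow> 'b::real_normed_vector) \<Rightarrow> real \<times> real \<Rightarrow> 'b" where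
  "dx f p = vector_derivative (\<lambda>t. f (t, snd p)) (at (fst p))"

definition dy :: "(real \<times> real \<Rightarrow> 'b::real_normed_vector) \<Rightarrow> real \<times> real \<Rightarrow> 'b" where
  "dy f p = vector_derivative (\<lambda>t. f (fst p, t)) (at (snd p))"

definition tzitzeica_solution :: "(real \<times> real) set \<Rightarrow> (real \<times> real \<Rightarrow> real) \<Rightarrow> bool" where
  "tzitzeica_solution D h \<longleftrightarrow> smooth_on D h \<and>
     (\<forall>p\<in>D. h p * dy (dx h) p - dx h p * dy h p = (h p)^3 - 1)"

definition star_solution ::
  "(real \<times> real) set \<Rightarrow> (real \<times> real \<Rightarrow> real) \<Rightarrow> real \<Rightarrow> (real \<times> real \<Rightarrow> 'b::real_normed_vector) \<Rightarrow> bool" where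
  "star_solution D h \<gamma> X \<longleftrightarrow> \<gamma> \<noteq> 0 \<and> smooth_on D X \<and>
     (\<forall>p\<in>D. dx (dx X) p = (dx h p / h p) *\<^sub>R dx X p + (\<gamma> / h p) *\<^sub>R dy X p
          \<and> dy (dx X) p = h p *\<^sub>R X p
          \<and> dy (dy X) p = (1 / (\<gamma> * h p)) *\<^sub>R dx X p + (dy h p / h p) *\<^sub>R dy X p)"

definition lnx :: "(real \<times> real \<Rightarrow> real) \<Rightarrow> real \<times> real \<Rightarrow> real" where
  "lnx \<phi> p = dx \<phi> p / \<phi> p"

definition lny :: "(real \<times> real \<Rightarrow> real) \<Rightarrow> real \<times> real \<Rightarrow> real" where
  "lny \<phi> p = dy \<phi> p / \<phi> p"

definition transform_h :: "(real \<times> real \<Rightarrow> real) \<Rightarrow> (real \<times> real \<Rightarrow> real) \<Rightarrow> real \<times> real \<Rightarrow> real" where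
  "transform_h h \<phi> p = h p - 2 * dy (lnx \<phi>) p"

text \<open>
  Second component of the transform of \<open>(h, X)\<close> via \<open>(\<phi>, \<delta>)\<close>, where \<open>X\<close> belongs to the
  parameter \<open>\<gamma>\<close>. With scalar \<open>X = \<phi>\<^sub>j\<close>, \<open>\<phi> = \<phi>\<^sub>i\<close>, \<open>\<gamma> = \<gamma>\<^sub>j\<close>, \<open>\<delta> = \<gamma>\<^sub>i\<close> it is \<open>\<phi>\<^sub>i\<^sub>j\<close>.
\<close>

definition transform_X ::
  "(real \<times> real \<Rightarrow> real) \<Rightarrow> real \<Rightarrow> (real \<times> real \<Rightarrow> 'b::real_normed_vector)
     \<Rightarrow> real \<Rightarrow> (real \<times> real \<Rightarrow> real) \<Rightarrow> real \<times> real \<Rightarrow> 'b" where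
  "transform_X h \<gamma> X \<delta> \<phi> p =
     (1 / ((\<gamma> + \<delta>) * h p)) *\<^sub>R
       (((\<gamma> - \<delta>) * h p) *\<^sub>R X p - (2 * \<gamma> * lnx \<phi> p) *\<^sub>R dy X p + (2 * \<delta> * lny \<phi> p) *\<^sub>R dx X p)"

text \<open>The conditions under which the transform of \<open>(h, X)\<close> via \<open>(\<phi>, \<delta>)\<close> is defined.\<close>

definition transform_defined ::
  "(real \<times> real) set \<Rightarrow> (real \<times> real \<Rightarrow> real) \<Rightarrow> real \<Rightarrow> (real \<times> real \<Rightarrow> 'b::real_normed_vector)
     \<Rightarrow> real \<Rightarrow> (real \<times> real \<Rightarrow> real) \<Rightarrow> bool" where
  "transform_defined D h \<gamma> X \<delta> \<phi> \<longleftrightarrow>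
     tzitzeica_solution D h \<and> (\<forall>p\<in>D. h p \<noteq> 0) \<and>
     star_solution D h \<gamma> X \<and> star_solution D h \<delta> \<phi> \<and> (\<forall>p\<in>D. \<phi> p \<noteq> 0) \<and> \<gamma> + \<delta> \<noteq> 0"

type_synonym cmat = "complex^3^3"

text \<open>Maps on the punctured plane or on subsets of it are total functions; only the values on
  the stated domains matter.\<close>

type_synonym loop = "complex \<Rightarrow> cmat"

definition cscale :: "complex \<Rightarrow> cmat \<Rightarrow> cmat" where
  "cscale c A = (\<chi> i j. c * A $ i $ j)"

definition eps :: complex where
  "eps = exp (of_real pi * \<i> / 3)"

definition T_mat :: cmat where
  "T_mat = vector [vector [0, 1, 0], vector [- eps, 0, 0], vector [0, 0, eps^2]]"

definition sigma :: "cmat \<Rightarrow> cmat" where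
  "sigma g = T_mat ** matrix_inv (transpose g) ** matrix_inv T_mat"

definition cnj_mat :: "cmat \<Rightarrow> cmat" where
  "cnj_mat A = (\<chi> i j. cnj (A $ i $ j))"

definition tau_sigma_on :: "complex set \<Rightarrow> loop \<Rightarrow> bool" where
  "tau_sigma_on S g \<longleftrightarrow> (\<forall>l\<in>S. cnj_mat (g (cnj l)) = g l \<and> sigma (g l) = g (eps * l))"

definition mat_holomorphic_on :: "loop \<Rightarrow> complex set \<Rightarrow> bool" where
  "mat_holomorphic_on g S \<longleftrightarrow> (\<forall>i j. (\<lambda>l. g l $ i $ j) holomorphic_on S)"

definition Lambda_plus_SL :: "loop set" where
  "Lambda_plus_SL = {g. mat_holomorphic_on g (- {0}) \<and> (\<forall>l\<in>- {0}. det (g l) = 1) \<and>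
     tau_sigma_on (- {0}) g}"

text \<open>The finite part of the neighbourhood of \<open>0\<close> and \<open>\<infinity>\<close> on the Riemann sphere.\<close>

definition near_0_inf :: "real \<Rightarrow> complex set" where
  "near_0_inf r = {l. cmod l < r \<or> cmod l > 1 / r}"

text \<open>The clause on \<open>inverse w\<close> is holomorphy near \<open>\<infinity>\<close> in the chart \<open>w = 1 / \<lambda>\<close>,
  with value \<open>I\<close> at \<open>\<infinity>\<close>.\<close>

definition Lambda_minus_GL :: "real \<Rightarrow> loop set" where
  "Lambda_minus_GL r = {g. mat_holomorphic_on g (near_0_inf r) \<and>
     mat_holomorphic_on (\<lambda>w. if w = 0 then mat 1 else g (inverse w)) (ball 0 r) \<and>
     (\<forall>l\<in>near_0_inf r. invertible (g l)) \<and> tau_sigma_on (near_0_inf r) g}"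

definition loop_mult :: "loop \<Rightarrow> loop \<Rightarrow> loop" where
  "loop_mult g g' = (\<lambda>l. g l ** g' l)"

text \<open>\<open>f\<close> is a factor \<open>F~\<close> in \<open>g F = F~ g~\<close>. By Liouville's theorem it is
  unique up to its irrelevant value at \<open>0\<close>.\<close>

definition dressing_factor :: "real \<Rightarrow> loop \<Rightarrow> loop \<Rightarrow> loop \<Rightarrow> bool" where
  "dressing_factor r g F f \<longleftrightarrow> f \<in> Lambda_plus_SL \<and>
     (\<exists>g'\<in>Lambda_minus_GL r. \<forall>l\<in>near_0_inf r - {0}. g l ** F l = f l ** g' l)"

definition dressing_defined ::
  "real \<Rightarrow> (real \<times> real) set \<Rightarrow> loop \<Rightarrow> (real \<times> real \<Rightarrow> loop) \<Rightarrow> bool" where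
  "dressing_defined r D g F \<longleftrightarrow>
     g \<in> Lambda_minus_GL r \<and> (\<forall>p\<in>D. \<exists>f. dressing_factor r g (F p) f)"

definition dress :: "real \<Rightarrow> loop \<Rightarrow> (real \<times> real \<Rightarrow> loop) \<Rightarrow> real \<times> real \<Rightarrow> loop" where
  "dress r g F p = (SOME f. dressing_factor r g (F p) f)"

text \<open>
  Smoothness as a map into the loop group (holomorphic maps with the topology of locally
  uniform convergence) is joint smoothness in \<open>(x, y)\<close> and \<open>\<lambda>\<close>.
\<close>

definition affine_frame ::
  "(real \<times> real) set \<Rightarrow> (real \<times> real \<Rightarrow> real) \<Rightarrow> (real \<times> real \<Rightarrow> loop) \<Rightarrow> bool" where
  "affine_frame D h F \<longleftrightarrow>
     smooth_on (D \<times> - {0}) (\<lambda>(p, l). F p l) \<and>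
     (\<forall>p\<in>D. F p \<in> Lambda_plus_SL) \<and>
     (\<forall>p\<in>D. \<forall>l. l \<noteq> 0 \<longrightarrow>
        matrix_inv (F p l) ** dx (\<lambda>q. F q l) p =
          vector [vector [of_real (dx h p / h p), 0, l],
                  vector [l, of_real (- dx h p / h p), 0],
                  vector [0, l, 0]] \<and>
        matrix_inv (F p l) ** dy (\<lambda>q. F q l) p =
          cscale (1 / l) (vector [vector [0, of_real (1 / (h p)^2), 0],
                               vector [0, 0, of_real (h p)],
                               vector [of_real (h p), 0, 0]]))"

text \<open>For real \<open>\<lambda>\<close> the frame has real entries, so taking real parts only changes the type.\<close>

definition Re_mat :: "cmat \<Rightarrow> real^3^3" where
  "Re_mat A = (\<chi> i j. Re (A $ i $ j))"

definition third_column :: "(real \<times> real \<Rightarrow> loop) \<Rightarrow> real \<Rightarrow> real \<times> real \<Rightarrow> real^3" where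
  "third_column F l p = column 3 (Re_mat (F p (of_real l)))"

definition Delta0 :: "(real^3) set" where
  "Delta0 = {z. 2 * z $ 1 * z $ 2 = (z $ 3)^2 \<or> z $ 3 = 0}"

definition line_times :: "(real^3) set \<Rightarrow> real^3^3 \<Rightarrow> (real^3) set" where
  "line_times L M = (\<lambda>v. v v* M) ` L"

definition simple_matrix :: "real \<Rightarrow> real \<Rightarrow> real \<Rightarrow> loop" where
  "simple_matrix \<alpha> a b l =
     (let \<alpha>' = of_real \<alpha>; a' = of_real a; b' = of_real b; d = 2 * a' * b' - 1 in
      mat 1 + cscale (2 / (l^3 - \<alpha>'^3))
        (vector [vector [\<alpha>'^3 * a' * b' / d, \<alpha>' * l^2 * b'^2 / d, \<alpha>'^2 * l * b' / d],
                vector [\<alpha>'^2 * l * a'^2, \<alpha>'^3 * a' * b', \<alpha>' * l^2 * a'],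
                vector [\<alpha>' * l^2 * a', \<alpha>'^2 * l * b', \<alpha>'^3]]))"

text \<open>A line not contained in \<open>Delta0\<close> is spanned by exactly one vector of the form \<open>(a, b, 1)\<close>.\<close>

definition simple_element :: "real \<Rightarrow> (real^3) set \<Rightarrow> loop" where
  "simple_element \<alpha> L =
     (let (a, b) = (THE (a, b). L = span {vector [a, b, 1]}) in simple_matrix \<alpha> a b)"

end

theory Submission
  imports Defs
begin

text \<open>
  Dressing an affine frame by a simple element multiplies it, up to a left factor independent of
  \<open>(x, y)\<close>, on the right by the inverse of the simple element of the transported line. With
  \<open>\<phi> = l X\<^sub>\<alpha>\<close>, the components of that line at a point are \<open>\<phi>\<^sub>x / \<alpha>\<close>, \<open>\<alpha> \<phi>\<^sub>y / h\<close> and \<open>\<phi>\<close>, so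
  this gauge transformation is exactly the Tzitzeica transform via \<open>\<phi>\<close>: it carries frames for \<open>h\<close> to frames for \<open>h (2 a b - 1)\<close>, where \<open>(a, b, 1)\<close> spans the
  transported line. Both halves of the theorem thus reduce to one rational identity,
  \<open>g\<^sub>2' g\<^sub>1 = g\<^sub>1' g\<^sub>2\<close> for simple elements: with Liouville's theorem it gives \<open>F\<^sub>1\<^sub>2 = F\<^sub>2\<^sub>1\<close>, and applied
  to the transported lines at each point it gives \<open>X\<^sub>1\<^sub>2 = X\<^sub>2\<^sub>1\<close>; its value at \<open>\<lambda> = 0\<close> gives \<open>h\<^sub>1\<^sub>2 = h\<^sub>2\<^sub>1\<close>.
\<close>

text \<open>The lines with a tilde are chosen so that the left factors cancel. Since F_1 is g_1 F
  g~_1^{-1} off the poles, transporting l_2 g_1(\<alpha>_2)^{-1} by F_1(\<alpha>_2) gives l_2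
  F(\<alpha>_2) g~_1(\<alpha>_2)^{-1}, which is the first transform of the second row. So the
  hypotheses on the dressed lines say exactly that the second scalar has no zero and the second
  gauge is nondegenerate, and the transform half can work with rows and columns of F alone. The
  obstacle in the dressing half is the existence of the factor: g F g~^{-1} could have poles at the
  six cube roots of \<alpha>^3 and -\<alpha>^3. The twisting by \<sigma> reduces these to \<alpha>
  and -\<alpha>, where rank one degenerations make the numerator vanish. As \<open>dress\<close> is
  a choice among factors, every formula for it passes through uniqueness. Simple elements are set up
  over an arbitrary field, because the same identities serve complex loops and real frames.\<close>

no_notation fps_nth (infixl "$" 75)

section \<open>Smooth functions and partial derivatives\<close>

lemma Ck_on_Suc_imp: "Ck_on (Suc k) f S \<Longrightarrow> Ck_on k f S"
proof (induction k arbitrary: f)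
  case 0
  then show ?case
    by (auto intro!: continuous_at_imp_continuous_on differentiable_imp_continuous_within)
next
  case (Suc k)
  have "\<forall>x\<in>S. f differentiable (at x)" "\<forall>v. Ck_on (Suc k) (\<lambda>x. frechet_derivative f (at x) v) S"
    using Suc.prems Ck_on.simps(2)[of "Suc k" f S] by blast+
  then show ?case
    using Suc.IH Ck_on.simps(2)[of k f S] by blast
qed

lemma frechet_derivative_cong_open:
  assumes "open S" "x \<in> S" "\<And>y. y \<in> S \<Longrightarrow> f y = g y"
  shows "frechet_derivative f (at x) = frechet_derivative g (at x)"
    and "f differentiable (at x) \<longleftrightarrow> g differentiable (at x)"
proof -
  have "(f has_derivative f') (at x) \<longleftrightarrow> (g has_derivative f') (at x)" for f'
    using has_derivative_transform_within_open[OF _ assms(1,2), of f f' UNIV g]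
      has_derivative_transform_within_open[OF _ assms(1,2), of g f' UNIV f] assms(3) by auto
  then show "frechet_derivative f (at x) = frechet_derivative g (at x)"
    "f differentiable (at x) \<longleftrightarrow> g differentiable (at x)"
    by (simp_all add: frechet_derivative_def differentiable_def)
qed

lemma Ck_on_cong:
  assumes "open S" "\<And>y. y \<in> S \<Longrightarrow> f y = g y"
  shows "Ck_on k f S \<longleftrightarrow> Ck_on k g S"
  using assms(2)
proof (induction k arbitrary: f g)
  case 0
  then show ?case by (simp cong: continuous_on_cong)
next
  case (Suc k)
  have "Ck_on k (\<lambda>x. frechet_derivative f (at x) v) S \<longleftrightarrow> Ck_on k (\<lambda>x. frechet_derivative g (at x) v) S" for v
  proof (rule Suc.IH)
    show "frechet_derivative f (at x) v = frechet_derivative g (at x) v" if "x \<in> S" for x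
      using frechet_derivative_cong_open(1)[OF assms(1) that Suc.prems] by simp
  qed
  then show ?case
    using frechet_derivative_cong_open(2)[OF assms(1) _ Suc.prems] by auto
qed

text \<open>Lets each closure rule supply an explicit derivative in place of
  \<open>frechet_derivative\<close>; openness makes the two interchangeable under
  \<open>Ck_on\<close>.\<close>

lemma Ck_on_SucI:
  assumes "open S" "\<And>x. x \<in> S \<Longrightarrow> (f has_derivative f' x) (at x)"
    and "\<And>v. Ck_on k (\<lambda>x. f' x v) S"
  shows "Ck_on (Suc k) f S"
proof -
  have "Ck_on k (\<lambda>x. frechet_derivative f (at x) v) S" for v
  proof -
    have "frechet_derivative f (at x) v = f' x v" if "x \<in> S" for x
      using frechet_derivative_at[OF assms(2)[OF that]] by simp
    then have "Ck_on k (\<lambda>x. frechet_derivative f (at x) v) S \<longleftrightarrow> Ck_on k (\<lambda>x. f' x v) S"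
      by (rule Ck_on_cong[OF assms(1)])
    then show ?thesis using assms(3) by blast
  qed
  then show ?thesis
    using assms(2) by (auto simp: differentiable_def)
qed

lemma Ck_on_SucE:
  assumes "Ck_on (Suc k) f S"
  shows "\<And>x. x \<in> S \<Longrightarrow> (f has_derivative frechet_derivative f (at x)) (at x)"
    and "\<And>v. Ck_on k (\<lambda>x. frechet_derivative f (at x) v) S"
  using assms by (auto simp: frechet_derivative_works)

lemma Ck_on_const: "open S \<Longrightarrow> Ck_on k (\<lambda>x. c) S"
  by (induction k arbitrary: c) (auto intro!: Ck_on_SucI[of _ _ "\<lambda>x v. 0"] derivative_eq_intros)

lemma Ck_on_add:
  "open S \<Longrightarrow> Ck_on k f S \<Longrightarrow> Ck_on k g S \<Longrightarrow> Ck_on k (\<lambda>x. f x + g x) S"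
proof (induction k arbitrary: f g)
  case 0
  then show ?case by (auto intro: continuous_on_add)
next
  case (Suc k)
  show ?case
    using Ck_on_SucE[OF Suc.prems(2)] Ck_on_SucE[OF Suc.prems(3)] Suc
    by (intro Ck_on_SucI[OF Suc.prems(1) has_derivative_add]) blast+
qed

lemma Ck_on_linear:
  assumes "bounded_linear L" "open S"
  shows "Ck_on k f S \<Longrightarrow> Ck_on k (\<lambda>x. L (f x)) S"
proof (induction k arbitrary: f)
  case 0
  then show ?case
    using assms(1) by (auto intro: bounded_linear.continuous_on)
next
  case (Suc k)
  show ?case
    using Ck_on_SucE[OF Suc.prems] Suc assms
    by (intro Ck_on_SucI[OF assms(2) bounded_linear.has_derivative[OF assms(1)]]) blast+
qed

text \<open>The product rule leaves terms with one factor differentiated and the other not, so the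
  induction needs both factors also at the lower order.\<close>

lemma Ck_on_bilinear:
  assumes "bounded_bilinear B" "open S"
  shows "Ck_on k f S \<Longrightarrow> Ck_on k g S \<Longrightarrow> Ck_on k (\<lambda>x. B (f x) (g x)) S"
proof (induction k arbitrary: f g)
  case 0
  then show ?case
    using assms(1) by (auto intro: bounded_bilinear.continuous_on)
next
  case (Suc k)
  show ?case
    using Ck_on_SucE[OF Suc.prems(1)] Ck_on_SucE[OF Suc.prems(2)]
      Ck_on_Suc_imp[OF Suc.prems(1)] Ck_on_Suc_imp[OF Suc.prems(2)] Suc.IH assms
    by (intro Ck_on_SucI[OF assms(2) bounded_bilinear.FDERIV[OF assms(1)]] Ck_on_add) blast+
qed

lemma Ck_on_inverse:
  fixes f :: "'a::real_normed_vector \<Rightarrow> real"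
  assumes "open S" "\<And>x. x \<in> S \<Longrightarrow> f x \<noteq> 0"
  shows "Ck_on k f S \<Longrightarrow> Ck_on k (\<lambda>x. inverse (f x)) S"
proof (induction k)
  case 0
  then show ?case using assms by (auto intro: continuous_on_inverse)
next
  case (Suc k)
  have inv: "Ck_on k (\<lambda>x. inverse (f x)) S"
    using Suc Ck_on_Suc_imp by blast
  show ?case
  proof (rule Ck_on_SucI[OF assms(1)])
    \<comment> \<open>The derivative again contains 1 / f, which is C^k by the induction hypothesis;
      writing it as a pure product lets the bilinear rule finish.\<close>
    show "((\<lambda>x. inverse (f x)) has_derivative
        (\<lambda>v. (- 1) * (inverse (f x) * frechet_derivative f (at x) v * inverse (f x)))) (at x)" if "x \<in> S" for x
      using Deriv.has_derivative_inverse[OF assms(2) Ck_on_SucE(1)[OF Suc.prems]] that by simp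
    show "Ck_on k (\<lambda>x. (- 1) * (inverse (f x) * frechet_derivative f (at x) v * inverse (f x))) S" for v
      using Ck_on_SucE(2)[OF Suc.prems] inv Ck_on_const[OF assms(1)]
      by (intro Ck_on_bilinear[OF bounded_bilinear_mult assms(1)])
  qed
qed

text \<open>An affine frame is smooth jointly in the point and \<lambda>; this freezes \<lambda>.
  The derivative of the slice is the joint derivative in direction (v, 0).\<close>

lemma Ck_on_slice:
  fixes f :: "'a::real_normed_vector \<times> 'b::real_normed_vector \<Rightarrow> 'c::real_normed_vector"
  assumes "open S" "open T" "l \<in> T"
  shows "Ck_on k f (S \<times> T) \<Longrightarrow> Ck_on k (\<lambda>p. f (p, l)) S"
proof (induction k arbitrary: f)
  case 0
  have "continuous_on S (f \<circ> (\<lambda>p. (p, l)))"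
    using 0 assms(3) by (intro continuous_on_compose continuous_intros) (auto elim!: continuous_on_subset)
  then show ?case by (simp add: o_def)
next
  case (Suc k)
  show ?case
  proof (rule Ck_on_SucI[OF assms(1)])
    show "((\<lambda>p. f (p, l)) has_derivative (\<lambda>v. frechet_derivative f (at (x, l)) (v, 0))) (at x)" if "x \<in> S" for x
    proof -
      have "((\<lambda>p. (p, l)) has_derivative (\<lambda>v. (v, 0))) (at x)"
        by (auto intro!: derivative_eq_intros)
      moreover have "(f has_derivative frechet_derivative f (at (x, l))) (at (x, l))"
        using Ck_on_SucE(1)[OF Suc.prems] that assms(3) by auto
      ultimately show ?thesis by (rule has_derivative_compose)
    qed
    show "Ck_on k (\<lambda>x. frechet_derivative f (at (x, l)) (v, 0)) S" for v
      using Suc.IH[OF Ck_on_SucE(2)[OF Suc.prems, of "(v, 0)"]] by simp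
  qed
qed

section \<open>Closure rules for smooth functions\<close>

lemma smooth_on_cong:
  "open S \<Longrightarrow> (\<And>y. y \<in> S \<Longrightarrow> f y = g y) \<Longrightarrow> smooth_on S f \<longleftrightarrow> smooth_on S g"
  using Ck_on_cong unfolding smooth_on_def by metis

lemma smooth_on_const: "open S \<Longrightarrow> smooth_on S (\<lambda>x. c)"
  by (simp add: smooth_on_def Ck_on_const)

lemma smooth_on_add: "open S \<Longrightarrow> smooth_on S f \<Longrightarrow> smooth_on S g \<Longrightarrow> smooth_on S (\<lambda>x. f x + g x)"
  by (simp add: smooth_on_def Ck_on_add)

lemma smooth_on_linear: "bounded_linear L \<Longrightarrow> open S \<Longrightarrow> smooth_on S f \<Longrightarrow> smooth_on S (\<lambda>x. L (f x))"
  by (simp add: smooth_on_def Ck_on_linear)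

lemma smooth_on_bilinear:
  "bounded_bilinear B \<Longrightarrow> open S \<Longrightarrow> smooth_on S f \<Longrightarrow> smooth_on S g \<Longrightarrow> smooth_on S (\<lambda>x. B (f x) (g x))"
  by (simp add: smooth_on_def Ck_on_bilinear)

lemmas smooth_on_scaleR = smooth_on_bilinear[OF bounded_bilinear_scaleR]
lemmas smooth_on_mult = smooth_on_bilinear[OF bounded_bilinear_mult]

lemma smooth_on_minus:
  "open S \<Longrightarrow> smooth_on S f \<Longrightarrow> smooth_on S g \<Longrightarrow> smooth_on S (\<lambda>x. f x - g x)"
  using smooth_on_add[of S f "\<lambda>x. - g x"] smooth_on_linear[OF bounded_linear_minus[OF bounded_linear_ident], of S g]
  by simp

lemma smooth_on_uminus:
  "open S \<Longrightarrow> smooth_on S g \<Longrightarrow> smooth_on S (\<lambda>x. - g x)"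
  using smooth_on_linear[OF bounded_linear_minus[OF bounded_linear_ident], of S g]
  by simp

lemma smooth_on_divide:
  fixes f g :: "'a::real_normed_vector \<Rightarrow> real"
  assumes "open S" "smooth_on S f" "smooth_on S g" "\<And>x. x \<in> S \<Longrightarrow> g x \<noteq> 0"
  shows "smooth_on S (\<lambda>x. f x / g x)"
  unfolding divide_inverse
  using assms by (intro smooth_on_mult) (auto simp: smooth_on_def Ck_on_inverse)

lemma smooth_on_power:
  fixes f :: "'a::real_normed_vector \<Rightarrow> real"
  assumes "open S" "smooth_on S f"
  shows "smooth_on S (\<lambda>x. f x ^ n)"
  by (induction n) (simp_all add: smooth_on_const smooth_on_mult assms)

lemmas smooth_intros = smooth_on_const smooth_on_add smooth_on_minus smooth_on_uminus smooth_on_mult smooth_on_scaleR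
  smooth_on_divide smooth_on_power

lemma smooth_on_slice:
  "open S \<Longrightarrow> open T \<Longrightarrow> l \<in> T \<Longrightarrow> smooth_on (S \<times> T) f \<Longrightarrow> smooth_on S (\<lambda>p. f (p, l))"
  unfolding smooth_on_def by (blast intro: Ck_on_slice)

section \<open>Partial derivatives in the plane\<close>

lemma smooth_on_has_partials:
  assumes "smooth_on S f" "p \<in> S"
  shows "((\<lambda>t. f (t, snd p)) has_vector_derivative dx f p) (at (fst p))"
    and "((\<lambda>t. f (fst p, t)) has_vector_derivative dy f p) (at (snd p))"
    and "dx f p = frechet_derivative f (at p) (1, 0)"
    and "dy f p = frechet_derivative f (at p) (0, 1)"
proof -
  have f: "(f has_derivative frechet_derivative f (at p)) (at p)"
    using assms Ck_on_SucE(1)[of 0 f S] unfolding smooth_on_def by blast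
  have lin: "bounded_linear (frechet_derivative f (at p))"
    using f by (rule has_derivative_bounded_linear)
  have "((\<lambda>t. (t, snd p)) has_derivative (\<lambda>v. (v, 0))) (at (fst p))"
    by (auto intro!: derivative_eq_intros)
  then have "((\<lambda>t. f (t, snd p)) has_derivative (\<lambda>v. frechet_derivative f (at p) (v, 0))) (at (fst p))"
    by (rule has_derivative_compose) (use f in simp)
  moreover have "(\<lambda>v. frechet_derivative f (at p) (v, 0)) = (\<lambda>v. v *\<^sub>R frechet_derivative f (at p) (1, 0))"
  proof
    show "frechet_derivative f (at p) (v, 0) = v *\<^sub>R frechet_derivative f (at p) (1, 0)" for v
      using linear_scale[OF bounded_linear.linear[OF lin], of v "(1, 0)"]
      by (simp only: scaleR_Pair real_scaleR_def mult_1_right mult_zero_right)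
  qed
  ultimately have x: "((\<lambda>t. f (t, snd p)) has_vector_derivative frechet_derivative f (at p) (1, 0)) (at (fst p))"
    by (simp only: has_vector_derivative_def)
  then show dx: "dx f p = frechet_derivative f (at p) (1, 0)"
    unfolding dx_def by (rule vector_derivative_at)
  show "((\<lambda>t. f (t, snd p)) has_vector_derivative dx f p) (at (fst p))"
    unfolding dx by (rule x)
  have "((\<lambda>t. (fst p, t)) has_derivative (\<lambda>v. (0, v))) (at (snd p))"
    by (auto intro!: derivative_eq_intros)
  then have "((\<lambda>t. f (fst p, t)) has_derivative (\<lambda>v. frechet_derivative f (at p) (0, v))) (at (snd p))"
    by (rule has_derivative_compose) (use f in simp)
  moreover have "(\<lambda>v. frechet_derivative f (at p) (0, v)) = (\<lambda>v. v *\<^sub>R frechet_derivative f (at p) (0, 1))"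
  proof
    show "frechet_derivative f (at p) (0, v) = v *\<^sub>R frechet_derivative f (at p) (0, 1)" for v
      using linear_scale[OF bounded_linear.linear[OF lin], of v "(0, 1)"]
      by (simp only: scaleR_Pair real_scaleR_def mult_1_right mult_zero_right)
  qed
  ultimately have y: "((\<lambda>t. f (fst p, t)) has_vector_derivative frechet_derivative f (at p) (0, 1)) (at (snd p))"
    by (simp only: has_vector_derivative_def)
  then show dy: "dy f p = frechet_derivative f (at p) (0, 1)"
    unfolding dy_def by (rule vector_derivative_at)
  show "((\<lambda>t. f (fst p, t)) has_vector_derivative dy f p) (at (snd p))"
    unfolding dy by (rule y)
qed

lemma smooth_on_dx_dy:
  assumes "open S" "smooth_on S f"
  shows "smooth_on S (dx f)" and "smooth_on S (dy f)"
proof -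
  have v: "smooth_on S (\<lambda>p. frechet_derivative f (at p) v)" for v
    unfolding smooth_on_def
  proof
    show "Ck_on k (\<lambda>p. frechet_derivative f (at p) v) S" for k
      using assms(2) Ck_on_SucE(2)[of k f S] unfolding smooth_on_def by blast
  qed
  show "smooth_on S (dx f)"
    by (subst smooth_on_cong[OF assms(1) smooth_on_has_partials(3)[OF assms(2)]]) (auto intro: v)
  show "smooth_on S (dy f)"
    by (subst smooth_on_cong[OF assms(1) smooth_on_has_partials(4)[OF assms(2)]]) (auto intro: v)
qed

text \<open>The differential systems hold only on D, so an equation for a first partial may be
  differentiated again only through agreement near the point.\<close>

lemma dx_dy_cong:
  assumes "open S" "p \<in> S" "\<And>q. q \<in> S \<Longrightarrow> f q = g q"
  shows "dx f p = dx g p" and "dy f p = dy g p"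
proof -
  have ev: "eventually (\<lambda>q. f q = g q) (nhds p)"
    unfolding eventually_nhds using assms by blast
  have "((\<lambda>t. (t, snd p)) \<longlongrightarrow> (fst p, snd p)) (nhds (fst p))"
    by (intro tendsto_Pair filterlim_ident tendsto_const)
  then have "eventually (\<lambda>t. f (t, snd p) = g (t, snd p)) (nhds (fst p))"
    using ev by (auto dest: eventually_compose_filterlim)
  then show "dx f p = dx g p"
    unfolding dx_def by (intro vector_derivative_cong_eq) auto
  have "((\<lambda>t. (fst p, t)) \<longlongrightarrow> (fst p, snd p)) (nhds (snd p))"
    by (intro tendsto_Pair filterlim_ident tendsto_const)
  then have "eventually (\<lambda>t. f (fst p, t) = g (fst p, t)) (nhds (snd p))"
    using ev by (auto dest: eventually_compose_filterlim)
  then show "dy f p = dy g p"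
    unfolding dy_def by (intro vector_derivative_cong_eq) auto
qed

section \<open>Simple elements and their exchange relation\<close>

text \<open>The matrix in the formula for g_{\<alpha>,\<ell>}, stripped of the factor 2 /
  (\<lambda>^3 - \<alpha>^3).\<close>

definition simple_num :: "'a::field \<Rightarrow> 'a \<Rightarrow> 'a \<Rightarrow> 'a \<Rightarrow> 'a^3^3" where
  "simple_num \<alpha> a b l = (let d = 2 * a * b - 1 in vector
     [vector [\<alpha>^3 * a * b / d, \<alpha> * l^2 * b^2 / d, \<alpha>^2 * l * b / d],
      vector [\<alpha>^2 * l * a^2, \<alpha>^3 * a * b, \<alpha> * l^2 * a],
      vector [\<alpha> * l^2 * a, \<alpha>^2 * l * b, \<alpha>^3]])"

text \<open>The matching numerator of the inverse, whose poles lie at the cube roots of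
  -\<alpha>^3.\<close>

definition simple_inv_num :: "'a::field \<Rightarrow> 'a \<Rightarrow> 'a \<Rightarrow> 'a \<Rightarrow> 'a^3^3" where
  "simple_inv_num \<alpha> a b l = (let d = 2 * a * b - 1 in vector
     [vector [\<alpha>^3 * a * b, \<alpha> * l^2 * b^2 / d, - (\<alpha>^2 * l * b)],
      vector [- (\<alpha>^2 * l * a^2), \<alpha>^3 * a * b / d, \<alpha> * l^2 * a],
      vector [\<alpha> * l^2 * a, - (\<alpha>^2 * l * b / d), \<alpha>^3]])"

definition simple :: "'a::field \<Rightarrow> 'a \<Rightarrow> 'a \<Rightarrow> 'a \<Rightarrow> 'a^3^3" where
  "simple \<alpha> a b l = (\<chi> i j. mat 1 $ i $ j + 2 / (l^3 - \<alpha>^3) * simple_num \<alpha> a b l $ i $ j)"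

definition simple_inv :: "'a::field \<Rightarrow> 'a \<Rightarrow> 'a \<Rightarrow> 'a \<Rightarrow> 'a^3^3" where
  "simple_inv \<alpha> a b l = (\<chi> i j. mat 1 $ i $ j - 2 / (l^3 + \<alpha>^3) * simple_inv_num \<alpha> a b l $ i $ j)"

definition swap12 :: "'a::field^3^3" where
  "swap12 = vector [vector [0, 1, 0], vector [1, 0, 0], vector [0, 0, 1]]"

lemmas mat3_simps = vec_eq_iff forall_3 matrix_matrix_mult_def sum_3 mat_def
  vector_matrix_mult_def matrix_vector_mult_def transpose_def

lemma simple_mult_inv:
  fixes \<alpha> a b l :: "'a::field"
  assumes "2 * a * b \<noteq> 1" "l^3 \<noteq> \<alpha>^3" "l^3 \<noteq> - (\<alpha>^3)"
  shows "simple \<alpha> a b l ** simple_inv \<alpha> a b l = mat 1"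
proof -
  \<comment> \<open>The denominator stays an atom until fractions are cleared; only then is it
    expanded.\<close>
  define d where "d = 2 * a * b - 1"
  have d: "2 * a * b - 1 = d" "d \<noteq> 0" using assms(1) by (auto simp: d_def)
  have k: "l^3 - \<alpha>^3 \<noteq> 0" "l^3 + \<alpha>^3 \<noteq> 0"
    using assms(2,3) by (auto simp: eq_neg_iff_add_eq_0)
  show ?thesis
    unfolding simple_def simple_inv_def simple_num_def simple_inv_num_def Let_def d(1)
    using d(2) k
    apply (simp add: mat3_simps)
    apply (intro conjI)
            apply (simp_all add: divide_simps)
            apply (simp_all add: d_def power2_eq_square power3_eq_cube)
            apply (simp_all add: algebra_simps)
    done
qed

text \<open>This is the \<sigma>-symmetry applied three times, where \<epsilon>^3 = -1. Being free
  of side conditions, it turns identities for simple elements at -l into identities for their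
  inverses at l.\<close>

lemma simple_inv_eq_swap:
  "simple_inv \<alpha> a b l = swap12 ** transpose (simple \<alpha> a b (- l)) ** swap12"
proof -
  have *: "2 / (- (l^3) - \<alpha>^3) = - (2 / (l^3 + \<alpha>^3))"
    by (metis minus_add_distrib minus_divide_right uminus_add_conv_diff add.commute)
  show ?thesis
    unfolding simple_def simple_inv_def simple_num_def simple_inv_num_def Let_def swap12_def
    by (simp add: mat3_simps *)
qed

lemma swap12_mult_self [simp]: "swap12 ** swap12 = mat 1"
  by (simp add: swap12_def mat3_simps)

lemma swap12_cancel [simp]: "swap12 ** (swap12 ** A) = A"
  by (simp add: matrix_mul_assoc)

text \<open>
  Multiplied by \<open>p^3 + q^3\<close>, the transported rows are \<open>(x1, y1 / d2, Z)\<close> and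
  \<open>(x2, y2 / d1, - Z)\<close>; the form \<open>Q\<close> is symmetric under exchanging the indices.
\<close>

lemma simple_num_exchange:
  fixes p q a1 b1 a2 b2 Z d1 d2 x1 x2 y1 y2 Q l :: "'a::field"
  assumes d1: "d1 = 2 * a1 * b1 - 1" and d2: "d2 = 2 * a2 * b2 - 1"
    and Z: "Z = p^3 - q^3 + 2 * p * q * (q * a1 * b2 - p * a2 * b1)"
    and x1: "x1 = (p^3 + q^3) * a1 - 2 * (a1 * q^3 * a2 * b2 - b1 * q^2 * p * a2^2 + q * p^2 * a2)"
    and x2: "x2 = (p^3 + q^3) * a2 - 2 * (a2 * p^3 * a1 * b1 - b2 * p^2 * q * a1^2 + p * q^2 * a1)"
    and y1: "y1 = (p^3 + q^3) * b1 * d2 - 2 * (a1 * q * p^2 * b2^2 + b1 * q^3 * a2 * b2 - q^2 * p * b2)"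
    and y2: "y2 = (p^3 + q^3) * b2 * d1 - 2 * (a2 * p * q^2 * b1^2 + b2 * p^3 * a1 * b1 - p^2 * q * b1)"
    and Q: "Q = 2 * x1 * y1 - d2 * Z^2"
    and nz: "d1 \<noteq> 0" "d2 \<noteq> 0" "Z \<noteq> 0" "Q \<noteq> 0"
  defines "M1 \<equiv> simple_num p a1 b1 l" and "M2 \<equiv> simple_num q a2 b2 l"
    and "M1' \<equiv> simple_num p (x1 / Z) (y1 / (d2 * Z)) l"
    and "M2' \<equiv> simple_num q (- x2 / Z) (- y2 / (d1 * Z)) l"
  shows "(l^3 - p^3) * (M2' $ i $ j - M2 $ i $ j) + (l^3 - q^3) * (M1 $ i $ j - M1' $ i $ j)
    + 2 * ((M2' ** M1) $ i $ j - (M1' ** M2) $ i $ j) = 0"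
proof -
  have Q2: "Q = 2 * x2 * y2 - d1 * Z^2"
    unfolding Q x1 y1 x2 y2 Z d1 d2 by algebra
  \<comment> \<open>The quantities 2ab - 1 of the two transported lines share the numerator
    \<open>Q\<close>.\<close>
  have e1: "2 * (x1 / Z) * (y1 / (d2 * Z)) - 1 = Q / (d2 * Z^2)"
    using nz by (simp add: Q field_simps power2_eq_square)
  have e2: "2 * (- x2 / Z) * (- y2 / (d1 * Z)) - 1 = Q / (d1 * Z^2)"
    using nz by (simp add: Q2 field_simps power2_eq_square)
  have M1: "M1 = vector
     [vector [p^3 * a1 * b1 / d1, p * l^2 * b1^2 / d1, p^2 * l * b1 / d1],
      vector [p^2 * l * a1^2, p^3 * a1 * b1, p * l^2 * a1],
      vector [p * l^2 * a1, p^2 * l * b1, p^3]]"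
    unfolding M1_def simple_num_def Let_def d1 ..
  have M2: "M2 = vector
     [vector [q^3 * a2 * b2 / d2, q * l^2 * b2^2 / d2, q^2 * l * b2 / d2],
      vector [q^2 * l * a2^2, q^3 * a2 * b2, q * l^2 * a2],
      vector [q * l^2 * a2, q^2 * l * b2, q^3]]"
    unfolding M2_def simple_num_def Let_def d2 ..
  have M1': "M1' = vector
     [vector [p^3 * x1 * y1 / Q, p * l^2 * y1^2 / (d2 * Q), p^2 * l * y1 * Z / Q],
      vector [p^2 * l * x1^2 / Z^2, p^3 * x1 * y1 / (d2 * Z^2), p * l^2 * x1 / Z],
      vector [p * l^2 * x1 / Z, p^2 * l * y1 / (d2 * Z), p^3]]"
    unfolding M1'_def simple_num_def Let_def e1 using nz
    by (simp add: vec_eq_iff forall_3 divide_simps) (simp add: power2_eq_square)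
  have M2': "M2' = vector
     [vector [q^3 * x2 * y2 / Q, q * l^2 * y2^2 / (d1 * Q), - (q^2 * l * y2 * Z / Q)],
      vector [q^2 * l * x2^2 / Z^2, q^3 * x2 * y2 / (d1 * Z^2), - (q * l^2 * x2 / Z)],
      vector [- (q * l^2 * x2 / Z), - (q^2 * l * y2 / (d1 * Z)), q^3]]"
    unfolding M2'_def simple_num_def Let_def e2 using nz
    by (simp add: vec_eq_iff forall_3 divide_simps) (simp add: power2_eq_square)
  \<comment> \<open>Half the difference of the two products g_2' g_1 and g_1' g_2, times (l^3 -
    p^3)(l^3 - q^3).\<close>
  let ?P = "\<lambda>i j. (l^3 - p^3) * (M2' $ i $ j - M2 $ i $ j) + (l^3 - q^3) * (M1 $ i $ j - M1' $ i $ j)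
    + 2 * ((M2' ** M1) $ i $ j - (M1' ** M2) $ i $ j) = 0"
  have expand: "(A ** B) $ i $ j = A $ i $ 1 * B $ 1 $ j + A $ i $ 2 * B $ 2 $ j + A $ i $ 3 * B $ 3 $ j"
    for A B :: "'a^3^3" and i j
    by (simp add: matrix_matrix_mult_def sum_3)
  \<comment> \<open>Clearing \<open>d1\<close>, \<open>d2\<close>, \<open>Z\<close> and
    \<open>Q\<close> as atoms leaves a polynomial identity in p, q, l and the line
    coordinates.\<close>
  have "?P 1 1" unfolding M1 M2 M1' M2' expand using nz
    apply (simp add: divide_simps)
    unfolding Q x1 y1 x2 y2 Z d1 d2 by algebra
  moreover have "?P 1 2" unfolding M1 M2 M1' M2' expand using nz
    apply (simp add: divide_simps)
    unfolding Q x1 y1 x2 y2 Z d1 d2 by algebra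
  moreover have "?P 1 3" unfolding M1 M2 M1' M2' expand using nz
    apply (simp add: divide_simps)
    unfolding Q x1 y1 x2 y2 Z d1 d2 by algebra
  moreover have "?P 2 1" unfolding M1 M2 M1' M2' expand using nz
    apply (simp add: divide_simps)
    unfolding Q x1 y1 x2 y2 Z d1 d2 by algebra
  moreover have "?P 2 2" unfolding M1 M2 M1' M2' expand using nz
    apply (simp add: divide_simps)
    unfolding Q x1 y1 x2 y2 Z d1 d2 by algebra
  moreover have "?P 2 3" unfolding M1 M2 M1' M2' expand using nz
    apply (simp add: divide_simps)
    unfolding Q x1 y1 x2 y2 Z d1 d2 by algebra
  moreover have "?P 3 1" unfolding M1 M2 M1' M2' expand using nz
    apply (simp add: divide_simps)
    unfolding Q x1 y1 x2 y2 Z d1 d2 by algebra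
  moreover have "?P 3 2" unfolding M1 M2 M1' M2' expand using nz
    apply (simp add: divide_simps)
    unfolding Q x1 y1 x2 y2 Z d1 d2 by algebra
  moreover have "?P 3 3" unfolding M1 M2 M1' M2' expand using nz
    apply (simp add: divide_simps)
    unfolding Q x1 y1 x2 y2 Z d1 d2 by algebra
  ultimately show ?thesis
    using exhaust_3[of i] exhaust_3[of j] by auto
qed

text \<open>Denominator-free coordinates of a transported row, in the shape of \<open>x1\<close>,
  \<open>y1\<close> and \<open>Z\<close> from \<open>simple_num_exchange\<close>.\<close>

lemma row_mult_simple_inv:
  fixes \<alpha> a b u v l :: "'a::field"
  assumes "2 * a * b \<noteq> 1" "l^3 + \<alpha>^3 \<noteq> 0"
  defines "w \<equiv> vector [u, v, 1] v* simple_inv \<alpha> a b l"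
  shows "(l^3 + \<alpha>^3) * w $ 1 = (l^3 + \<alpha>^3) * u - 2 * (u * \<alpha>^3 * a * b - v * \<alpha>^2 * l * a^2 + \<alpha> * l^2 * a)"
    and "(l^3 + \<alpha>^3) * ((2 * a * b - 1) * w $ 2) =
      (l^3 + \<alpha>^3) * v * (2 * a * b - 1) - 2 * (u * \<alpha> * l^2 * b^2 + v * \<alpha>^3 * a * b - \<alpha>^2 * l * b)"
    and "(l^3 + \<alpha>^3) * w $ 3 = l^3 - \<alpha>^3 + 2 * \<alpha> * l * (u * \<alpha> * b - v * l * a)"
proof -
  define d where "d = 2 * a * b - 1"
  define c where "c = 2 / (l^3 + \<alpha>^3)"
  define e where "e = inverse d"
  have c: "(l^3 + \<alpha>^3) * c = 2"
    unfolding c_def using assms(2) by (metis nonzero_mult_div_cancel_left times_divide_eq_right)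
  have e: "d * e = 1"
    using assms(1) by (auto simp: e_def d_def)
  note ds = d_def[symmetric] c_def[symmetric]
  have *: "w $ 1 = u * (1 - c * (\<alpha>^3 * a * b)) + v * (c * (\<alpha>^2 * l * a^2)) - c * (\<alpha> * l^2 * a)"
    "w $ 2 = - u * (c * (\<alpha> * l^2 * b^2 * e)) + v * (1 - c * (\<alpha>^3 * a * b * e)) + c * (\<alpha>^2 * l * b * e)"
    "w $ 3 = u * (c * (\<alpha>^2 * l * b)) - v * (c * (\<alpha> * l^2 * a)) + (1 - c * \<alpha>^3)"
    unfolding w_def simple_inv_def simple_inv_num_def Let_def ds
    by (simp_all add: mat3_simps divide_inverse e_def[symmetric] mult.commute)
  have "(l^3 + \<alpha>^3) * w $ 1 =
      (l^3 + \<alpha>^3) * u - ((l^3 + \<alpha>^3) * c) * (u * \<alpha>^3 * a * b - v * \<alpha>^2 * l * a^2 + \<alpha> * l^2 * a)"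
    unfolding * by (simp add: algebra_simps)
  then show "(l^3 + \<alpha>^3) * w $ 1 = (l^3 + \<alpha>^3) * u - 2 * (u * \<alpha>^3 * a * b - v * \<alpha>^2 * l * a^2 + \<alpha> * l^2 * a)"
    unfolding c .
  have "(l^3 + \<alpha>^3) * w $ 3 = (l^3 + \<alpha>^3) - ((l^3 + \<alpha>^3) * c) * (\<alpha>^3 - \<alpha> * l * (u * \<alpha> * b - v * l * a))"
    unfolding * by (simp add: algebra_simps power2_eq_square)
  then show "(l^3 + \<alpha>^3) * w $ 3 = l^3 - \<alpha>^3 + 2 * \<alpha> * l * (u * \<alpha> * b - v * l * a)"
    unfolding c by (simp add: algebra_simps)
  have "(l^3 + \<alpha>^3) * (d * w $ 2) = (l^3 + \<alpha>^3) * v * d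
      - ((l^3 + \<alpha>^3) * c) * ((d * e) * (u * \<alpha> * l^2 * b^2 + v * \<alpha>^3 * a * b - \<alpha>^2 * l * b))"
    unfolding * by (simp add: algebra_simps)
  then show "(l^3 + \<alpha>^3) * ((2 * a * b - 1) * w $ 2) =
      (l^3 + \<alpha>^3) * v * (2 * a * b - 1) - 2 * (u * \<alpha> * l^2 * b^2 + v * \<alpha>^3 * a * b - \<alpha>^2 * l * b)"
    unfolding c e by (simp add: d_def)
qed

lemma simple_mult_num:
  fixes A B :: "'a::field^3^3"
  assumes "u \<noteq> 0" "v \<noteq> 0"
  shows "((\<chi> i j. mat 1 $ i $ j + 2 / u * A $ i $ j) ** (\<chi> i j. mat 1 $ i $ j + 2 / v * B $ i $ j)) $ i $ j
    = mat 1 $ i $ j + 2 / (u * v) * (v * A $ i $ j + u * B $ i $ j + 2 * (A ** B) $ i $ j)"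
proof -
  have "\<forall>i j. ((\<chi> i j. mat 1 $ i $ j + 2 / u * A $ i $ j) ** (\<chi> i j. mat 1 $ i $ j + 2 / v * B $ i $ j)) $ i $ j
    = mat 1 $ i $ j + 2 / (u * v) * (v * A $ i $ j + u * B $ i $ j + 2 * (A ** B) $ i $ j)"
    using assms by (simp add: forall_3 matrix_matrix_mult_def sum_3 mat_def field_simps)
  then show ?thesis by blast
qed

text \<open>Normalizing the third coordinate of the transported rows to 1 gives precisely the
  coordinates of \<open>simple_num_exchange\<close>; the scale factors \<open>k1\<close> and
  \<open>k2\<close> record that normalization.\<close>

lemma simple_exchange:
  fixes p q a1 b1 a2 b2 a1' b1' a2' b2' k1 k2 l :: "'a::field"
  assumes pq: "p^3 + q^3 \<noteq> 0"
    and d: "2 * a1 * b1 \<noteq> 1" "2 * a2 * b2 \<noteq> 1" "2 * a1' * b1' \<noteq> 1"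
    and k: "k1 \<noteq> 0" "k2 \<noteq> 0"
    and v1: "vector [a1, b1, 1] v* simple_inv q a2 b2 p = k1 *s vector [a1', b1', 1]"
    and v2: "vector [a2, b2, 1] v* simple_inv p a1 b1 q = k2 *s vector [a2', b2', 1]"
    and l: "l^3 \<noteq> p^3" "l^3 \<noteq> q^3"
  shows "simple q a2' b2' l ** simple p a1 b1 l = simple p a1' b1' l ** simple q a2 b2 l"
proof -
  define d1 d2 where "d1 = 2 * a1 * b1 - 1" and "d2 = 2 * a2 * b2 - 1"
  define Z where "Z = p^3 - q^3 + 2 * p * q * (q * a1 * b2 - p * a2 * b1)"
  define x1 where "x1 = (p^3 + q^3) * a1 - 2 * (a1 * q^3 * a2 * b2 - b1 * q^2 * p * a2^2 + q * p^2 * a2)"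
  define x2 where "x2 = (p^3 + q^3) * a2 - 2 * (a2 * p^3 * a1 * b1 - b2 * p^2 * q * a1^2 + p * q^2 * a1)"
  define y1 where "y1 = (p^3 + q^3) * b1 * d2 - 2 * (a1 * q * p^2 * b2^2 + b1 * q^3 * a2 * b2 - q^2 * p * b2)"
  define y2 where "y2 = (p^3 + q^3) * b2 * d1 - 2 * (a2 * p * q^2 * b1^2 + b2 * p^3 * a1 * b1 - p^2 * q * b1)"
  define Q where "Q = 2 * x1 * y1 - d2 * Z^2"
  have nz: "d1 \<noteq> 0" "d2 \<noteq> 0" using d by (auto simp: d1_def d2_def)
  have pq': "q^3 + p^3 \<noteq> 0" using pq by (simp add: add.commute)
  note v = row_mult_simple_inv[OF d(2) pq, of a1 b1, unfolded v1]
    row_mult_simple_inv[OF d(1) pq', of a2 b2, unfolded v2]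
  define s where "s = p^3 + q^3"
  have s: "s \<noteq> 0" using pq by (simp add: s_def)
  have "Z = s * k1" "x1 = s * (k1 * a1')" "y1 = s * (d2 * (k1 * b1'))"
    using v(1-3) by (simp_all add: s_def Z_def x1_def y1_def d2_def algebra_simps)
  moreover have "- Z = s * k2" "x2 = s * (k2 * a2')" "y2 = s * (d1 * (k2 * b2'))"
    using v(4-6) by (simp_all add: s_def Z_def x2_def y2_def d1_def algebra_simps)
  \<comment> \<open>The third coordinates of the two transported rows are opposite, \<open>Z\<close>
    and - \<open>Z\<close> up to the common factor s.\<close>
  moreover have "k2 = - k1"
    using calculation s by (metis mult_cancel_left mult_minus_right)
  ultimately have Z: "Z \<noteq> 0" and a: "a1' = x1 / Z" "b1' = y1 / (d2 * Z)" "a2' = - x2 / Z" "b2' = - y2 / (d1 * Z)"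
    using k s nz by auto
  \<comment> \<open>Nondegeneracy of the first transported line is what makes \<open>Q\<close>
    nonzero.\<close>
  have "Q / (d2 * Z^2) = 2 * a1' * b1' - 1"
    using nz Z unfolding a by (simp add: Q_def field_simps power2_eq_square)
  then have Q: "Q \<noteq> 0" using d(3) by auto
  have u: "l^3 - p^3 \<noteq> 0" "l^3 - q^3 \<noteq> 0" using l by auto
  have "(simple q a2' b2' l ** simple p a1 b1 l) $ i $ j = (simple p a1' b1' l ** simple q a2 b2 l) $ i $ j"
    for i j
  proof -
    note ex = simple_num_exchange[OF d1_def d2_def Z_def x1_def x2_def y1_def y2_def Q_def nz Z Q, of l i j,
        folded a]
    show ?thesis
      unfolding simple_def simple_mult_num[OF u(2,1)] simple_mult_num[OF u]
      unfolding mult.commute[of "l^3 - q^3" "l^3 - p^3"]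
      using ex by (intro arg_cong[where f = "\<lambda>x. mat 1 $ i $ j + 2 / ((l^3 - p^3) * (l^3 - q^3)) * x"])
        (simp add: algebra_simps)
  qed
  then show ?thesis by (simp add: vec_eq_iff)
qed

text \<open>Transposition reverses the products in \<open>simple_exchange\<close> at -l, and
  conjugation by \<open>swap12\<close> turns them into products of inverses. Gauges act on frames
  from the right by these inverses.\<close>

lemma simple_inv_exchange:
  fixes p q a1 b1 a2 b2 a1' b1' a2' b2' k1 k2 l :: "'a::field"
  assumes pq: "p^3 + q^3 \<noteq> 0"
    and d: "2 * a1 * b1 \<noteq> 1" "2 * a2 * b2 \<noteq> 1" "2 * a1' * b1' \<noteq> 1"
    and k: "k1 \<noteq> 0" "k2 \<noteq> 0"
    and v1: "vector [a1, b1, 1] v* simple_inv q a2 b2 p = k1 *s vector [a1', b1', 1]"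
    and v2: "vector [a2, b2, 1] v* simple_inv p a1 b1 q = k2 *s vector [a2', b2', 1]"
    and l: "l^3 \<noteq> - (p^3)" "l^3 \<noteq> - (q^3)"
  shows "simple_inv p a1 b1 l ** simple_inv q a2' b2' l = simple_inv q a2 b2 l ** simple_inv p a1' b1' l"
proof -
  have l': "(- l)^3 \<noteq> p^3" "(- l)^3 \<noteq> q^3"
    using l minus_equation_iff[of "l^3" "p^3"] minus_equation_iff[of "l^3" "q^3"] by auto
  have *: "simple_inv p u v l ** simple_inv q u' v' l =
      swap12 ** transpose (simple q u' v' (- l) ** simple p u v (- l)) ** swap12"
    "simple_inv q u' v' l ** simple_inv p u v l =
      swap12 ** transpose (simple p u v (- l) ** simple q u' v' (- l)) ** swap12" for u v u' v'
    unfolding simple_inv_eq_swap matrix_transpose_mul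
    by (simp_all add: matrix_mul_assoc[symmetric])
  show ?thesis
    unfolding * simple_exchange[OF pq d k v1 v2 l'] ..
qed

section \<open>Frames and the Tzitzeica transform\<close>

lemma smooth_on_has_real_partials:
  fixes f :: "real \<times> real \<Rightarrow> real"
  assumes "smooth_on S f" "p \<in> S"
  shows "((\<lambda>t. f (t, snd p)) has_real_derivative dx f p) (at (fst p))"
    and "((\<lambda>t. f (fst p, t)) has_real_derivative dy f p) (at (snd p))"
  using smooth_on_has_partials(1,2)[OF assms] by (simp_all add: has_real_derivative_iff_has_vector_derivative)

text \<open>The matrix of F^{-1}F_x at real \<lambda>, with \<open>H\<close> standing for h_x /
  h.\<close>

definition frame_x :: "real \<Rightarrow> real \<Rightarrow> real^3^3" where
  "frame_x H l = vector [vector [H, 0, l], vector [l, - H, 0], vector [0, l, 0]]"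

definition frame_y :: "real \<Rightarrow> real \<Rightarrow> real^3^3" where
  "frame_y h l = vector [vector [0, 1 / (l * h^2), 0], vector [0, 0, h / l], vector [h / l, 0, 0]]"

text \<open>The columns of a frame for the spectral parameter \<open>l\<close>; the third column is \<open>X\<close>, and the first
  two are \<open>X\<^sub>x / l\<close> and \<open>l X\<^sub>y / h\<close>.\<close>

definition frame ::
  "(real \<times> real) set \<Rightarrow> (real \<times> real \<Rightarrow> real) \<Rightarrow> real \<Rightarrow> (3 \<Rightarrow> real \<times> real \<Rightarrow> 'b::real_normed_vector) \<Rightarrow> bool"
  where "frame D h l u \<longleftrightarrow> l \<noteq> 0 \<and> (\<forall>j. smooth_on D (u j)) \<and>
    (\<forall>p\<in>D. \<forall>j. dx (u j) p = (\<Sum>i\<in>UNIV. frame_x (dx h p / h p) l $ i $ j *\<^sub>R u i p)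
            \<and> dy (u j) p = (\<Sum>i\<in>UNIV. frame_y (h p) l $ i $ j *\<^sub>R u i p))"

lemma frameD:
  assumes "frame D h l u" "p \<in> D"
  shows "dx (u 1) p = (dx h p / h p) *\<^sub>R u 1 p + l *\<^sub>R u 2 p"
    and "dx (u 2) p = (- (dx h p / h p)) *\<^sub>R u 2 p + l *\<^sub>R u 3 p"
    and "dx (u 3) p = l *\<^sub>R u 1 p"
    and "dy (u 1) p = (h p / l) *\<^sub>R u 3 p"
    and "dy (u 2) p = (1 / (l * (h p)^2)) *\<^sub>R u 1 p"
    and "dy (u 3) p = (h p / l) *\<^sub>R u 2 p"
  using assms by (simp_all add: frame_def frame_x_def frame_y_def sum_3)

lemma dx_scaleR_dy_scaleR:
  fixes c :: "real \<times> real \<Rightarrow> real" and u :: "real \<times> real \<Rightarrow> 'b::real_normed_vector"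
  assumes "smooth_on D c" "smooth_on D u" "p \<in> D"
  shows "dx (\<lambda>q. c q *\<^sub>R u q) p = c p *\<^sub>R dx u p + dx c p *\<^sub>R u p"
    and "dy (\<lambda>q. c q *\<^sub>R u q) p = c p *\<^sub>R dy u p + dy c p *\<^sub>R u p"
proof -
  note c = smooth_on_has_real_partials(1,2)[OF assms(1,3)]
  note u = smooth_on_has_partials(1,2)[OF assms(2,3)]
  show "dx (\<lambda>q. c q *\<^sub>R u q) p = c p *\<^sub>R dx u p + dx c p *\<^sub>R u p"
    unfolding dx_def[of "\<lambda>q. c q *\<^sub>R u q"]
    using has_vector_derivative_scaleR[OF c(1) u(1)] by (auto intro!: vector_derivative_at)
  show "dy (\<lambda>q. c q *\<^sub>R u q) p = c p *\<^sub>R dy u p + dy c p *\<^sub>R u p"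
    unfolding dy_def[of "\<lambda>q. c q *\<^sub>R u q"]
    using has_vector_derivative_scaleR[OF c(2) u(2)] by (auto intro!: vector_derivative_at)
qed

text \<open>With X_x = l u_1 and X_y = (h / l) u_2 the system closes after one more differentiation.
  The parameter l^3 comes from l^2 u_2 = (l^3 / h) X_y in X_xx.\<close>

lemma frame_star_solution:
  fixes u :: "3 \<Rightarrow> real \<times> real \<Rightarrow> 'b::real_normed_vector"
  assumes D: "open D" and h: "smooth_on D h" "\<forall>p\<in>D. h p \<noteq> 0" and u: "frame D h l u"
  shows "star_solution D h (l^3) (u 3)"
proof -
  have l: "l \<noteq> 0" and sm: "smooth_on D (u j)" for j
    using u by (auto simp: frame_def)
  have "dx (dx (u 3)) p = (dx h p / h p) *\<^sub>R dx (u 3) p + (l^3 / h p) *\<^sub>R dy (u 3) p"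
    and "dy (dx (u 3)) p = h p *\<^sub>R u 3 p"
    and "dy (dy (u 3)) p = (1 / (l^3 * h p)) *\<^sub>R dx (u 3) p + (dy h p / h p) *\<^sub>R dy (u 3) p"
    if p: "p \<in> D" for p
  proof -
    note fr = frameD[OF u p]
    have hp: "h p \<noteq> 0" using h p by auto
    have "dx (dx (u 3)) p = dx (\<lambda>q. l *\<^sub>R u 1 q) p"
      by (rule dx_dy_cong(1)[OF D p], rule frameD(3)[OF u])
    moreover have "dy (dx (u 3)) p = dy (\<lambda>q. l *\<^sub>R u 1 q) p"
      by (rule dx_dy_cong(2)[OF D p], rule frameD(3)[OF u])
    ultimately have x: "dx (dx (u 3)) p = l *\<^sub>R dx (u 1) p" "dy (dx (u 3)) p = l *\<^sub>R dy (u 1) p"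
      using dx_scaleR_dy_scaleR[OF smooth_on_const[OF D, of l] sm p] by (simp_all add: dx_def dy_def)
    have yh: "smooth_on D (\<lambda>q. h q / l)"
      using D h l by (intro smooth_intros) auto
    have dyh: "dy (\<lambda>q. h q / l) p = dy h p / l"
      unfolding dy_def[of "\<lambda>q. h q / l"]
      using smooth_on_has_partials(2)[OF h(1) p] l
      by (intro vector_derivative_at) (auto simp flip: has_real_derivative_iff_has_vector_derivative intro!: derivative_eq_intros)
    have "dy (dy (u 3)) p = dy (\<lambda>q. (h q / l) *\<^sub>R u 2 q) p"
      by (rule dx_dy_cong(2)[OF D p], rule frameD(6)[OF u])
    then have y: "dy (dy (u 3)) p = (h p / l) *\<^sub>R dy (u 2) p + (dy h p / l) *\<^sub>R u 2 p"
      using dx_scaleR_dy_scaleR(2)[OF yh sm p] dyh by simp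
    show "dx (dx (u 3)) p = (dx h p / h p) *\<^sub>R dx (u 3) p + (l^3 / h p) *\<^sub>R dy (u 3) p"
      unfolding x fr using l hp by (simp add: algebra_simps power3_eq_cube)
    show "dy (dx (u 3)) p = h p *\<^sub>R u 3 p"
      unfolding x fr using l by simp
    show "dy (dy (u 3)) p = (1 / (l^3 * h p)) *\<^sub>R dx (u 3) p + (dy h p / h p) *\<^sub>R dy (u 3) p"
      unfolding y fr using l hp by (simp add: power2_eq_square power3_eq_cube)
  qed
  then show ?thesis
    unfolding star_solution_def using l sm by auto
qed

section \<open>Gauge transformations by inverse simple elements\<close>

definition simple_inv_deriv :: "real \<Rightarrow> real \<Rightarrow> real \<Rightarrow> real \<Rightarrow> real \<Rightarrow> real \<Rightarrow> real^3^3" where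
  "simple_inv_deriv \<alpha> a b a' b' l = (let d = 2 * a * b - 1; d' = 2 * (a' * b + a * b') in
    \<chi> i j. - (2 / (l^3 + \<alpha>^3)) * (vector
     [vector [\<alpha>^3 * (a' * b + a * b'), \<alpha> * l^2 * (2 * b * b' * d - b^2 * d') / d^2, - (\<alpha>^2 * l * b')],
      vector [- (\<alpha>^2 * l * (2 * a * a')), \<alpha>^3 * ((a' * b + a * b') * d - a * b * d') / d^2, \<alpha> * l^2 * a'],
      vector [\<alpha> * l^2 * a', - (\<alpha>^2 * l * (b' * d - b * d') / d^2), 0]] :: real^3^3) $ i $ j)"

text \<open>Entrywise quotient rule: \<open>simple_inv_deriv\<close> is the derivative of the
  inverse along a curve of lines (a, b, 1) with velocity (a', b').\<close>

lemma simple_inv_has_derivative: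
  fixes a b :: "real \<Rightarrow> real"
  assumes "(a has_real_derivative a') (at t)" "(b has_real_derivative b') (at t)"
    and "2 * a t * b t \<noteq> 1"
  shows "((\<lambda>t. simple_inv \<alpha> (a t) (b t) l $ i $ j) has_real_derivative
    simple_inv_deriv \<alpha> (a t) (b t) a' b' l $ i $ j) (at t)"
proof -
  define k where "k = 2 / (l^3 + \<alpha>^3)"
  have d: "2 * a t * b t - 1 \<noteq> 0" using assms(3) by simp
  have "\<forall>i j. ((\<lambda>t. simple_inv \<alpha> (a t) (b t) l $ i $ j) has_real_derivative
    simple_inv_deriv \<alpha> (a t) (b t) a' b' l $ i $ j) (at t)"
    unfolding simple_inv_def simple_inv_num_def simple_inv_deriv_def Let_def k_def[symmetric] forall_3
    apply (simp add: mat_def)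
    apply (intro conjI)
    apply (auto intro!: derivative_eq_intros assms(1,2) d simp: d)
    apply (simp_all add: algebra_simps power2_eq_square)
    done
  then show ?thesis by blast
qed

text \<open>The expressions for a' and b' are the Riccati equations of the ratios z_1 / z_3 and z_2
  / z_3 of a row frame at \<alpha>. The new diagonal entry is the logarithmic derivative of h (2ab -
  1), which is how the transformed h shows up.\<close>

lemma gauge_x:
  fixes \<alpha> a b l H :: real
  assumes "2 * a * b \<noteq> 1" "l^3 \<noteq> - (\<alpha>^3)"
  defines "a' \<equiv> H * a + \<alpha> * b - \<alpha> * a^2" and "b' \<equiv> - H * b + \<alpha> - \<alpha> * a * b"
  shows "simple_inv_deriv \<alpha> a b a' b' l + frame_x H l ** simple_inv \<alpha> a b l =
    simple_inv \<alpha> a b l ** frame_x (H + 2 * (a' * b + a * b') / (2 * a * b - 1)) l"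
proof -
  define d where "d = 2 * a * b - 1"
  have nz: "d \<noteq> 0" "l^3 + \<alpha>^3 \<noteq> 0"
    using assms(1,2) by (auto simp: d_def)
  show ?thesis
    unfolding simple_inv_def simple_inv_num_def simple_inv_deriv_def Let_def frame_x_def d_def[symmetric]
    using nz
    apply (simp add: mat3_simps)
    apply (intro conjI)
    apply (simp_all add: divide_simps)
    apply (unfold a'_def b'_def d_def)
    by algebra+
qed

text \<open>The y-counterpart, with the Riccati equations in y. Here the transformed h enters the
  matrix directly.\<close>

lemma gauge_y:
  fixes \<alpha> a b l h :: real
  assumes "2 * a * b \<noteq> 1" "l^3 \<noteq> - (\<alpha>^3)" "\<alpha> \<noteq> 0" "l \<noteq> 0" "h \<noteq> 0"
  defines "a' \<equiv> h / \<alpha> * (1 - a * b)" and "b' \<equiv> a / (\<alpha> * h^2) - h / \<alpha> * b^2"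
  shows "simple_inv_deriv \<alpha> a b a' b' l + frame_y h l ** simple_inv \<alpha> a b l =
    simple_inv \<alpha> a b l ** frame_y (h * (2 * a * b - 1)) l"
proof -
  define d where "d = 2 * a * b - 1"
  have nz: "d \<noteq> 0" "l^3 + \<alpha>^3 \<noteq> 0"
    using assms(1,2) by (auto simp: d_def)
  show ?thesis
    unfolding simple_inv_def simple_inv_num_def simple_inv_deriv_def Let_def frame_y_def d_def[symmetric]
      a'_def b'_def
    using nz assms(3-5)
    apply (simp add: mat3_simps)
    apply (intro conjI)
    apply (simp_all add: divide_simps)
    apply (unfold d_def)
    by algebra+
qed

text \<open>If u' = u A then (u C)' = u (C' + A C) = (u C) A'.\<close>

lemma gauge_has_vector_derivative:
  fixes u :: "'n::finite \<Rightarrow> real \<Rightarrow> 'b::real_normed_vector" and C :: "real \<Rightarrow> real^'n^'n"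
  assumes u: "\<And>j. (u j has_vector_derivative (\<Sum>i\<in>UNIV. A $ i $ j *\<^sub>R u i t)) (at t)"
    and C: "\<And>i j. ((\<lambda>t. C t $ i $ j) has_real_derivative C' $ i $ j) (at t)"
    and gauge: "C' + A ** C t = C t ** A'"
  shows "((\<lambda>t. \<Sum>i\<in>UNIV. C t $ i $ j *\<^sub>R u i t) has_vector_derivative
    (\<Sum>k\<in>UNIV. A' $ k $ j *\<^sub>R (\<Sum>i\<in>UNIV. C t $ i $ k *\<^sub>R u i t))) (at t)"
proof -
  have "((\<lambda>t. \<Sum>i\<in>UNIV. C t $ i $ j *\<^sub>R u i t) has_vector_derivative
    (\<Sum>i\<in>UNIV. C t $ i $ j *\<^sub>R (\<Sum>k\<in>UNIV. A $ k $ i *\<^sub>R u k t) + C' $ i $ j *\<^sub>R u i t)) (at t)"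
    by (intro has_vector_derivative_sum has_vector_derivative_scaleR C u)
  moreover have "(\<Sum>i\<in>UNIV. C t $ i $ j *\<^sub>R (\<Sum>k\<in>UNIV. A $ k $ i *\<^sub>R u k t) + C' $ i $ j *\<^sub>R u i t)
    = (\<Sum>k\<in>UNIV. A' $ k $ j *\<^sub>R (\<Sum>i\<in>UNIV. C t $ i $ k *\<^sub>R u i t))"
  proof -
    have "(\<Sum>i\<in>UNIV. C t $ i $ j *\<^sub>R (\<Sum>k\<in>UNIV. A $ k $ i *\<^sub>R u k t))
      = (\<Sum>k\<in>UNIV. (\<Sum>i\<in>UNIV. A $ k $ i * C t $ i $ j) *\<^sub>R u k t)"
    and "(\<Sum>k\<in>UNIV. A' $ k $ j *\<^sub>R (\<Sum>i\<in>UNIV. C t $ i $ k *\<^sub>R u i t))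
      = (\<Sum>i\<in>UNIV. (\<Sum>k\<in>UNIV. C t $ i $ k * A' $ k $ j) *\<^sub>R u i t)"
    and "C' $ i $ j + (\<Sum>k\<in>UNIV. A $ i $ k * C t $ k $ j) = (\<Sum>k\<in>UNIV. C t $ i $ k * A' $ k $ j)" for i
      subgoal unfolding scaleR_sum_right scaleR_sum_left by (subst sum.swap) (simp add: mult.commute)
      subgoal unfolding scaleR_sum_right scaleR_sum_left by (subst sum.swap) (simp add: mult.commute)
      subgoal using arg_cong[OF gauge, of "\<lambda>M. M $ i $ j"] by (simp add: matrix_matrix_mult_def)
      done
    note eqs = this
    show ?thesis
      unfolding sum.distrib eqs(1,2) eqs(3)[symmetric]
      by (simp add: scaleR_left_distrib sum.distrib add.commute)
  qed
  ultimately show ?thesis by simp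
qed

lemma smooth_on_sum:
  assumes "open S" "finite I" "\<And>i. i \<in> I \<Longrightarrow> smooth_on S (f i)"
  shows "smooth_on S (\<lambda>x. \<Sum>i\<in>I. f i x)"
  using assms(2,3) by (induction I rule: finite_induct) (auto intro: smooth_on_const smooth_on_add assms(1))

lemma smooth_on_simple_inv:
  fixes a b :: "real \<times> real \<Rightarrow> real"
  assumes D: "open D" and "smooth_on D a" "smooth_on D b" and "\<And>p. p \<in> D \<Longrightarrow> 2 * a p * b p \<noteq> 1"
  shows "smooth_on D (\<lambda>p. simple_inv \<alpha> (a p) (b p) l $ i $ j)"
proof -
  \<comment> \<open>The factor is constant in the point, so no condition on l^3 + \<alpha>^3
    arises.\<close>
  define k where "k = 2 / (l^3 + \<alpha>^3)"
  have "\<forall>i j. smooth_on D (\<lambda>p. simple_inv \<alpha> (a p) (b p) l $ i $ j)"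
    unfolding simple_inv_def simple_inv_num_def Let_def forall_3 k_def[symmetric]
    using assms(4)
    by (simp add: mat_def)
      (safe; (rule smooth_on_const[OF D] | rule assms(2,3) | rule smooth_on_minus[OF D]
        | rule smooth_on_uminus[OF D] | rule smooth_on_divide[OF D] | rule smooth_on_mult[OF D]
        | rule smooth_on_power[OF D] | force)+)
  then show ?thesis by blast
qed

text \<open>For a row frame z = l F(\<alpha>), the two slopes are the coordinates a and b of the
  transported line spanned by (a, b, 1).\<close>

definition slope1 :: "(3 \<Rightarrow> 'a \<Rightarrow> real) \<Rightarrow> 'a \<Rightarrow> real" where
  "slope1 z p = z 1 p / z 3 p"

definition slope2 :: "(3 \<Rightarrow> 'a \<Rightarrow> real) \<Rightarrow> 'a \<Rightarrow> real" where
  "slope2 z p = z 2 p / z 3 p"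

definition new_h :: "('a \<Rightarrow> real) \<Rightarrow> (3 \<Rightarrow> 'a \<Rightarrow> real) \<Rightarrow> 'a \<Rightarrow> real" where
  "new_h h z p = h p * (2 * slope1 z p * slope2 z p - 1)"

text \<open>The dressed frame without its left factor g, which does not depend on the point and does
  not occur in the Tzitzeica transform.\<close>

definition new_frame ::
  "real \<Rightarrow> (3 \<Rightarrow> 'a \<Rightarrow> real) \<Rightarrow> real \<Rightarrow> (3 \<Rightarrow> 'a \<Rightarrow> 'b::real_normed_vector) \<Rightarrow> 3 \<Rightarrow> 'a \<Rightarrow> 'b" where
  "new_frame \<alpha> z l u j p = (\<Sum>i\<in>UNIV. simple_inv \<alpha> (slope1 z p) (slope2 z p) l $ i $ j *\<^sub>R u i p)"

section \<open>One Tzitzeica transform as a gauge transformation\<close>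

context
  fixes D :: "(real \<times> real) set" and h :: "real \<times> real \<Rightarrow> real" and z :: "3 \<Rightarrow> real \<times> real \<Rightarrow> real"
    and \<alpha> :: real
  assumes D: "open D" and tz: "tzitzeica_solution D h" and h0: "\<forall>p\<in>D. h p \<noteq> 0"
    and z: "frame D h \<alpha> z"
    and z0: "\<forall>p\<in>D. z 3 p \<noteq> 0 \<and> 2 * z 1 p * z 2 p \<noteq> (z 3 p)^2"
begin

lemma slope_neq: "p \<in> D \<Longrightarrow> 2 * slope1 z p * slope2 z p \<noteq> 1"
  using z0 by (auto simp: slope1_def slope2_def power2_eq_square)

lemma alpha_nz: "\<alpha> \<noteq> 0"
  using z by (simp add: frame_def)

lemma smooth_h: "smooth_on D h"
  using tz by (simp add: tzitzeica_solution_def)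

lemma smooth_slope: "smooth_on D (slope1 z)" "smooth_on D (slope2 z)"
proof -
  have "smooth_on D (z j)" for j
    using z by (simp add: frame_def)
  then show "smooth_on D (slope1 z)" "smooth_on D (slope2 z)"
    unfolding slope1_def[abs_def] slope2_def[abs_def] using z0 by (auto intro!: smooth_on_divide D)
qed

text \<open>Dividing the linear system of the row by its third entry gives Riccati equations, the
  ones built into \<open>gauge_x\<close> and \<open>gauge_y\<close>.\<close>

lemma slope_derivs:
  assumes p: "p \<in> D"
  shows "dx (slope1 z) p = dx h p / h p * slope1 z p + \<alpha> * slope2 z p - \<alpha> * (slope1 z p)^2"
    and "dx (slope2 z) p = - (dx h p / h p) * slope2 z p + \<alpha> - \<alpha> * slope1 z p * slope2 z p"
    and "dy (slope1 z) p = h p / \<alpha> * (1 - slope1 z p * slope2 z p)"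
    and "dy (slope2 z) p = slope1 z p / (\<alpha> * (h p)^2) - h p / \<alpha> * (slope2 z p)^2"
proof -
  have sm: "smooth_on D (z j)" for j
    using z by (simp add: frame_def)
  note zx = smooth_on_has_real_partials(1)[OF sm p]
  note zy = smooth_on_has_real_partials(2)[OF sm p]
  have z3: "z 3 p \<noteq> 0" using z0 p by auto
  have hp: "h p \<noteq> 0" using h0 p by auto
  have z3': "z 3 (fst p, snd p) \<noteq> 0" using z3 by simp
  have q: "dx (\<lambda>q. z j q / z 3 q) p = (dx (z j) p * z 3 p - z j p * dx (z 3) p) / (z 3 p * z 3 p)"
    "dy (\<lambda>q. z j q / z 3 q) p = (dy (z j) p * z 3 p - z j p * dy (z 3) p) / (z 3 p * z 3 p)" for j
    unfolding dx_def[of "\<lambda>q. z j q / z 3 q"] dy_def[of "\<lambda>q. z j q / z 3 q"]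
    using DERIV_divide[OF zx[of j] zx[of 3] z3'] DERIV_divide[OF zy[of j] zy[of 3] z3']
    by (simp_all add: has_real_derivative_iff_has_vector_derivative vector_derivative_at)
  define H where "H = dx h p / h p"
  note fr = frameD[OF z p, folded H_def, unfolded real_scaleR_def]
  show "dx (slope1 z) p = dx h p / h p * slope1 z p + \<alpha> * slope2 z p - \<alpha> * (slope1 z p)^2"
    "dx (slope2 z) p = - (dx h p / h p) * slope2 z p + \<alpha> - \<alpha> * slope1 z p * slope2 z p"
    "dy (slope1 z) p = h p / \<alpha> * (1 - slope1 z p * slope2 z p)"
    "dy (slope2 z) p = slope1 z p / (\<alpha> * (h p)^2) - h p / \<alpha> * (slope2 z p)^2"
    unfolding slope1_def[abs_def] slope2_def[abs_def] q fr H_def[symmetric]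
    using z3 hp alpha_nz by (simp_all add: field_simps power2_eq_square)
qed


text \<open>With the slope derivatives eliminated, a further differentiation needs only the Riccati
  equations and the mixed derivative of h.\<close>

lemma new_h_derivs:
  assumes p: "p \<in> D"
  shows "dx (new_h h z) p = dx h p * (2 * slope1 z p * slope2 z p - 1)
      + 2 * \<alpha> * h p * ((slope2 z p)^2 - slope1 z p * (2 * slope1 z p * slope2 z p - 1))"
    and "dy (new_h h z) p = dy h p * (2 * slope1 z p * slope2 z p - 1)
      + 2 * h p / \<alpha> * ((slope1 z p)^2 / (h p)^2 - h p * slope2 z p * (2 * slope1 z p * slope2 z p - 1))"
proof -
  note smx = smooth_on_has_real_partials(1)[OF _ p]
  note smy = smooth_on_has_real_partials(2)[OF _ p]
  have hp: "h p \<noteq> 0" using h0 p by auto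
  have "((\<lambda>t. new_h h z (t, snd p)) has_real_derivative
      dx h p * (2 * slope1 z p * slope2 z p - 1)
      + h p * (2 * (dx (slope1 z) p * slope2 z p + slope1 z p * dx (slope2 z) p))) (at (fst p))"
    unfolding new_h_def
    by (auto intro!: derivative_eq_intros smx[OF smooth_h] smx[OF smooth_slope(1)] smx[OF smooth_slope(2)])
  then have "dx (new_h h z) p = dx h p * (2 * slope1 z p * slope2 z p - 1)
      + h p * (2 * (dx (slope1 z) p * slope2 z p + slope1 z p * dx (slope2 z) p))"
    unfolding dx_def[of "new_h h z"] has_real_derivative_iff_has_vector_derivative by (rule vector_derivative_at)
  then show "dx (new_h h z) p = dx h p * (2 * slope1 z p * slope2 z p - 1)
      + 2 * \<alpha> * h p * ((slope2 z p)^2 - slope1 z p * (2 * slope1 z p * slope2 z p - 1))"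
    unfolding slope_derivs[OF p] by (simp add: algebra_simps power2_eq_square)
  have "((\<lambda>t. new_h h z (fst p, t)) has_real_derivative
      dy h p * (2 * slope1 z p * slope2 z p - 1)
      + h p * (2 * (dy (slope1 z) p * slope2 z p + slope1 z p * dy (slope2 z) p))) (at (snd p))"
    unfolding new_h_def
    by (auto intro!: derivative_eq_intros smy[OF smooth_h] smy[OF smooth_slope(1)] smy[OF smooth_slope(2)])
  then have E: "dy (new_h h z) p = dy h p * (2 * slope1 z p * slope2 z p - 1)
      + h p * (2 * (dy (slope1 z) p * slope2 z p + slope1 z p * dy (slope2 z) p))"
    unfolding dy_def[of "new_h h z"] has_real_derivative_iff_has_vector_derivative by (rule vector_derivative_at)
  show "dy (new_h h z) p = dy h p * (2 * slope1 z p * slope2 z p - 1)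
      + 2 * h p / \<alpha> * ((slope1 z p)^2 / (h p)^2 - h p * slope2 z p * (2 * slope1 z p * slope2 z p - 1))"
    unfolding E slope_derivs[OF p] using hp alpha_nz by (simp add: field_simps power2_eq_square)
qed

lemma smooth_new_h: "smooth_on D (new_h h z)"
  unfolding new_h_def[abs_def]
  by (intro smooth_on_mult[OF D] smooth_on_minus[OF D] smooth_on_const[OF D] smooth_h smooth_slope)

lemma new_h_nz: "p \<in> D \<Longrightarrow> new_h h z p \<noteq> 0"
  using slope_neq h0 by (auto simp: new_h_def)

text \<open>Needed because the second transform is defined only over a solution of the Tzitzeica
  equation. After the Riccati equations are inserted, the single second derivative left is h_xy, and
  the equation for h removes it.\<close>

lemma tzitzeica_new_h: "tzitzeica_solution D (new_h h z)"
  unfolding tzitzeica_solution_def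
proof (intro conjI ballI smooth_new_h)
  fix p assume p: "p \<in> D"
  have hp: "h p \<noteq> 0" using h0 p by auto
  have tzp: "h p * dy (dx h) p = (h p)^3 - 1 + dx h p * dy h p"
    using tz p by (auto simp: tzitzeica_solution_def algebra_simps)
  define a b where "a = slope1 z p" and "b = slope2 z p"
  note smy = smooth_on_has_real_partials(2)[OF _ p]
  let ?f = "\<lambda>q. dx h q * (2 * slope1 z q * slope2 z q - 1)
      + 2 * \<alpha> * h q * ((slope2 z q)^2 - slope1 z q * (2 * slope1 z q * slope2 z q - 1))"
  have "dy (dx (new_h h z)) p = dy ?f p"
    by (rule dx_dy_cong(2)[OF D p], rule new_h_derivs(1))
  also have "((\<lambda>t. ?f (fst p, t)) has_real_derivative
      dy (dx h) p * (2 * a * b - 1) + dx h p * (2 * (dy (slope1 z) p * b + a * dy (slope2 z) p))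
      + 2 * \<alpha> * dy h p * (b^2 - a * (2 * a * b - 1))
      + 2 * \<alpha> * h p * (2 * b * dy (slope2 z) p - dy (slope1 z) p * (2 * a * b - 1)
          - a * (2 * (dy (slope1 z) p * b + a * dy (slope2 z) p)))) (at (snd p))"
    unfolding a_def b_def
    by (rule derivative_eq_intros smy[OF smooth_h] smy[OF smooth_slope(1)] smy[OF smooth_slope(2)]
        smy[OF smooth_on_dx_dy(1)[OF D smooth_h]] refl)+ (simp add: algebra_simps)
  then have "dy ?f p = dy (dx h) p * (2 * a * b - 1) + dx h p * (2 * (dy (slope1 z) p * b + a * dy (slope2 z) p))
      + 2 * \<alpha> * dy h p * (b^2 - a * (2 * a * b - 1))
      + 2 * \<alpha> * h p * (2 * b * dy (slope2 z) p - dy (slope1 z) p * (2 * a * b - 1)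
          - a * (2 * (dy (slope1 z) p * b + a * dy (slope2 z) p)))"
    unfolding dy_def[of ?f] has_real_derivative_iff_has_vector_derivative by (rule vector_derivative_at)
  finally have E: "dy (dx (new_h h z)) p = dy (dx h) p * (2 * a * b - 1)
      + dx h p * (2 * (dy (slope1 z) p * b + a * dy (slope2 z) p))
      + 2 * \<alpha> * dy h p * (b^2 - a * (2 * a * b - 1))
      + 2 * \<alpha> * h p * (2 * b * dy (slope2 z) p - dy (slope1 z) p * (2 * a * b - 1)
          - a * (2 * (dy (slope1 z) p * b + a * dy (slope2 z) p)))" .
  \<comment> \<open>Multiplication by h exposes the product h h_xy, the form in which
    \<open>tzp\<close> replaces it.\<close>
  have xy: "h p * dy (dx (new_h h z)) p = (h p * dy (dx h) p) * (2 * a * b - 1)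
      + h p * (dx h p * (2 * (dy (slope1 z) p * b + a * dy (slope2 z) p))
      + 2 * \<alpha> * dy h p * (b^2 - a * (2 * a * b - 1))
      + 2 * \<alpha> * h p * (2 * b * dy (slope2 z) p - dy (slope1 z) p * (2 * a * b - 1)
          - a * (2 * (dy (slope1 z) p * b + a * dy (slope2 z) p))))"
    unfolding E by (simp add: algebra_simps)
  have "new_h h z p * dy (dx (new_h h z)) p = (2 * a * b - 1) * (h p * dy (dx (new_h h z)) p)"
    by (simp add: new_h_def a_def b_def)
  then show "new_h h z p * dy (dx (new_h h z)) p - dx (new_h h z) p * dy (new_h h z) p = new_h h z p ^ 3 - 1"
    unfolding xy tzp new_h_derivs[OF p] slope_derivs[OF p] new_h_def a_def[symmetric] b_def[symmetric]
    using hp alpha_nz apply (simp add: divide_simps) apply algebra done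
qed

text \<open>The gauge equations are applied along the horizontal and the vertical line through each
  point. The condition on l keeps away from the poles of the inverse.\<close>

lemma frame_new_frame:
  fixes u :: "3 \<Rightarrow> real \<times> real \<Rightarrow> 'b::real_normed_vector"
  assumes u: "frame D h l u" and l: "l^3 \<noteq> - (\<alpha>^3)"
  shows "frame D (new_h h z) l (new_frame \<alpha> z l u)"
proof -
  have l0: "l \<noteq> 0" and sm: "smooth_on D (u j)" for j
    using u by (auto simp: frame_def)
  have smn: "smooth_on D (new_frame \<alpha> z l u j)" for j
    unfolding new_frame_def[abs_def]
    by (intro smooth_on_sum smooth_on_scaleR D smooth_on_simple_inv smooth_slope slope_neq sm) auto
  show ?thesis
    unfolding frame_def
  proof (intro conjI ballI allI l0 smn)
    fix p j assume p: "p \<in> D"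
    have hp: "h p \<noteq> 0" and d: "2 * slope1 z p * slope2 z p - 1 \<noteq> 0"
      using h0 slope_neq[OF p] p by auto
    note smx = smooth_on_has_real_partials(1)[OF _ p]
    note smy = smooth_on_has_real_partials(2)[OF _ p]
    \<comment> \<open>The diagonal entry produced by \<open>gauge_x\<close> is recognised as the
      logarithmic x-derivative of the new h.\<close>
    have H: "dx (new_h h z) p / new_h h z p = dx h p / h p
        + 2 * (dx (slope1 z) p * slope2 z p + slope1 z p * dx (slope2 z) p) / (2 * slope1 z p * slope2 z p - 1)"
      unfolding new_h_derivs[OF p] slope_derivs[OF p] new_h_def using hp d
      by (simp add: divide_simps) algebra
    have gx: "simple_inv_deriv \<alpha> (slope1 z p) (slope2 z p) (dx (slope1 z) p) (dx (slope2 z) p) l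
        + frame_x (dx h p / h p) l ** simple_inv \<alpha> (slope1 z p) (slope2 z p) l
      = simple_inv \<alpha> (slope1 z p) (slope2 z p) l ** frame_x (dx (new_h h z) p / new_h h z p) l"
      unfolding H unfolding slope_derivs[OF p] by (rule gauge_x[OF slope_neq[OF p] l])
    have gy: "simple_inv_deriv \<alpha> (slope1 z p) (slope2 z p) (dy (slope1 z) p) (dy (slope2 z) p) l
        + frame_y (h p) l ** simple_inv \<alpha> (slope1 z p) (slope2 z p) l
      = simple_inv \<alpha> (slope1 z p) (slope2 z p) l ** frame_y (new_h h z p) l"
      unfolding new_h_def slope_derivs[OF p] by (rule gauge_y[OF slope_neq[OF p] l alpha_nz l0 hp])
    have ux: "((\<lambda>t. u j (t, snd p)) has_vector_derivative
        (\<Sum>i\<in>UNIV. frame_x (dx h p / h p) l $ i $ j *\<^sub>R u i (fst p, snd p))) (at (fst p))" for j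
      using smooth_on_has_partials(1)[OF sm p, of j] u p by (simp add: frame_def)
    have uy: "((\<lambda>t. u j (fst p, t)) has_vector_derivative
        (\<Sum>i\<in>UNIV. frame_y (h p) l $ i $ j *\<^sub>R u i (fst p, snd p))) (at (snd p))" for j
      using smooth_on_has_partials(2)[OF sm p, of j] u p by (simp add: frame_def)
    have Cx: "((\<lambda>t. simple_inv \<alpha> (slope1 z (t, snd p)) (slope2 z (t, snd p)) l $ i $ j) has_real_derivative
        simple_inv_deriv \<alpha> (slope1 z p) (slope2 z p) (dx (slope1 z) p) (dx (slope2 z) p) l $ i $ j) (at (fst p))" for i j
      using simple_inv_has_derivative[OF smx[OF smooth_slope(1)] smx[OF smooth_slope(2)]] slope_neq[OF p] by simp
    have Cy: "((\<lambda>t. simple_inv \<alpha> (slope1 z (fst p, t)) (slope2 z (fst p, t)) l $ i $ j) has_real_derivative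
        simple_inv_deriv \<alpha> (slope1 z p) (slope2 z p) (dy (slope1 z) p) (dy (slope2 z) p) l $ i $ j) (at (snd p))" for i j
      using simple_inv_has_derivative[OF smy[OF smooth_slope(1)] smy[OF smooth_slope(2)]] slope_neq[OF p] by simp
    show "dx (new_frame \<alpha> z l u j) p =
        (\<Sum>i\<in>UNIV. frame_x (dx (new_h h z) p / new_h h z p) l $ i $ j *\<^sub>R new_frame \<alpha> z l u i p)"
      unfolding dx_def[of "new_frame \<alpha> z l u j"] new_frame_def
      using gauge_has_vector_derivative[OF ux Cx, of "frame_x (dx (new_h h z) p / new_h h z p) l" j] gx
      by (intro vector_derivative_at) simp
    show "dy (new_frame \<alpha> z l u j) p =
        (\<Sum>i\<in>UNIV. frame_y (new_h h z p) l $ i $ j *\<^sub>R new_frame \<alpha> z l u i p)"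
      unfolding dy_def[of "new_frame \<alpha> z l u j"] new_frame_def
      using gauge_has_vector_derivative[OF uy Cy, of "frame_y (new_h h z p) l" j] gy
      by (intro vector_derivative_at) simp
  qed
qed

text \<open>Here (ln z_3)_x = \<alpha> a and \<alpha> a_y = h (1 - ab), so h - 2 h (1 - ab) = h (2ab
  - 1).\<close>

lemma transform_h_eq:
  assumes p: "p \<in> D"
  shows "transform_h h (z 3) p = new_h h z p"
proof -
  have "lnx (z 3) q = \<alpha> *\<^sub>R slope1 z q" if "q \<in> D" for q
    using frameD(3)[OF z that] by (simp add: lnx_def slope1_def)
  then have "dy (lnx (z 3)) p = dy (\<lambda>q. \<alpha> *\<^sub>R slope1 z q) p"
    by (rule dx_dy_cong(2)[OF D p])
  also have "\<dots> = \<alpha> *\<^sub>R dy (slope1 z) p"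
    using dx_scaleR_dy_scaleR(2)[OF smooth_on_const[OF D, of \<alpha>] smooth_slope(1) p] by (simp add: dy_def)
  finally show ?thesis
    unfolding transform_h_def slope_derivs[OF p] new_h_def using alpha_nz by (simp add: algebra_simps)
qed

text \<open>The third column of the inverse simple element, contracted with u_1 = X_x / l, u_2 = l
  X_y / h and u_3 = X, is the formula of the transform.\<close>

lemma transform_X_eq:
  fixes u :: "3 \<Rightarrow> real \<times> real \<Rightarrow> 'b::real_normed_vector"
  assumes p: "p \<in> D" and u: "frame D h l u" and l: "l^3 \<noteq> - (\<alpha>^3)"
  shows "transform_X h (l^3) (u 3) (\<alpha>^3) (z 3) p = new_frame \<alpha> z l u 3 p"
proof -
  have nz: "h p \<noteq> 0" "z 3 p \<noteq> 0" "l \<noteq> 0" "l^3 + \<alpha>^3 \<noteq> 0"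
    using h0 z0 p u l by (auto simp: frame_def)
  have ln: "lnx (z 3) p = \<alpha> * slope1 z p" "lny (z 3) p = h p / \<alpha> * slope2 z p"
    using frameD(3,6)[OF z p] by (simp_all add: lnx_def lny_def slope1_def slope2_def)
  \<comment> \<open>The bottom diagonal entry of the inverse is the coefficient (\<gamma> -
    \<delta>) / (\<gamma> + \<delta>) of X.\<close>
  have "1 - 2 * \<alpha>^3 / (l^3 + \<alpha>^3) = (l^3 - \<alpha>^3) / (l^3 + \<alpha>^3)"
    using nz by (simp add: divide_simps)
  then show ?thesis
    unfolding transform_X_def ln frameD(3,6)[OF u p]
    using nz alpha_nz
    by (simp add: new_frame_def simple_inv_def simple_inv_num_def Let_def sum_3 mat_def scaleR_right_distrib
        scaleR_diff_right power2_eq_square power3_eq_cube mult_ac)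
qed

end

text \<open>Pairing the columns of F at \<alpha> with a fixed row vector gives a scalar-valued
  frame; its third entry is the potential \<phi>.\<close>

lemma frame_linear:
  assumes D: "open D" and L: "bounded_linear L" and u: "frame D h l u"
  shows "frame D h l (\<lambda>j p. L (u j p))"
proof -
  have sm: "smooth_on D (u j)" and l: "l \<noteq> 0" for j using u by (auto simp: frame_def)
  have d: "dx (\<lambda>p. L (u j p)) p = L (dx (u j) p)" "dy (\<lambda>p. L (u j p)) p = L (dy (u j) p)" if "p \<in> D" for j p
    unfolding dx_def[of "\<lambda>p. L (u j p)"] dy_def[of "\<lambda>p. L (u j p)"]
    using bounded_linear.has_vector_derivative[OF L smooth_on_has_partials(1)[OF sm that, of j]]
      bounded_linear.has_vector_derivative[OF L smooth_on_has_partials(2)[OF sm that, of j]]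
    by (auto intro: vector_derivative_at)
  have lin: "L (\<Sum>i\<in>UNIV. c i *\<^sub>R x i) = (\<Sum>i\<in>UNIV. c i *\<^sub>R L (x i))" for c x
    using bounded_linear.linear[OF L] by (simp add: linear_sum linear_scale)
  show ?thesis
    unfolding frame_def using u sm l D L
    by (simp add: d frame_def lin smooth_on_linear)
qed

text \<open>The transforms agree with the gauged data only on D, so all notions must be insensitive
  to values outside D.\<close>

lemma tzitzeica_solution_cong:
  assumes D: "open D" and eq: "\<And>p. p \<in> D \<Longrightarrow> h p = h' p" and tz: "tzitzeica_solution D h"
  shows "tzitzeica_solution D h'"
proof -
  have d: "dx h p = dx h' p" "dy h p = dy h' p" if "p \<in> D" for p
    using dx_dy_cong[OF D that eq] by auto
  have "dy (dx h) p = dy (dx h') p" if "p \<in> D" for p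
    using dx_dy_cong(2)[OF D that d(1)] .
  then show ?thesis
    using tz d eq smooth_on_cong[OF D eq] by (auto simp: tzitzeica_solution_def)
qed

lemma star_solution_cong:
  assumes D: "open D" and eq: "\<And>p. p \<in> D \<Longrightarrow> h p = h' p" "\<And>p. p \<in> D \<Longrightarrow> X p = X' p"
    and star: "star_solution D h \<gamma> X"
  shows "star_solution D h' \<gamma> X'"
proof -
  have d: "dx h p = dx h' p" "dy h p = dy h' p" "dx X p = dx X' p" "dy X p = dy X' p" if "p \<in> D" for p
    using dx_dy_cong[OF D that eq(1)] dx_dy_cong[OF D that eq(2)] by auto
  have dd: "dx (dx X) p = dx (dx X') p" "dy (dx X) p = dy (dx X') p" "dy (dy X) p = dy (dy X') p" if "p \<in> D" for p
    using dx_dy_cong[OF D that d(3)] dx_dy_cong[OF D that d(4)] by auto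
  show ?thesis
    unfolding star_solution_def
  proof (intro conjI ballI)
    show "\<gamma> \<noteq> 0" "smooth_on D X'"
      using star smooth_on_cong[OF D eq(2)] by (auto simp: star_solution_def)
    fix p assume p: "p \<in> D"
    show "dx (dx X') p = (dx h' p / h' p) *\<^sub>R dx X' p + (\<gamma> / h' p) *\<^sub>R dy X' p"
      "dy (dx X') p = h' p *\<^sub>R X' p"
      "dy (dy X') p = (1 / (\<gamma> * h' p)) *\<^sub>R dx X' p + (dy h' p / h' p) *\<^sub>R dy X' p"
      using star p unfolding star_solution_def d(1)[OF p, symmetric] d(2)[OF p, symmetric] d(3)[OF p, symmetric]
        d(4)[OF p, symmetric] dd(1)[OF p, symmetric] dd(2)[OF p, symmetric] dd(3)[OF p, symmetric]
        eq(1)[OF p, symmetric] eq(2)[OF p, symmetric]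
      by blast+
  qed
qed

lemma transform_h_cong:
  assumes D: "open D" and eq: "\<And>p. p \<in> D \<Longrightarrow> h p = h' p" "\<And>p. p \<in> D \<Longrightarrow> \<phi> p = \<phi>' p" and p: "p \<in> D"
  shows "transform_h h \<phi> p = transform_h h' \<phi>' p"
proof -
  have "lnx \<phi> q = lnx \<phi>' q" if "q \<in> D" for q
    using dx_dy_cong(1)[OF D that eq(2)] eq(2)[OF that] by (simp add: lnx_def)
  then have "dy (lnx \<phi>) p = dy (lnx \<phi>') p"
    by (rule dx_dy_cong(2)[OF D p])
  then show ?thesis using eq(1)[OF p] by (simp add: transform_h_def)
qed

lemma transform_X_cong:
  assumes D: "open D" and eq: "\<And>p. p \<in> D \<Longrightarrow> h p = h' p" "\<And>p. p \<in> D \<Longrightarrow> X p = X' p"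
      "\<And>p. p \<in> D \<Longrightarrow> \<phi> p = \<phi>' p" and p: "p \<in> D"
  shows "transform_X h \<gamma> X \<delta> \<phi> p = transform_X h' \<gamma> X' \<delta> \<phi>' p"
  using dx_dy_cong[OF D p eq(2)] dx_dy_cong[OF D p eq(3)] eq p
  by (simp add: transform_X_def lnx_def lny_def)

text \<open>The row spans a line outside \<open>Delta0\<close> at every point of D.\<close>

definition nondegenerate :: "(real \<times> real) set \<Rightarrow> (3 \<Rightarrow> real \<times> real \<Rightarrow> real) \<Rightarrow> bool" where
  "nondegenerate D z \<longleftrightarrow> (\<forall>p\<in>D. z 3 p \<noteq> 0 \<and> 2 * z 1 p * z 2 p \<noteq> (z 3 p)^2)"

lemma frame_transform_defined:
  fixes u :: "3 \<Rightarrow> real \<times> real \<Rightarrow> 'b::real_normed_vector"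
  assumes D: "open D" and tz: "tzitzeica_solution D h" and h0: "\<forall>p\<in>D. h p \<noteq> 0"
    and z: "frame D h \<alpha> z" "nondegenerate D z" and u: "frame D h l u" and l: "l^3 \<noteq> - (\<alpha>^3)"
  shows "transform_defined D h (l^3) (u 3) (\<alpha>^3) (z 3)"
  unfolding transform_defined_def
  using assms frame_star_solution[OF D _ h0 z(1)] frame_star_solution[OF D _ h0 u]
  by (auto simp: nondegenerate_def tzitzeica_solution_def eq_neg_iff_add_eq_0)

text \<open>The scalar \<phi>_ij is a transform itself: it is the third entry of the row frame
  \<open>w\<close>, obtained by gauging y at its own parameter \<beta>. So the second step is the
  first one again, over the new h and with \<open>w\<close> in place of z.\<close>

lemma two_step_transform:
  fixes u :: "3 \<Rightarrow> real \<times> real \<Rightarrow> 'b::real_normed_vector"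
  assumes D: "open D" and tz: "tzitzeica_solution D h" and h0: "\<forall>p\<in>D. h p \<noteq> 0"
    and z: "frame D h \<alpha> z" "nondegenerate D z" and y: "frame D h \<beta> y" and u: "frame D h l u"
    and neq: "\<beta>^3 \<noteq> - (\<alpha>^3)" "l^3 \<noteq> - (\<alpha>^3)" "l^3 \<noteq> - (\<beta>^3)"
  defines "w \<equiv> new_frame \<alpha> z \<beta> y"
  defines "h' \<equiv> transform_h h (z 3)" and "X' \<equiv> transform_X h (l^3) (u 3) (\<alpha>^3) (z 3)"
    and "\<psi> \<equiv> transform_X h (\<beta>^3) (y 3) (\<alpha>^3) (z 3)"
  assumes w: "nondegenerate D w"
  shows "transform_defined D h' (l^3) X' (\<beta>^3) \<psi>"
    and "p \<in> D \<Longrightarrow> transform_X h' (l^3) X' (\<beta>^3) \<psi> p = new_frame \<beta> w l (new_frame \<alpha> z l u) 3 p"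
    and "p \<in> D \<Longrightarrow> transform_h h' \<psi> p = new_h (new_h h z) w p"
proof -
  note z0 = z(2)[unfolded nondegenerate_def]
  note w0 = w[unfolded nondegenerate_def]
  have eq: "h' p = new_h h z p" "X' p = new_frame \<alpha> z l u 3 p" "\<psi> p = w 3 p" if "p \<in> D" for p
    unfolding h'_def X'_def \<psi>_def w_def
    using transform_h_eq[OF D tz h0 z(1) z0 that] transform_X_eq[OF D tz h0 z(1) z0 that u neq(2)]
      transform_X_eq[OF D tz h0 z(1) z0 that y neq(1)] by simp_all
  have tz': "tzitzeica_solution D (new_h h z)" by (rule tzitzeica_new_h[OF D tz h0 z(1) z0])
  have h0': "\<forall>p\<in>D. new_h h z p \<noteq> 0" using new_h_nz[OF D tz h0 z(1) z0] by blast
  have fw: "frame D (new_h h z) \<beta> w" unfolding w_def by (rule frame_new_frame[OF D tz h0 z(1) z0 y neq(1)])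
  have fu: "frame D (new_h h z) l (new_frame \<alpha> z l u)" by (rule frame_new_frame[OF D tz h0 z(1) z0 u neq(2)])
  note td = frame_transform_defined[OF D tz' h0' fw w fu neq(3)]
  show "transform_defined D h' (l^3) X' (\<beta>^3) \<psi>"
    unfolding transform_defined_def
  proof (intro conjI)
    show "tzitzeica_solution D h'"
      by (rule tzitzeica_solution_cong[OF D eq(1)[symmetric] tz'])
    show "\<forall>p\<in>D. h' p \<noteq> 0" "\<forall>p\<in>D. \<psi> p \<noteq> 0"
      using eq h0' w0 by auto
    show "star_solution D h' (l^3) X'"
      by (rule star_solution_cong[OF D eq(1)[symmetric] eq(2)[symmetric]])
        (use td in \<open>simp_all add: transform_defined_def\<close>)
    show "star_solution D h' (\<beta>^3) \<psi>"
      by (rule star_solution_cong[OF D eq(1)[symmetric] eq(3)[symmetric]])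
        (use td in \<open>simp_all add: transform_defined_def\<close>)
    show "l^3 + \<beta>^3 \<noteq> 0" using neq(3) by (simp add: eq_neg_iff_add_eq_0)
  qed
  show "transform_X h' (l^3) X' (\<beta>^3) \<psi> p = new_frame \<beta> w l (new_frame \<alpha> z l u) 3 p" if p: "p \<in> D"
    using transform_X_cong[OF D eq p] transform_X_eq[OF D tz' h0' fw w0 p fu neq(3)] by simp
  show "transform_h h' \<psi> p = new_h (new_h h z) w p" if p: "p \<in> D"
    using transform_h_cong[OF D eq(1,3) p] transform_h_eq[OF D tz' h0' fw w0 p] by simp
qed

text \<open>Translates gauging of a row frame at one point into transport of its normalized line;
  the scale factor is the ratio of third entries.\<close>

lemma row_mult_simple_inv_slopes:
  assumes "z 3 p \<noteq> 0" "w 3 p \<noteq> 0" and w: "\<And>j. w j p = (\<Sum>i\<in>UNIV. z i p * C $ i $ j)"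
  shows "vector [slope1 z p, slope2 z p, 1] v* C = (w 3 p / z 3 p) *s vector [slope1 w p, slope2 w p, 1]"
proof -
  have v: "vector [slope1 v p, slope2 v p, 1] $ i = v i p / v 3 p" if "v 3 p \<noteq> 0" for v i
    using that exhaust_3[of i] by (auto simp: slope1_def slope2_def)
  have "(vector [slope1 z p, slope2 z p, 1] v* C) $ j = w j p / z 3 p" for j
    by (simp add: vector_matrix_mult_def v assms(1) w sum_divide_distrib mult.commute)
  then show ?thesis
    using assms(2) by (simp add: vec_eq_iff v)
qed

text \<open>At a fixed point, the slopes of z and y are the two original lines of the exchange
  identity, and those of \<open>yz\<close> and \<open>zy\<close> are their transports. Hence both
  orders of gauging multiply u by the same matrix.\<close>

lemma permute_new_frames:
  fixes u :: "3 \<Rightarrow> 'a \<Rightarrow> 'b::real_normed_vector" and y z :: "3 \<Rightarrow> 'a \<Rightarrow> real"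
  assumes neq: "\<alpha>^3 + \<beta>^3 \<noteq> 0" "l^3 \<noteq> - (\<alpha>^3)" "l^3 \<noteq> - (\<beta>^3)"
  defines "zy \<equiv> new_frame \<alpha> z \<beta> y" and "yz \<equiv> new_frame \<beta> y \<alpha> z"
  assumes nd: "z 3 p \<noteq> 0" "2 * z 1 p * z 2 p \<noteq> (z 3 p)^2" "y 3 p \<noteq> 0" "2 * y 1 p * y 2 p \<noteq> (y 3 p)^2"
    "zy 3 p \<noteq> 0" "2 * zy 1 p * zy 2 p \<noteq> (zy 3 p)^2" "yz 3 p \<noteq> 0" "2 * yz 1 p * yz 2 p \<noteq> (yz 3 p)^2"
  shows "new_frame \<beta> zy l (new_frame \<alpha> z l u) j p = new_frame \<alpha> yz l (new_frame \<beta> y l u) j p"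
    and "\<alpha> \<noteq> 0 \<Longrightarrow> \<beta> \<noteq> 0 \<Longrightarrow> new_h (new_h h z) zy p = new_h (new_h h y) yz p"
proof -
  have sl: "2 * slope1 v p * slope2 v p \<noteq> 1" if "v 3 p \<noteq> 0" "2 * v 1 p * v 2 p \<noteq> (v 3 p)^2" for v :: "3 \<Rightarrow> 'a \<Rightarrow> real"
    using that by (auto simp: slope1_def slope2_def power2_eq_square)
  have r1: "vector [slope1 z p, slope2 z p, 1] v* simple_inv \<beta> (slope1 y p) (slope2 y p) \<alpha>
      = (yz 3 p / z 3 p) *s vector [slope1 yz p, slope2 yz p, 1]"
    by (rule row_mult_simple_inv_slopes[of z p yz, OF nd(1) nd(7)]) (simp add: yz_def new_frame_def mult.commute)
  have r2: "vector [slope1 y p, slope2 y p, 1] v* simple_inv \<alpha> (slope1 z p) (slope2 z p) \<beta>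
      = (zy 3 p / y 3 p) *s vector [slope1 zy p, slope2 zy p, 1]"
    by (rule row_mult_simple_inv_slopes[of y p zy, OF nd(3) nd(5)]) (simp add: zy_def new_frame_def mult.commute)
  have k: "yz 3 p / z 3 p \<noteq> 0" "zy 3 p / y 3 p \<noteq> 0" using nd by auto
  note ex = simple_inv_exchange[OF neq(1) sl[of z, OF nd(1,2)] sl[of y, OF nd(3,4)] sl[of yz, OF nd(7,8)] k r1 r2]
  have comp: "new_frame b w l (new_frame a v l u) j p =
      (\<Sum>k\<in>UNIV. (simple_inv a (slope1 v p) (slope2 v p) l ** simple_inv b (slope1 w p) (slope2 w p) l) $ k $ j *\<^sub>R u k p)"
    for a b v w
    unfolding new_frame_def matrix_matrix_mult_def vec_lambda_beta scaleR_sum_right scaleR_sum_left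
    by (subst sum.swap) (simp add: mult.commute)
  show "new_frame \<beta> zy l (new_frame \<alpha> z l u) j p = new_frame \<alpha> yz l (new_frame \<beta> y l u) j p"
    unfolding comp ex[OF neq(2,3)] ..
  assume ab: "\<alpha> \<noteq> 0" "\<beta> \<noteq> 0"
  \<comment> \<open>At l = 0 the inverse is diagonal with first entry 1 - 2ab, and the two signs
    cancel in the product.\<close>
  have at0: "(simple_inv a (slope1 v p) (slope2 v p) 0 ** simple_inv b (slope1 w p) (slope2 w p) 0) $ 1 $ 1
      = (2 * slope1 v p * slope2 v p - 1) * (2 * slope1 w p * slope2 w p - 1)" if "a \<noteq> 0" "b \<noteq> 0" for a b v w
    using that by (simp add: simple_inv_def simple_inv_num_def Let_def matrix_matrix_mult_def sum_3 mat_def algebra_simps)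
  have "simple_inv \<alpha> (slope1 z p) (slope2 z p) 0 ** simple_inv \<beta> (slope1 zy p) (slope2 zy p) 0 =
    simple_inv \<beta> (slope1 y p) (slope2 y p) 0 ** simple_inv \<alpha> (slope1 yz p) (slope2 yz p) 0"
    using ab by (intro ex) auto
  then have "(2 * slope1 z p * slope2 z p - 1) * (2 * slope1 zy p * slope2 zy p - 1)
      = (2 * slope1 y p * slope2 y p - 1) * (2 * slope1 yz p * slope2 yz p - 1)"
    using at0 ab by metis
  then show "new_h (new_h h z) zy p = new_h (new_h h y) yz p"
    by (simp add: new_h_def)
qed

section \<open>Loops and uniqueness of the dressing factor\<close>

lemma eps_square: "eps^2 = eps - 1"
  and eps_cube: "eps^3 = - 1"
  and cmod_eps [simp]: "cmod eps = 1"
proof -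
  have e: "eps = Complex (1 / 2) (sqrt 3 / 2)"
    by (simp add: eps_def complex_eq_iff Re_exp Im_exp cos_60 sin_60)
  show sq: "eps^2 = eps - 1"
    by (simp add: e complex_eq_iff power2_eq_square)
  have "eps^3 = eps * eps^2" by (simp add: power3_eq_cube power2_eq_square)
  also have "\<dots> = eps^2 - eps" by (subst sq) (simp add: algebra_simps power2_eq_square)
  finally show "eps^3 = - 1" by (simp add: sq)
  show "cmod eps = 1"
    by (simp add: eps_def)
qed

lemma eps_neq_0 [simp]: "eps \<noteq> 0"
  using cmod_eps by fastforce

lemma eps_mult_cube: "(eps * l)^3 = - (l^3)"
  by (simp add: power_mult_distrib eps_cube)

lemma T_mat_entries:
  "T_mat $ 1 $ 1 = 0" "T_mat $ 1 $ 2 = 1" "T_mat $ 1 $ 3 = 0"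
  "T_mat $ 2 $ 1 = - eps" "T_mat $ 2 $ 2 = 0" "T_mat $ 2 $ 3 = 0"
  "T_mat $ 3 $ 1 = 0" "T_mat $ 3 $ 2 = 0" "T_mat $ 3 $ 3 = eps^2"
  by (simp_all add: T_mat_def)

lemma invertible_T_mat: "invertible T_mat"
  by (simp add: invertible_det_nz det_3 T_mat_entries)

lemma matrix_inv_mult:
  fixes A :: "'a::field^'n^'n"
  assumes "invertible A"
  shows "matrix_inv A ** A = mat 1" "A ** matrix_inv A = mat 1"
    "B ** matrix_inv A ** A = B" "B ** A ** matrix_inv A = B"
proof -
  have "A ** matrix_inv A = mat 1 \<and> matrix_inv A ** A = mat 1"
    using assms unfolding invertible_def matrix_inv_def by (rule someI_ex)
  then show "matrix_inv A ** A = mat 1" "A ** matrix_inv A = mat 1"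
    "B ** matrix_inv A ** A = B" "B ** A ** matrix_inv A = B"
    by (simp_all add: matrix_mul_assoc[symmetric])
qed

text \<open>The form without inverses: it telescopes in products, and its entries are continuous for
  continuous loops, so it extends across removed poles.\<close>

lemma sigma_eq_iff:
  assumes "invertible g"
  shows "sigma g = g' \<longleftrightarrow> g' ** T_mat ** transpose g = T_mat"
proof -
  have t: "invertible (transpose g)"
    using assms by (simp add: invertible_det_nz)
  show ?thesis
  proof
    show "g' ** T_mat ** transpose g = T_mat" if "sigma g = g'"
      unfolding that[symmetric] sigma_def
      by (simp add: matrix_inv_mult t invertible_T_mat)
    assume a: "g' ** T_mat ** transpose g = T_mat"
    show "sigma g = g'"
      unfolding sigma_def by (subst a[symmetric]) (simp add: matrix_inv_mult t invertible_T_mat)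
  qed
qed

lemma tau_sigma_on_iff:
  assumes "\<forall>l\<in>S. invertible (g l)"
  shows "tau_sigma_on S g \<longleftrightarrow>
    (\<forall>l\<in>S. cnj_mat (g (cnj l)) = g l \<and> g (eps * l) ** T_mat ** transpose (g l) = T_mat)"
  unfolding tau_sigma_on_def using assms sigma_eq_iff by blast

lemma cnj_mat_mult: "cnj_mat (A ** B) = cnj_mat A ** cnj_mat B"
  by (simp add: cnj_mat_def vec_eq_iff matrix_matrix_mult_def)

lemma open_near_0_inf: "open (near_0_inf r)"
  unfolding near_0_inf_def
  by (intro open_Collect_disj open_Collect_less continuous_intros)

lemma mat_holomorphic_on_mult:
  assumes "mat_holomorphic_on f S" "mat_holomorphic_on g S"
  shows "mat_holomorphic_on (\<lambda>l. f l ** g l) S"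
  using assms unfolding mat_holomorphic_on_def matrix_matrix_mult_def
  by (auto intro!: holomorphic_intros)

lemma Lambda_minus_mult:
  assumes f: "f \<in> Lambda_minus_GL r" and g: "g \<in> Lambda_minus_GL r"
  shows "loop_mult f g \<in> Lambda_minus_GL r"
proof -
  have inv: "\<forall>l\<in>near_0_inf r. invertible (f l)" "\<forall>l\<in>near_0_inf r. invertible (g l)"
    using f g by (auto simp: Lambda_minus_GL_def)
  note fT = f[unfolded Lambda_minus_GL_def mem_Collect_eq tau_sigma_on_iff[of "near_0_inf r" f, OF inv(1)]]
  note gT = g[unfolded Lambda_minus_GL_def mem_Collect_eq tau_sigma_on_iff[of "near_0_inf r" g, OF inv(2)]]
  have chart: "(\<lambda>w. if w = 0 then mat 1 else loop_mult f g (inverse w)) =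
      (\<lambda>w. (if w = 0 then mat 1 else f (inverse w)) ** (if w = 0 then mat 1 else g (inverse w)))"
    by (auto simp: loop_mult_def)
  have inv2: "\<forall>l\<in>near_0_inf r. invertible (loop_mult f g l)"
    using inv by (simp add: loop_mult_def invertible_mult)
  have "loop_mult f g (eps * l) ** T_mat ** transpose (loop_mult f g l) = T_mat" if "l \<in> near_0_inf r" for l
  proof -
    have "f (eps * l) ** (g (eps * l) ** T_mat ** transpose (g l)) ** transpose (f l) = T_mat"
      using fT gT that by simp
    then show ?thesis
      by (simp add: loop_mult_def matrix_transpose_mul matrix_mul_assoc)
  qed
  moreover have "cnj_mat (loop_mult f g (cnj l)) = loop_mult f g l" if "l \<in> near_0_inf r" for l
    using fT gT that by (simp add: loop_mult_def cnj_mat_mult)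
  ultimately show ?thesis
    unfolding Lambda_minus_GL_def mem_Collect_eq tau_sigma_on_iff[of "near_0_inf r" "loop_mult f g", OF inv2] chart
    using fT gT inv2 unfolding loop_mult_def by (simp add: mat_holomorphic_on_mult)
qed

section \<open>Holomorphic inverse matrices\<close>

definition adjugate3 :: "'a::field^3^3 \<Rightarrow> 'a^3^3" where
  "adjugate3 A = vector
    [vector [A$2$2 * A$3$3 - A$2$3 * A$3$2, A$1$3 * A$3$2 - A$1$2 * A$3$3, A$1$2 * A$2$3 - A$1$3 * A$2$2],
     vector [A$2$3 * A$3$1 - A$2$1 * A$3$3, A$1$1 * A$3$3 - A$1$3 * A$3$1, A$1$3 * A$2$1 - A$1$1 * A$2$3],
     vector [A$2$1 * A$3$2 - A$2$2 * A$3$1, A$1$2 * A$3$1 - A$1$1 * A$3$2, A$1$1 * A$2$2 - A$1$2 * A$2$1]]"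

lemma matrix_inv_eqI:
  fixes A B :: "'a::field^'n^'n"
  assumes "A ** B = mat 1"
  shows "matrix_inv A = B"
proof -
  have "invertible A"
    using assms by (auto simp: invertible_right_inverse)
  then have "matrix_inv A ** (A ** B) = B"
    by (simp add: matrix_mul_assoc matrix_inv_mult)
  then show ?thesis by (simp add: assms)
qed

text \<open>Cramer's rule makes each entry of the inverse a polynomial in the entries over the
  determinant, hence visibly holomorphic.\<close>

lemma matrix_inv_adjugate3:
  fixes A :: "'a::field^3^3"
  assumes "invertible A"
  shows "matrix_inv A = (\<chi> i j. adjugate3 A $ i $ j / det A)"
proof (rule matrix_inv_eqI)
  have nz: "det A \<noteq> 0"
    using assms by (simp add: invertible_det_nz)
  have "\<forall>i j. (\<Sum>k\<in>UNIV. A $ i $ k * adjugate3 A $ k $ j) = (if i = j then det A else 0)"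
    unfolding forall_3 sum_3 adjugate3_def det_3 by (simp add: algebra_simps)
  then show "A ** (\<chi> i j. adjugate3 A $ i $ j / det A) = mat 1"
    using nz by (simp add: vec_eq_iff matrix_matrix_mult_def mat_def flip: sum_divide_distrib)
qed

lemma mat_holomorphic_on_inv:
  assumes f: "mat_holomorphic_on f S" and inv: "\<And>l. l \<in> S \<Longrightarrow> invertible (f l)"
  shows "mat_holomorphic_on (\<lambda>l. matrix_inv (f l)) S"
proof -
  have h: "(\<lambda>l. f l $ i $ j) holomorphic_on S" for i j
    using f by (simp add: mat_holomorphic_on_def)
  have "\<forall>i j. (\<lambda>l. adjugate3 (f l) $ i $ j / det (f l)) holomorphic_on S"
    unfolding forall_3 adjugate3_def det_3
    using inv by (auto intro!: holomorphic_intros h simp: invertible_det_nz det_3)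
  then have "(\<lambda>l. matrix_inv (f l) $ i $ j) holomorphic_on S" for i j
    by (subst holomorphic_cong[OF refl, of _ _ "\<lambda>l. adjugate3 (f l) $ i $ j / det (f l)"])
      (simp_all add: matrix_inv_adjugate3 inv)
  then show ?thesis
    by (simp add: mat_holomorphic_on_def)
qed

lemma Lambda_plusD:
  assumes "f \<in> Lambda_plus_SL" "l \<noteq> 0"
  shows "invertible (f l)" "det (f l) = 1" "cnj_mat (f (cnj l)) = f l"
    "f (eps * l) ** T_mat ** transpose (f l) = T_mat"
proof -
  have inv: "\<forall>l\<in>- {0}. invertible (f l)"
    using assms(1) by (simp add: Lambda_plus_SL_def invertible_det_nz)
  then show "invertible (f l)" using assms(2) by simp
  show "det (f l) = 1" "cnj_mat (f (cnj l)) = f l" "f (eps * l) ** T_mat ** transpose (f l) = T_mat"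
    using assms unfolding Lambda_plus_SL_def mem_Collect_eq tau_sigma_on_iff[of "- {0}" f, OF inv] by auto
qed

text \<open>Liouville: the quotient of two factors is entire and tends to the identity at infinity.\<close>

lemma dressing_factor_unique:
  assumes r: "0 < r" "r < 1" and f: "dressing_factor r g F f" and f': "dressing_factor r g F f'"
    and l: "l \<noteq> 0"
  shows "f l = f' l"
proof -
  obtain k where k: "k \<in> Lambda_minus_GL r" "\<And>l. l \<in> near_0_inf r - {0} \<Longrightarrow> g l ** F l = f l ** k l"
    and fp: "f \<in> Lambda_plus_SL"
    using f by (auto simp: dressing_factor_def)
  obtain k' where k': "k' \<in> Lambda_minus_GL r" "\<And>l. l \<in> near_0_inf r - {0} \<Longrightarrow> g l ** F l = f' l ** k' l"
    and fp': "f' \<in> Lambda_plus_SL"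
    using f' by (auto simp: dressing_factor_def)
  let ?N = "near_0_inf r"
  have hol: "mat_holomorphic_on f (- {0})" "mat_holomorphic_on f' (- {0})"
    using fp fp' by (auto simp: Lambda_plus_SL_def)
  have inv: "invertible (k l)" "mat_holomorphic_on k ?N" "mat_holomorphic_on k' ?N" if "l \<in> ?N" for l
    using k k' that by (auto simp: Lambda_minus_GL_def)
  \<comment> \<open>From f k = f' k' one gets f'^{-1} f = k' k^{-1}: the left side is holomorphic
    off 0, the right side near 0 and infinity. \<open>W\<close> glues them, taking its value at 0
    from the right side because factors have no meaningful value there.\<close>
  define U where "U l = matrix_inv (f' l) ** f l" for l
  define V where "V l = k' l ** matrix_inv (k l)" for l
  define W where "W l = (if l = 0 then V l else U l)" for l
  have UV: "U l = V l" if "l \<in> ?N - {0}" for l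
  proof -
    have "f l ** k l = f' l ** k' l" using k(2)[OF that] k'(2)[OF that] by simp
    then have "matrix_inv (f' l) ** (f l ** k l) ** matrix_inv (k l) = matrix_inv (f' l) ** (f' l ** k' l) ** matrix_inv (k l)"
      by simp
    then show ?thesis
      using Lambda_plusD(1)[OF fp'] inv(1) that unfolding U_def V_def
      by (simp add: matrix_mul_assoc matrix_inv_mult)
  qed
  have Uh: "mat_holomorphic_on U (- {0})"
    unfolding U_def using Lambda_plusD(1)[OF fp'] hol
    by (intro mat_holomorphic_on_mult mat_holomorphic_on_inv) auto
  have N0: "0 \<in> ?N" using r by (simp add: near_0_inf_def)
  have Vh: "mat_holomorphic_on V ?N"
    unfolding V_def using inv N0 by (intro mat_holomorphic_on_mult mat_holomorphic_on_inv) auto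
  have Wh: "(\<lambda>l. W l $ i $ j) holomorphic_on UNIV" for i j
  proof -
    have "(\<lambda>l. W l $ i $ j) holomorphic_on (- {0})"
      using Uh by (subst holomorphic_cong[OF refl, of _ _ "\<lambda>l. U l $ i $ j"])
        (auto simp: W_def mat_holomorphic_on_def)
    moreover have "(\<lambda>l. W l $ i $ j) holomorphic_on ?N"
      using Vh UV by (subst holomorphic_cong[OF refl, of _ _ "\<lambda>l. V l $ i $ j"])
        (auto simp: W_def mat_holomorphic_on_def)
    ultimately have "(\<lambda>l. W l $ i $ j) holomorphic_on (- {0} \<union> ?N)"
      by (intro holomorphic_on_Un open_near_0_inf) auto
    moreover have "- {0} \<union> ?N = UNIV" using N0 by auto
    ultimately show ?thesis by simp
  qed
  \<comment> \<open>The chart at infinity, where elements of the minus group extend with value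
    I.\<close>
  define c where "c h w = (if w = 0 then mat 1 else h (inverse w))" for h :: loop and w :: complex
  have ch: "mat_holomorphic_on (c k) (ball 0 r)" "mat_holomorphic_on (c k') (ball 0 r)"
    using k(1) k'(1) by (auto simp: Lambda_minus_GL_def c_def[abs_def])
  have inN: "inverse w \<in> ?N" if "w \<in> ball 0 r" "w \<noteq> 0" for w
  proof -
    have "1 / r < 1 / cmod w" using that r by (intro divide_strict_left_mono) auto
    then show ?thesis by (simp add: near_0_inf_def norm_inverse divide_inverse)
  qed
  have cinv: "invertible (c k w)" if "w \<in> ball 0 r" for w
    using inv(1)[OF inN[OF that]] by (auto simp: c_def invertible_det_nz)
  have lim: "((\<lambda>l. W l $ i $ j) \<longlongrightarrow> mat 1 $ i $ j) at_infinity" for i j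
  proof -
    let ?C = "\<lambda>w. (c k' w ** matrix_inv (c k w)) $ i $ j"
    have "?C holomorphic_on ball 0 r"
      using mat_holomorphic_on_mult[OF ch(2) mat_holomorphic_on_inv[OF ch(1) cinv]]
      by (auto simp: mat_holomorphic_on_def)
    then have "isCont ?C 0"
      using r by (auto dest!: holomorphic_on_imp_continuous_on simp: continuous_on_eq_continuous_at)
    then have "(?C \<longlongrightarrow> ?C 0) (at 0)" by (simp add: isCont_def)
    moreover have "?C 0 = mat 1 $ i $ j"
      using matrix_inv_eqI[of "mat 1 :: cmat" "mat 1"] by (simp add: c_def)
    moreover have "eventually (\<lambda>w. ?C w = ((\<lambda>l. W l $ i $ j) \<circ> inverse) w) (at 0)"
      unfolding eventually_at using r UV inN
      by (intro exI[of _ r]) (auto simp: c_def W_def V_def)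
    ultimately show ?thesis
      unfolding lim_at_infinity_0 using Lim_transform_eventually[of ?C "mat 1 $ i $ j" "at 0"] by simp
  qed
  have "W l = mat 1"
    unfolding vec_eq_iff using Liouville_weak[OF Wh lim] by blast
  then have "matrix_inv (f' l) ** f l = mat 1"
    using l by (simp add: W_def U_def)
  then have "f' l ** (matrix_inv (f' l) ** f l) = f' l" by simp
  then show ?thesis
    using Lambda_plusD(1)[OF fp' l] by (simp add: matrix_mul_assoc matrix_inv_mult)
qed

section \<open>Dressing by a simple element\<close>

lemma simple_matrix_eq:
  "simple_matrix \<alpha> a b l = simple (of_real \<alpha>) (of_real a) (of_real b) l"
  unfolding simple_matrix_def simple_def simple_num_def Let_def
  by (simp add: vec_eq_iff cscale_def)

text \<open>The value does not involve the line, so g and g~ have equal determinants and g F g~^{-1}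
  has determinant 1.\<close>

lemma det_simple:
  fixes \<alpha> a b l :: "'a::field"
  assumes "2 * a * b \<noteq> 1" "l^3 \<noteq> \<alpha>^3"
  shows "det (simple \<alpha> a b l) = (l^3 + \<alpha>^3) / (l^3 - \<alpha>^3)"
proof -
  define d k where "d = 2 * a * b - 1" and "k = l^3 - \<alpha>^3"
  have nz: "d \<noteq> 0" "k \<noteq> 0" using assms by (auto simp: d_def k_def)
  show ?thesis
    unfolding simple_def simple_num_def Let_def d_def[symmetric] k_def[symmetric] det_3 using nz
    apply (simp add: mat_def divide_simps)
    unfolding d_def k_def by algebra
qed

lemma invertible_simple:
  fixes \<alpha> a b l :: "'a::field"
  assumes "2 * a * b \<noteq> 1" "l^3 \<noteq> \<alpha>^3" "l^3 \<noteq> - (\<alpha>^3)"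
  shows "invertible (simple \<alpha> a b l)" "simple_inv \<alpha> a b l ** simple \<alpha> a b l = mat 1"
  using simple_mult_inv[OF assms] invertible_right_inverse matrix_left_right_inverse by blast+

text \<open>The \<sigma>-symmetry with the inverse written explicitly. Since (\<epsilon>\<lambda>)^3
  = -\<lambda>^3, the pole denominators of g turn into those of its inverse.\<close>

lemma simple_eps: "simple \<alpha> a b (eps * l) ** T_mat = T_mat ** transpose (simple_inv \<alpha> a b l)"
proof -
  have *: "2 / (- (l^3) - \<alpha>^3) = - (2 / (l^3 + \<alpha>^3))"
    by (metis minus_add_distrib minus_divide_right uminus_add_conv_diff add.commute)
  have e3: "eps * (eps * (eps * x)) = - x" for x
    using eps_cube by (simp add: power3_eq_cube mult.assoc[symmetric])
  show ?thesis
    unfolding simple_def simple_inv_def eps_mult_cube simple_num_def simple_inv_num_def Let_def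
    by (simp add: mat3_simps T_mat_entries * power_mult_distrib)
      (simp add: power2_eq_square e3 algebra_simps)
qed

lemma cnj_simple: "cnj_mat (simple (of_real \<alpha>) (of_real a) (of_real b) l) = simple (of_real \<alpha>) (of_real a) (of_real b) (cnj l)"
  "cnj_mat (simple_inv (of_real \<alpha>) (of_real a) (of_real b) l) = simple_inv (of_real \<alpha>) (of_real a) (of_real b) (cnj l)"
  unfolding simple_def simple_inv_def simple_num_def simple_inv_num_def Let_def
  by (simp_all add: vec_eq_iff forall_3 cnj_mat_def mat_def)

text \<open>All cube roots of \<alpha>^3 and -\<alpha>^3 lie on the circle of radius |\<alpha>|,
  strictly between r and 1 / r.\<close>

lemma near_0_inf_cube_neq:
  assumes "0 < r" "r < \<bar>\<alpha>\<bar>" "\<bar>\<alpha>\<bar> < 1 / r" "l \<in> near_0_inf r"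
  shows "l^3 \<noteq> of_real \<alpha> ^ 3" "l^3 \<noteq> - (of_real \<alpha> ^ 3)"
proof -
  have "cmod l \<noteq> \<bar>\<alpha>\<bar>" using assms by (auto simp: near_0_inf_def)
  then have "cmod (l^3) \<noteq> cmod (of_real \<alpha> ^ 3)"
    by (simp add: norm_power power_eq_iff_eq_base)
  then show "l^3 \<noteq> of_real \<alpha> ^ 3" "l^3 \<noteq> - (of_real \<alpha> ^ 3)"
    by (auto simp: norm_minus_cancel)
qed

lemma simple_in_Lambda_minus:
  assumes r: "0 < r" "r < 1" and \<alpha>: "r < \<bar>\<alpha>\<bar>" "\<bar>\<alpha>\<bar> < 1 / r" and ab: "2 * a * b \<noteq> 1"
  shows "simple_matrix \<alpha> a b \<in> Lambda_minus_GL r"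
proof -
  \<comment> \<open>This is w^3 times the numerator at 1 / w. Every entry keeps a positive power of
    w, so \<open>c\<close> takes the value I at w = 0.\<close>
  define n :: "complex \<Rightarrow> cmat" where "n w = (let d = 2 * of_real a * of_real b - 1; \<alpha> = of_real \<alpha> in vector
     [vector [\<alpha>^3 * of_real a * (of_real b / d) * w^3, \<alpha> * (of_real b^2 / d) * w, \<alpha>^2 * (of_real b / d) * w^2],
      vector [\<alpha>^2 * of_real a^2 * w^2, \<alpha>^3 * of_real a * of_real b * w^3, \<alpha> * of_real a * w],
      vector [\<alpha> * of_real a * w, \<alpha>^2 * of_real b * w^2, \<alpha>^3 * w^3]])" for w
  define c :: "complex \<Rightarrow> cmat" where
    "c w = (\<chi> i j. mat 1 $ i $ j + 2 / (1 - of_real \<alpha>^3 * w^3) * n w $ i $ j)" for w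
  have d: "2 * complex_of_real a * of_real b \<noteq> 1"
    using ab by (metis of_real_1 of_real_eq_iff of_real_mult of_real_numeral)
  have nz: "1 - of_real \<alpha>^3 * w^3 \<noteq> 0" if "w \<in> ball 0 r" for w :: complex
  proof -
    have "\<bar>\<alpha>\<bar> * cmod w < (1 / r) * r"
      using that \<alpha> r by (intro mult_strict_mono) auto
    then have "cmod (of_real \<alpha> * w) < 1" using r by (simp add: norm_mult)
    then have "cmod ((of_real \<alpha> * w)^3) < 1"
      by (simp add: norm_power power_less_one_iff)
    then show ?thesis by (auto simp: power_mult_distrib)
  qed
  have chart: "(if w = 0 then mat 1 else simple_matrix \<alpha> a b (inverse w)) = c w" if "w \<in> ball 0 r" for w
  proof (cases "w = 0")
    case True
    have "\<forall>i j. n 0 $ i $ j = 0"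
      by (simp add: n_def forall_3 Let_def)
    then show ?thesis
      using True by (simp add: c_def vec_eq_iff)
  next
    case False
    have 1: "2 / (inverse w^3 - of_real \<alpha>^3) = 2 / (1 - of_real \<alpha>^3 * w^3) * w^3"
      using False nz[OF that] by (simp add: field_simps power_inverse)
    have "w^3 * (inverse w)^2 = w" "w^3 * inverse w = w^2"
      using False by (simp_all add: field_simps power2_eq_square power3_eq_cube)
    then obtain v where v: "v = inverse w" "w^3 * v^2 = w" "w^3 * v = w^2"
      by blast
    have w: "x * v^2 * y * w^3 = x * y * w" "x * v * y * w^3 = x * y * w^2" for x y
    proof -
      have "x * v^2 * y * w^3 = x * y * (w^3 * v^2)" "x * v * y * w^3 = x * y * (w^3 * v)"
        by (simp_all add: algebra_simps)
      then show "x * v^2 * y * w^3 = x * y * w" "x * v * y * w^3 = x * y * w^2"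
        unfolding v(2,3) .
    qed
    have "\<forall>i j. w^3 * simple_num (of_real \<alpha>) (of_real a) (of_real b) (inverse w) $ i $ j = n w $ i $ j"
      unfolding forall_3 simple_num_def n_def Let_def v(1)[symmetric]
      by (simp only: vector_3 times_divide_eq_right[symmetric] w mult.commute[of "w^3"] simp_thms)
    then have 2: "w^3 * simple_num (of_real \<alpha>) (of_real a) (of_real b) (inverse w) $ i $ j = n w $ i $ j" for i j
      by blast
    show ?thesis
      using False by (simp add: simple_matrix_eq simple_def c_def vec_eq_iff 1 mult.assoc 2)
  qed
  have "mat_holomorphic_on c (ball 0 r)"
    unfolding mat_holomorphic_on_def forall_3 c_def n_def Let_def
    using nz by (auto intro!: holomorphic_intros)
  then have "mat_holomorphic_on (\<lambda>w. if w = 0 then mat 1 else simple_matrix \<alpha> a b (inverse w)) (ball 0 r)"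
    unfolding mat_holomorphic_on_def
  proof (intro allI)
    fix i j
    assume "\<forall>i j. (\<lambda>w. c w $ i $ j) holomorphic_on ball 0 r"
    then have "(\<lambda>w. c w $ i $ j) holomorphic_on ball 0 r" by blast
    then show "(\<lambda>w. (if w = 0 then mat 1 else simple_matrix \<alpha> a b (inverse w)) $ i $ j) holomorphic_on ball 0 r"
      by (rule holomorphic_transform) (simp only: chart)
  qed
  moreover have "mat_holomorphic_on (simple_matrix \<alpha> a b) (near_0_inf r)"
    unfolding mat_holomorphic_on_def forall_3 simple_matrix_eq simple_def simple_num_def Let_def
    using near_0_inf_cube_neq(1)[OF r(1) \<alpha>] by (auto intro!: holomorphic_intros)
  moreover have inv: "\<forall>l\<in>near_0_inf r. invertible (simple_matrix \<alpha> a b l)"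
    using near_0_inf_cube_neq[OF r(1) \<alpha>] invertible_simple(1)[OF d] by (simp add: simple_matrix_eq)
  moreover have "tau_sigma_on (near_0_inf r) (simple_matrix \<alpha> a b)"
    unfolding tau_sigma_on_iff[OF inv]
  proof (intro ballI conjI)
    fix l assume l: "l \<in> near_0_inf r"
    show "cnj_mat (simple_matrix \<alpha> a b (cnj l)) = simple_matrix \<alpha> a b l"
      by (simp add: simple_matrix_eq cnj_simple)
    have "T_mat ** transpose (simple (of_real \<alpha>) (of_real a) (of_real b) l ** simple_inv (of_real \<alpha>) (of_real a) (of_real b) l) = T_mat"
      using simple_mult_inv[OF d near_0_inf_cube_neq[OF r(1) \<alpha> l]] by simp
    then show "simple_matrix \<alpha> a b (eps * l) ** T_mat ** transpose (simple_matrix \<alpha> a b l) = T_mat"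
      by (simp add: simple_matrix_eq simple_eps matrix_transpose_mul matrix_mul_assoc)
  qed
  ultimately show ?thesis
    unfolding Lambda_minus_GL_def by (intro CollectI conjI)
qed

text \<open>The zeros of P are simple and K vanishes there, so the singularities of K / P are
  removable. It is applied with P = \<lambda>^6 - \<alpha>^6.\<close>

lemma holomorphic_quotient:
  assumes S: "open S" and K: "K holomorphic_on S" and P: "P holomorphic_on S"
    and fin: "finite {z\<in>S. P z = 0}"
    and zeros: "\<And>z. z \<in> S \<Longrightarrow> P z = 0 \<Longrightarrow> K z = 0 \<and> deriv P z \<noteq> 0"
  shows "\<exists>q. q holomorphic_on S \<and> (\<forall>z\<in>S. K z = P z * q z)"
proof -
  \<comment> \<open>At a zero of P the quotient of derivatives is the limit of K / P.\<close>
  define q where "q z = (if P z = 0 then deriv K z / deriv P z else K z / P z)" for z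
  let ?Z = "{z\<in>S. P z = 0}"
  have op: "open (S - ?Z)" using S fin by (simp add: open_Diff finite_imp_closed)
  have hol: "q holomorphic_on (S - ?Z)"
    by (rule holomorphic_transform[of "\<lambda>z. K z / P z"])
      (auto simp: q_def intro!: holomorphic_intros holomorphic_on_subset[OF K] holomorphic_on_subset[OF P])
  have "isCont q a" if a: "a \<in> S" for a
  proof (cases "P a = 0")
    case False
    then have "a \<in> S - ?Z" using a by auto
    then show ?thesis
      using holomorphic_on_imp_continuous_on[OF hol] op by (simp add: continuous_on_eq_continuous_at)
  next
    case True
    have lim: "((\<lambda>z. (f z - f a) / (z - a)) \<longlongrightarrow> deriv f a) (at a)" if "f holomorphic_on S" for f
      using holomorphic_derivI[OF that S a] by (simp add: has_field_derivative_iff)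
    have "((\<lambda>z. ((K z - K a) / (z - a)) / ((P z - P a) / (z - a))) \<longlongrightarrow> deriv K a / deriv P a) (at a)"
      using zeros[OF a True] by (intro tendsto_divide lim K P) auto
    moreover have "eventually (\<lambda>z. z \<in> S - (?Z - {a})) (at a)"
      using S fin a by (intro eventually_at_in_open') (auto simp: open_Diff finite_imp_closed)
    then have "eventually (\<lambda>z. ((K z - K a) / (z - a)) / ((P z - P a) / (z - a)) = q z) (at a)"
      using eventually_neq_at_within[of a a UNIV]
      by eventually_elim (use zeros[OF a True] True in \<open>auto simp: q_def\<close>)
    ultimately have "(q \<longlongrightarrow> deriv K a / deriv P a) (at a)"
      by (rule Lim_transform_eventually)
    then show ?thesis using True by (simp add: isCont_def q_def)
  qed
  then have "q holomorphic_on S"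
    by (intro no_isolated_singularity[OF _ hol S fin] continuous_at_imp_continuous_on) auto
  moreover have "K z = P z * q z" if "z \<in> S" for z
    using zeros[OF that] by (auto simp: q_def)
  ultimately show ?thesis by blast
qed

text \<open>Carries determinant, reality and twisting from generic \<lambda> to the removed
  poles.\<close>

lemma continuous_eq_off_finite:
  fixes f g :: "complex \<Rightarrow> 'b::t2_space"
  assumes "open S" "finite Z" "continuous_on S f" "continuous_on S g"
    and "\<And>l. l \<in> S - Z \<Longrightarrow> f l = g l" and "l \<in> S"
  shows "f l = g l"
proof -
  have f: "(f \<longlongrightarrow> f l) (at l)" and g: "(g \<longlongrightarrow> g l) (at l)"
    using assms by (auto simp: continuous_on_eq_continuous_at isCont_def)
  have "eventually (\<lambda>z. z \<in> S - (Z - {l})) (at l)"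
    using assms by (intro eventually_at_in_open') (auto simp: open_Diff finite_imp_closed)
  then have "eventually (\<lambda>z. g z = f z) (at l)"
    using eventually_neq_at_within[of l l UNIV] by eventually_elim (use assms(5) in auto)
  with g have "(f \<longlongrightarrow> g l) (at l)"
    by (rule Lim_transform_eventually)
  with f show ?thesis
    by (rule tendsto_unique[OF at_neq_bot])
qed

text \<open>Up to a scalar this is the residue of g at \<alpha>: it has rank one, with the given
  line as row space.\<close>

lemma simple_num_row: "simple_num \<alpha> a b \<alpha> $ i $ k =
  vector [\<alpha>^3 * b / (2 * a * b - 1), \<alpha>^3 * a, \<alpha>^3] $ i * (vector [a, b, 1] :: 'a::field^3) $ k"
proof -
  have "\<forall>i k. simple_num \<alpha> a b \<alpha> $ i $ k =
    vector [\<alpha>^3 * b / (2 * a * b - 1), \<alpha>^3 * a, \<alpha>^3] $ i * (vector [a, b, 1] :: 'a::field^3) $ k"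
    unfolding forall_3 by (simp add: simple_num_def Let_def power2_eq_square power3_eq_cube)
  then show ?thesis by blast
qed

text \<open>The residue of the inverse at -\<alpha>, up to a scalar: rank one again, with column
  space spanned by the swapped vector (b, a, 1).\<close>

lemma simple_inv_num_column: "simple_inv_num \<alpha> a b (- \<alpha>) $ i $ k =
  (vector [b, a, 1] :: 'a::field^3) $ i * vector [\<alpha>^3 * a, \<alpha>^3 * b / (2 * a * b - 1), \<alpha>^3] $ k"
proof -
  have "\<forall>i k. simple_inv_num \<alpha> a b (- \<alpha>) $ i $ k =
    (vector [b, a, 1] :: 'a::field^3) $ i * vector [\<alpha>^3 * a, \<alpha>^3 * b / (2 * a * b - 1), \<alpha>^3] $ k"
    unfolding forall_3 by (simp add: simple_inv_num_def Let_def power2_eq_square power3_eq_cube)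
  then show ?thesis by blast
qed

text \<open>At a pole \<open>simple\<close> evaluates to I by division by zero, which carries no
  information; the cleared form is correct there too.\<close>

definition simple_poly :: "'a::field \<Rightarrow> 'a \<Rightarrow> 'a \<Rightarrow> 'a \<Rightarrow> 'a^3^3" where
  "simple_poly \<alpha> a b l = (\<chi> i j. (l^3 - \<alpha>^3) * mat 1 $ i $ j + 2 * simple_num \<alpha> a b l $ i $ j)"

definition simple_inv_poly :: "'a::field \<Rightarrow> 'a \<Rightarrow> 'a \<Rightarrow> 'a \<Rightarrow> 'a^3^3" where
  "simple_inv_poly \<alpha> a b l = (\<chi> i j. (l^3 + \<alpha>^3) * mat 1 $ i $ j - 2 * simple_inv_num \<alpha> a b l $ i $ j)"

lemma simple_poly_entries:
  assumes "l^3 \<noteq> \<alpha>^3"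
  shows "simple_poly \<alpha> a b l $ i $ j = (l^3 - \<alpha>^3) * simple \<alpha> a b l $ i $ j"
  using assms by (simp add: simple_poly_def simple_def field_simps)

lemma simple_inv_poly_entries:
  assumes "l^3 + \<alpha>^3 \<noteq> 0"
  shows "simple_inv_poly \<alpha> a b l $ i $ j = (l^3 + \<alpha>^3) * simple_inv \<alpha> a b l $ i $ j"
proof -
  have "(l^3 + \<alpha>^3) * (m - 2 / (l^3 + \<alpha>^3) * n) = (l^3 + \<alpha>^3) * m - 2 * n" for m n
    using assms by (simp add: right_diff_distrib)
  then show ?thesis by (simp add: simple_inv_poly_def simple_inv_def)
qed

text \<open>The residue of g g^{-1} = I at \<alpha> is zero, so g^{-1}(\<alpha>) kills the row space
  of the residue of g.\<close>

lemma row_mult_simple_inv_poly: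
  fixes \<alpha> a b :: "'a::field"
  assumes "2 * a * b \<noteq> 1"
  shows "vector [a, b, 1] v* simple_inv_poly \<alpha> a b \<alpha> = 0"
proof -
  define d where "d = 2 * a * b - 1"
  have "d \<noteq> 0" using assms by (simp add: d_def)
  then show ?thesis
    unfolding simple_inv_poly_def simple_inv_num_def Let_def d_def[symmetric]
    apply (simp add: mat3_simps divide_simps)
    apply (simp add: d_def power2_eq_square power3_eq_cube algebra_simps)
    done
qed

text \<open>Mirror image at -\<alpha>: there g kills the column space of the residue of its
  inverse.\<close>

lemma simple_poly_mult_column:
  fixes \<alpha> a b :: "'a::field"
  assumes "2 * a * b \<noteq> 1"
  shows "simple_poly \<alpha> a b (- \<alpha>) *v vector [b, a, 1] = 0"
proof -
  define d e where "d = 2 * a * b - 1" and "e = inverse d"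
  have e: "(2 * a * b - 1) * e = 1" using assms by (simp add: d_def e_def)
  let ?P = "simple_poly \<alpha> a b (- \<alpha>) *v vector [b, a, 1]"
  have "?P $ 1 = 2 * \<alpha>^3 * b * ((2 * a * b - 1) * e - 1)" "?P $ 2 = 0" "?P $ 3 = 0"
    unfolding simple_poly_def simple_num_def Let_def d_def[symmetric] divide_inverse e_def[symmetric]
    by (simp_all add: matrix_vector_mult_def sum_3 mat_def power2_eq_square power3_eq_cube algebra_simps)
      (simp add: d_def algebra_simps)
  then show ?thesis
    unfolding e by (simp add: vec_eq_iff forall_3)
qed

text \<open>This is T (T^t)^{-1}, so \<sigma> applied twice is conjugation by it. The entries are
  the three cube roots of unity.\<close>

definition rot :: cmat where
  "rot = vector [vector [eps^2, 0, 0], vector [0, - eps, 0], vector [0, 0, 1]]"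

lemma eps_reduce: "eps * eps = eps - 1" "eps * (eps * x) = eps * x - x"
proof -
  show *: "eps * eps = eps - 1"
    using eps_square by (simp add: power2_eq_square)
  have "eps * (eps * x) = (eps * eps) * x" by (simp only: mult.assoc)
  then show "eps * (eps * x) = eps * x - x" unfolding * by (simp add: left_diff_distrib)
qed

text \<open>Each entry is homogeneous in \<lambda> modulo 3, with a degree fixed by its position, so
  multiplying \<lambda> by the cube root of unity \<epsilon>^2 amounts to conjugation by a diagonal
  matrix.\<close>

lemma rot_simple_poly:
  "simple_poly \<alpha> a b (eps^2 * l) ** rot = rot ** simple_poly \<alpha> a b l"
  "simple_inv_poly \<alpha> a b (eps^2 * l) ** rot = rot ** simple_inv_poly \<alpha> a b l"
proof -
  have e: "(eps^2 * l)^3 = l^3" "(eps^2 * l)^2 = - (eps * l^2)" "eps^2 * l = eps * l - l" "(eps * l - l)^2 = - (eps * l^2)"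
    by (simp_all add: power2_eq_square power3_eq_cube algebra_simps eps_reduce)
  define t where "t = inverse (2 * a * b - 1)"
  \<comment> \<open>The diagonal of \<open>rot\<close>, already reduced by \<epsilon>^2 = \<epsilon>
    - 1.\<close>
  define c :: "complex^3" where "c = vector [eps - 1, - eps, 1]"
  have rot: "(A ** rot) $ i $ j = A $ i $ j * c $ j" "(rot ** A) $ i $ j = c $ i * A $ i $ j" for A i j
  proof -
    have "\<forall>i j. (A ** rot) $ i $ j = A $ i $ j * c $ j \<and> (rot ** A) $ i $ j = c $ i * A $ i $ j"
      unfolding forall_3 by (simp add: rot_def c_def matrix_matrix_mult_def sum_3 eps_square)
    then show "(A ** rot) $ i $ j = A $ i $ j * c $ j" "(rot ** A) $ i $ j = c $ i * A $ i $ j" by blast+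
  qed
  have "\<forall>i j. simple_num \<alpha> a b (eps^2 * l) $ i $ j * c $ j = c $ i * simple_num \<alpha> a b l $ i $ j"
    unfolding forall_3 simple_num_def Let_def e c_def divide_inverse t_def[symmetric]
    by (simp add: algebra_simps eps_reduce)
  then have n: "simple_num \<alpha> a b (eps^2 * l) $ i $ j * c $ j = c $ i * simple_num \<alpha> a b l $ i $ j" for i j
    by blast
  have "\<forall>i j. simple_inv_num \<alpha> a b (eps^2 * l) $ i $ j * c $ j = c $ i * simple_inv_num \<alpha> a b l $ i $ j"
    unfolding forall_3 simple_inv_num_def Let_def e c_def divide_inverse t_def[symmetric]
    by (simp add: algebra_simps eps_reduce)
  then have n': "simple_inv_num \<alpha> a b (eps^2 * l) $ i $ j * c $ j = c $ i * simple_inv_num \<alpha> a b l $ i $ j" for i j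
    by blast
  have m: "mat 1 $ i $ j * c $ j = c $ i * mat 1 $ i $ j" for i j
    by (simp add: mat_def)
  have *: "(x * m + y * n') * u = v * (x * m + y * n)" "(x * m - y * n') * u = v * (x * m - y * n)"
    if "m * u = v * m" "n' * u = v * n" for x y m n n' u v :: complex
  proof -
    have "(x * m + y * n') * u = x * (m * u) + y * (n' * u)" "(x * m - y * n') * u = x * (m * u) - y * (n' * u)"
      by (simp_all add: algebra_simps)
    then show "(x * m + y * n') * u = v * (x * m + y * n)" "(x * m - y * n') * u = v * (x * m - y * n)"
      unfolding that by (simp_all add: algebra_simps)
  qed
  show "simple_poly \<alpha> a b (eps^2 * l) ** rot = rot ** simple_poly \<alpha> a b l"
    unfolding simple_poly_def vec_eq_iff rot e(1) vec_lambda_beta using *(1)[OF m n] by blast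
  show "simple_inv_poly \<alpha> a b (eps^2 * l) ** rot = rot ** simple_inv_poly \<alpha> a b l"
    unfolding simple_inv_poly_def vec_eq_iff rot e(1) vec_lambda_beta using *(2)[OF m n'] by blast
qed

lemma cscale_mult: "A ** cscale c B = cscale c (A ** B)" "cscale c A ** B = cscale c (A ** B)"
  by (simp_all add: cscale_def matrix_matrix_mult_def vec_eq_iff sum_distrib_left mult.assoc mult.left_commute)

lemma rot_T_mat: "rot ** transpose T_mat = T_mat" "rot ** T_mat = cscale (eps^2) swap12"
  by (simp_all add: rot_def mat3_simps T_mat_entries cscale_def swap12_def)
    (simp_all add: power2_eq_square eps_reduce algebra_simps)

text \<open>The twisting condition at \<epsilon>\<lambda> is combined with its transpose at
  \<lambda>: two inverse transposes cancel.\<close>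

lemma Lambda_plus_rot:
  assumes f: "f \<in> Lambda_plus_SL" and l: "l \<noteq> 0"
  shows "f (eps^2 * l) ** rot = rot ** f l"
proof -
  let ?g = "f (eps * l)"
  have l': "eps * l \<noteq> 0" using l by simp
  have 1: "?g ** T_mat ** transpose (f l) = T_mat" by (rule Lambda_plusD(4)[OF f l])
  have 2: "f (eps^2 * l) ** T_mat ** transpose ?g = T_mat"
    using Lambda_plusD(4)[OF f l'] by (simp add: power2_eq_square mult.assoc)
  have 3: "f l ** transpose T_mat ** transpose ?g = transpose T_mat"
    using arg_cong[OF 1, of transpose] by (simp add: matrix_transpose_mul matrix_mul_assoc)
  have inv: "invertible (transpose ?g)" "invertible (transpose T_mat)"
    using Lambda_plusD(1)[OF f l'] invertible_T_mat by (simp_all add: invertible_det_nz)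
  have "f (eps^2 * l) ** rot ** transpose T_mat ** transpose ?g = f (eps^2 * l) ** (rot ** transpose T_mat) ** transpose ?g"
    by (simp only: matrix_mul_assoc)
  also have "\<dots> = rot ** (f l ** transpose T_mat ** transpose ?g)"
    unfolding 3 rot_T_mat(1) 2 ..
  also have "\<dots> = rot ** f l ** transpose T_mat ** transpose ?g"
    by (simp only: matrix_mul_assoc)
  finally have "f (eps^2 * l) ** rot ** transpose T_mat ** transpose ?g = rot ** f l ** transpose T_mat ** transpose ?g" .
  then have "f (eps^2 * l) ** rot ** transpose T_mat ** transpose ?g ** matrix_inv (transpose ?g) ** matrix_inv (transpose T_mat)
    = rot ** f l ** transpose T_mat ** transpose ?g ** matrix_inv (transpose ?g) ** matrix_inv (transpose T_mat)"
    by simp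
  then show ?thesis by (simp add: matrix_inv_mult inv)
qed

text \<open>Twisting three times leaves one inverse transpose, conjugated by \<open>swap12\<close>
  up to a scalar.\<close>

lemma Lambda_plus_minus:
  assumes f: "f \<in> Lambda_plus_SL" and l: "l \<noteq> 0"
  shows "f (- l) ** swap12 ** transpose (f l) = swap12"
proof -
  have "eps^2 * (eps * l) = - l"
    by (simp add: power2_eq_square algebra_simps eps_reduce)
  then have "f (- l) ** rot = rot ** f (eps * l)"
    using Lambda_plus_rot[OF f, of "eps * l"] l by simp
  then have "f (- l) ** rot ** (T_mat ** transpose (f l)) = rot ** (f (eps * l) ** T_mat ** transpose (f l))"
    by (simp add: matrix_mul_assoc)
  then have "f (- l) ** (rot ** T_mat) ** transpose (f l) = rot ** T_mat"
    using Lambda_plusD(4)[OF f l] by (simp add: matrix_mul_assoc)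
  then have "cscale (eps^2) (f (- l) ** swap12 ** transpose (f l)) = cscale (eps^2) swap12"
    unfolding rot_T_mat(2) cscale_mult .
  then show ?thesis
    by (simp add: cscale_def vec_eq_iff)
qed

lemma cube_eq_cube_iff: "z^3 = w^3 \<longleftrightarrow> z = w \<or> z = eps^2 * w \<or> z = eps^2 * (eps^2 * w)"
proof -
  have "z^3 - w^3 = (z - w) * (z - eps^2 * w) * (z - eps^2 * (eps^2 * w))"
    by (simp add: power2_eq_square power3_eq_cube algebra_simps eps_reduce)
  then show ?thesis
    by (metis divisors_zero eq_iff_diff_eq_0 mult_zero_left mult_zero_right)
qed

section \<open>Cancellation of the six poles and existence of the factor\<close>

lemma of_real_Re_mat_Lambda_plus:
  assumes "f \<in> Lambda_plus_SL" "\<alpha> \<noteq> 0"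
  shows "f (of_real \<alpha>) $ i $ j = of_real (Re_mat (f (of_real \<alpha>)) $ i $ j)"
proof -
  have "cnj_mat (f (of_real \<alpha>)) = f (of_real \<alpha>)"
    using Lambda_plusD(3)[OF assms(1), of "of_real \<alpha>"] assms(2) by simp
  then have "cnj (f (of_real \<alpha>) $ i $ j) = f (of_real \<alpha>) $ i $ j"
    unfolding cnj_mat_def vec_eq_iff by simp
  then show ?thesis
    by (simp add: Re_mat_def complex_eq_iff)
qed

lemma of_real_row_mult:
  fixes M :: "real^3^3" and M' :: cmat
  assumes M: "\<And>i j. M' $ i $ j = complex_of_real (M $ i $ j)"
    and row: "vector [a, b, 1] v* M = c *s vector [a', b', 1]"
  shows "vector [of_real a, of_real b, 1] v* M' = of_real c *s vector [of_real a', of_real b', 1]"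
proof -
  have "(\<Sum>i\<in>UNIV. M $ i $ j * vector [a, b, 1] $ i) = c * vector [a', b', 1] $ j" for j
    using arg_cong[OF row, of "\<lambda>v. v $ j"] by (simp add: vector_matrix_mult_def mult.commute)
  then have *: "complex_of_real (\<Sum>i\<in>UNIV. M $ i $ j * vector [a, b, 1] $ i)
      = of_real (c * vector [a', b', 1] $ j)" for j
    by simp
  show ?thesis
    using *[of 1] *[of 2] *[of 3] M by (simp add: vec_eq_iff forall_3 vector_matrix_mult_def sum_3 mult.commute)
qed

lemma outer_product_mult:
  fixes A X Q :: "'a::field^'n^'n"
  assumes "\<And>i k. A $ i $ k = v i * w $ k"
  shows "(A ** X ** Q) $ i $ j = v i * ((w v* X) v* Q) $ j"
proof -
  have "(A ** X) $ i $ k = v i * (w v* X) $ k" for i k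
    by (simp add: matrix_matrix_mult_def vector_matrix_mult_def assms sum_distrib_left mult_ac)
  then show ?thesis
    by (simp add: matrix_matrix_mult_def[of "A ** X"] vector_matrix_mult_def[of "w v* X"] sum_distrib_left mult_ac)
qed

lemma mult_outer_product:
  fixes P X B :: "'a::field^'n^'n"
  assumes "\<And>i k. B $ i $ k = v $ i * w k"
  shows "(P ** X ** B) $ i $ j = (P *v (X *v v)) $ i * w j"
proof -
  have "(P ** X ** B) $ i $ j = ((P ** X) *v v) $ i * w j"
    by (simp add: matrix_matrix_mult_def[of "P ** X"] matrix_vector_mult_def[of "P ** X"] assms
        sum_distrib_right mult.assoc)
  then show ?thesis by (simp add: matrix_vector_mul_assoc)
qed

text \<open>
  At \<open>\<alpha>\<close> the matrix \<^term>\<open>simple_num\<close> has rank one with row space \<open>(a, b, 1)\<close>, and its image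
  \<open>(a', b', 1)\<close> under \<open>f\<close> is annihilated by \<^term>\<open>simple_inv_poly\<close>. At \<open>- \<alpha>\<close> the roles of the two
  factors are exchanged, because \<open>f\<close> at \<open>- l\<close> is conjugate to the inverse transpose of \<open>f\<close> at \<open>l\<close>.
  The other four poles are images of these two under the rotation.
\<close>

lemma dressing_numerator_zero:
  fixes a b a' b' c :: complex and \<alpha> :: complex
  assumes f: "f \<in> Lambda_plus_SL" and \<alpha>: "\<alpha> \<noteq> 0"
    and ab: "2 * a * b \<noteq> 1" and ab': "2 * a' * b' \<noteq> 1" and c: "c \<noteq> 0"
    and line: "vector [a, b, 1] v* f \<alpha> = c *s vector [a', b', 1]"
    and l: "(l^3 - \<alpha>^3) * (l^3 + \<alpha>^3) = 0"
  shows "simple_poly \<alpha> a b l ** f l ** simple_inv_poly \<alpha> a' b' l = 0"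
proof -
  define K where "K l = simple_poly \<alpha> a b l ** f l ** simple_inv_poly \<alpha> a' b' l" for l
  have K1: "K \<alpha> = 0"
  proof -
    \<comment> \<open>The diagonal term l^3 - \<alpha>^3 vanishes here, leaving twice the rank one
      numerator.\<close>
    have P: "simple_poly \<alpha> a b \<alpha> $ i $ k =
        (2 * vector [\<alpha>^3 * b / (2 * a * b - 1), \<alpha>^3 * a, \<alpha>^3] $ i) * vector [a, b, 1] $ k" for i k
      by (simp add: simple_poly_def simple_num_row)
    have "K \<alpha> $ i $ j = (2 * vector [\<alpha>^3 * b / (2 * a * b - 1), \<alpha>^3 * a, \<alpha>^3] $ i)
        * ((c *s vector [a', b', 1]) v* simple_inv_poly \<alpha> a' b' \<alpha>) $ j" for i j
      unfolding K_def line[symmetric] by (rule outer_product_mult) (rule P)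
    moreover have "(c *s vector [a', b', 1]) v* simple_inv_poly \<alpha> a' b' \<alpha> = 0"
      unfolding scalar_vector_matrix_assoc row_mult_simple_inv_poly[OF ab'] by simp
    ultimately show ?thesis by (simp add: vec_eq_iff)
  qed
  have K2: "K (- \<alpha>) = 0"
  proof -
    have Q: "simple_inv_poly \<alpha> a' b' (- \<alpha>) $ i $ k =
        vector [b', a', 1] $ i * (- 2 * vector [\<alpha>^3 * a', \<alpha>^3 * b' / (2 * a' * b' - 1), \<alpha>^3] $ k)" for i k
      by (simp add: simple_inv_poly_def simple_inv_num_column)
    have K: "K (- \<alpha>) $ i $ j = (simple_poly \<alpha> a b (- \<alpha>) *v (f (- \<alpha>) *v vector [b', a', 1])) $ i
        * (- 2 * vector [\<alpha>^3 * a', \<alpha>^3 * b' / (2 * a' * b' - 1), \<alpha>^3] $ j)" for i j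
      unfolding K_def by (rule mult_outer_product) (rule Q)
    have sw: "vector [v, u, 1] = swap12 *v (vector [u, v, 1] :: complex^3)" for u v
      by (simp add: swap12_def vec_eq_iff forall_3 matrix_vector_mult_def sum_3)
    \<comment> \<open>By the relation between f(-\<alpha>) and f(\<alpha>), the hypothesis on rows
      at \<alpha> becomes one on columns at -\<alpha>: f(-\<alpha>) sends (b', a', 1) to a multiple
      of (b, a, 1).\<close>
    have "c *s (f (- \<alpha>) *v vector [b', a', 1]) = f (- \<alpha>) *v (swap12 *v (c *s vector [a', b', 1]))"
      unfolding sw[of b' a'] by (simp only: vector_scalar_commute)
    also have "\<dots> = f (- \<alpha>) *v (swap12 *v (transpose (f \<alpha>) *v vector [a, b, 1]))"
      unfolding line[symmetric] by simp
    also have "\<dots> = (f (- \<alpha>) ** swap12 ** transpose (f \<alpha>)) *v vector [a, b, 1]"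
      by (simp only: matrix_vector_mul_assoc matrix_mul_assoc)
    also have "\<dots> = vector [b, a, 1]"
      unfolding Lambda_plus_minus[OF f \<alpha>] sw[symmetric] ..
    finally have "inverse c *s (c *s (f (- \<alpha>) *v vector [b', a', 1])) = inverse c *s vector [b, a, 1]"
      by simp
    then have "f (- \<alpha>) *v vector [b', a', 1] = inverse c *s vector [b, a, 1]"
      using c by (simp add: vector_smult_assoc)
    then have "simple_poly \<alpha> a b (- \<alpha>) *v (f (- \<alpha>) *v vector [b', a', 1]) = 0"
      using simple_poly_mult_column[OF ab, of \<alpha>] by (simp add: vector_scalar_commute)
    then show ?thesis using K by (simp add: vec_eq_iff)
  qed
  \<comment> \<open>All three factors of \<open>K\<close> intertwine with \<open>rot\<close>, so the
    zeros of \<open>K\<close> are invariant under multiplication by \<epsilon>^2.\<close>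
  have rot: "K (eps^2 * l) = 0" if "K l = 0" "l \<noteq> 0" for l
  proof -
    have "K (eps^2 * l) ** rot = rot ** K l"
    proof -
      have "K (eps^2 * l) ** rot = simple_poly \<alpha> a b (eps^2 * l) ** f (eps^2 * l) ** (simple_inv_poly \<alpha> a' b' (eps^2 * l) ** rot)"
        by (simp add: K_def matrix_mul_assoc)
      also have "\<dots> = simple_poly \<alpha> a b (eps^2 * l) ** (f (eps^2 * l) ** rot) ** simple_inv_poly \<alpha> a' b' l"
        unfolding rot_simple_poly by (simp only: matrix_mul_assoc)
      also have "\<dots> = (simple_poly \<alpha> a b (eps^2 * l) ** rot) ** f l ** simple_inv_poly \<alpha> a' b' l"
        unfolding Lambda_plus_rot[OF f that(2)] by (simp only: matrix_mul_assoc)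
      also have "\<dots> = rot ** K l"
        unfolding rot_simple_poly K_def by (simp only: matrix_mul_assoc)
      finally show ?thesis .
    qed
    moreover have "invertible rot"
      by (simp add: invertible_det_nz det_3 rot_def)
    ultimately have "K (eps^2 * l) = rot ** K l ** matrix_inv rot"
      using matrix_inv_mult(4)[of rot "K (eps^2 * l)"] by simp
    then show ?thesis unfolding that by simp
  qed
  have "l^3 = \<alpha>^3 \<or> l^3 = (- \<alpha>)^3"
    using l by (auto simp: eq_neg_iff_add_eq_0)
  then obtain \<beta> where \<beta>: "l = \<beta> \<or> l = eps^2 * \<beta> \<or> l = eps^2 * (eps^2 * \<beta>)" "\<beta> = \<alpha> \<or> \<beta> = - \<alpha>"
    unfolding cube_eq_cube_iff by blast
  have "K \<beta> = 0" "\<beta> \<noteq> 0" using \<beta>(2) \<alpha> K1 K2 by auto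
  then have 1: "K (eps^2 * \<beta>) = 0" by (rule rot)
  then have 2: "K (eps^2 * (eps^2 * \<beta>)) = 0" by (rule rot) (simp add: \<open>\<beta> \<noteq> 0\<close>)
  then have "K l = 0" using \<beta>(1) \<open>K \<beta> = 0\<close> 1 2 by metis
  then show ?thesis by (simp add: K_def)
qed

text \<open>The candidate g F g~^{-1} is \<open>K\<close> / \<open>P\<close> with polynomial simple
  factors in \<open>K\<close> and P = \<lambda>^6 - \<alpha>^6. As \<open>K\<close> vanishes at the
  zeros of \<open>P\<close>, it extends over the punctured plane. Here g~ is the simple element of
  the line transported by F(\<alpha>).\<close>

lemma dressing_simple:
  fixes \<alpha> a b a' b' c :: real
  defines "A \<equiv> complex_of_real \<alpha>"
  assumes r: "0 < r" "r < 1" and \<alpha>: "r < \<bar>\<alpha>\<bar>" "\<bar>\<alpha>\<bar> < 1 / r"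
    and F: "F \<in> Lambda_plus_SL"
    and ab: "2 * a * b \<noteq> 1" and ab': "2 * a' * b' \<noteq> 1" and c: "c \<noteq> 0"
    and line: "vector [a, b, 1] v* Re_mat (F A) = c *s vector [a', b', 1]"
  obtains f where "dressing_factor r (simple_matrix \<alpha> a b) F f"
    and "\<And>l. l \<noteq> 0 \<Longrightarrow> l^3 \<noteq> A^3 \<Longrightarrow> l^3 \<noteq> - (A^3) \<Longrightarrow>
      f l = simple_matrix \<alpha> a b l ** F l ** simple_inv A (of_real a') (of_real b') l"
proof -
  have A0: "A \<noteq> 0" and \<alpha>0: "\<alpha> \<noteq> 0" using r \<alpha> by (auto simp: A_def)
  have cab: "2 * complex_of_real a * of_real b \<noteq> 1" "2 * complex_of_real a' * of_real b' \<noteq> 1" "complex_of_real c \<noteq> 0"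
    using ab ab' c of_real_eq_iff[of "2 * a * b" 1, where 'a = complex]
      of_real_eq_iff[of "2 * a' * b'" 1, where 'a = complex] by simp_all
  have cline: "vector [of_real a, of_real b, 1] v* F A = of_real c *s vector [of_real a', of_real b', 1]"
    unfolding A_def
    by (rule of_real_row_mult[OF of_real_Re_mat_Lambda_plus[OF F \<alpha>0] line[unfolded A_def]])
  define S R where "S = simple_matrix \<alpha> a b" and "R = simple_inv A (of_real a') (of_real b')"
  define K where "K l = simple_poly A (of_real a) (of_real b) l ** F l ** simple_inv_poly A (of_real a') (of_real b') l" for l
  define P where "P l = (l^3 - A^3) * (l^3 + A^3)" for l
  let ?Z = "{l\<in>- {0}. P l = 0}"
  have Kzero: "K l = 0" if "P l = 0" for l
    using dressing_numerator_zero[OF F A0 cab cline] that by (simp add: K_def P_def)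
  have fin: "finite ?Z"
  proof (rule finite_subset)
    show "?Z \<subseteq> (\<Union>\<beta>\<in>{A, - A}. {\<beta>, eps^2 * \<beta>, eps^2 * (eps^2 * \<beta>)})"
    proof
      fix l assume "l \<in> ?Z"
      then have "l^3 = A^3 \<or> l^3 = (- A)^3"
        by (auto simp: P_def eq_neg_iff_add_eq_0)
      then show "l \<in> (\<Union>\<beta>\<in>{A, - A}. {\<beta>, eps^2 * \<beta>, eps^2 * (eps^2 * \<beta>)})"
        unfolding cube_eq_cube_iff by auto
    qed
  qed simp
  have Khol: "(\<lambda>l. K l $ i $ j) holomorphic_on - {0}" for i j
  proof -
    have "mat_holomorphic_on (simple_poly A (of_real a) (of_real b)) (- {0})"
      "mat_holomorphic_on (simple_inv_poly A (of_real a') (of_real b')) (- {0})"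
      unfolding mat_holomorphic_on_def forall_3 simple_poly_def simple_inv_poly_def simple_num_def simple_inv_num_def Let_def
      using cab(1,2) by (auto intro!: holomorphic_intros)
    moreover have "mat_holomorphic_on F (- {0})"
      using F by (simp add: Lambda_plus_SL_def)
    ultimately show ?thesis
      using mat_holomorphic_on_mult[OF mat_holomorphic_on_mult] unfolding K_def mat_holomorphic_on_def by blast
  qed
  have ex: "\<exists>q. q holomorphic_on - {0} \<and> (\<forall>l\<in>- {0}. K l $ i $ j = P l * q l)" for i j
  proof (rule holomorphic_quotient[OF _ Khol _ fin])
    show "P holomorphic_on - {0}"
      unfolding P_def[abs_def] by (intro holomorphic_intros)
    fix l :: complex assume l: "l \<in> - {0}" "P l = 0"
    \<comment> \<open>The derivative 6 l^5 shows that the zeros are simple away from 0.\<close>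
    have "P = (\<lambda>l. l^6 - A^6)"
      by (auto simp: P_def algebra_simps simp flip: power_add)
    then have "(P has_field_derivative 6 * l^5) (at l)"
      by (auto intro!: derivative_eq_intros)
    then have "deriv P l \<noteq> 0"
      using l by (simp add: DERIV_imp_deriv)
    then show "K l $ i $ j = 0 \<and> deriv P l \<noteq> 0"
      using Kzero[OF l(2)] by simp
  qed auto
  define q where "q i j = (SOME q. q holomorphic_on - {0} \<and> (\<forall>l\<in>- {0}. K l $ i $ j = P l * q l))" for i j
  have q: "q i j holomorphic_on - {0}" "\<And>l. l \<noteq> 0 \<Longrightarrow> K l $ i $ j = P l * q i j l" for i j
    using someI_ex[OF ex[of i j]] unfolding q_def by auto
  define f :: loop where "f l = (\<chi> i j. q i j l)" for l
  have fgen: "f l = S l ** F l ** R l" if "l \<in> - {0} - ?Z" for l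
  proof -
    have l: "l \<noteq> 0" "P l \<noteq> 0" using that by auto
    then have k: "l^3 \<noteq> A^3" "l^3 + A^3 \<noteq> 0" by (auto simp: P_def)
    have "K l $ i $ j = P l * (S l ** F l ** R l) $ i $ j" for i j
      unfolding K_def P_def matrix_matrix_mult_def S_def R_def simple_matrix_eq A_def[symmetric]
      using simple_poly_entries[OF k(1)] simple_inv_poly_entries[OF k(2)]
      by (simp add: sum_distrib_left sum_distrib_right mult_ac)
    then show ?thesis
      using q(2)[OF l(1)] l(2) by (simp add: f_def vec_eq_iff)
  qed
  have cube: "l^3 \<noteq> A^3" "l^3 \<noteq> - (A^3)" if "l \<in> - {0} - ?Z" for l
    using that by (auto simp: P_def)
  have Sinv: "simple A (of_real a') (of_real b') l ** R l = mat 1" "R l ** simple A (of_real a') (of_real b') l = mat 1"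
    if "l^3 \<noteq> A^3" "l^3 \<noteq> - (A^3)" for l
    using simple_mult_inv[OF cab(2) that] invertible_simple(2)[OF cab(2) that] by (simp_all add: R_def)
  have fhol: "mat_holomorphic_on f (- {0})"
    using q(1) by (simp add: mat_holomorphic_on_def f_def)
  have cont: "continuous_on (- {0}) (\<lambda>l. f l $ i $ j)" for i j
    using q(1) by (simp add: f_def holomorphic_on_imp_continuous_on)
  have cont_cnj: "continuous_on (- {0}) (\<lambda>l. f (cnj l) $ i $ j)" for i j
    by (rule continuous_on_compose2[OF cont]) (auto intro!: continuous_intros)
  have cont_eps: "continuous_on (- {0}) (\<lambda>l. f (eps * l) $ i $ j)" for i j
    by (rule continuous_on_compose2[OF cont]) (auto intro!: continuous_intros)
  have opn: "open (- {0 :: complex})" by auto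
  have cont_det: "continuous_on (- {0}) (\<lambda>l. det (f l))"
    unfolding det_3 by (intro continuous_on_add continuous_on_diff continuous_on_mult cont)
  have det_gen: "det (f l) = 1" if l: "l \<in> - {0} - ?Z" for l
  proof -
    have "det (simple A (of_real a') (of_real b') l ** R l) = 1"
      unfolding Sinv(1)[OF cube[OF l]] by simp
    then have "det (simple A (of_real a') (of_real b') l) * det (R l) = 1"
      by (simp only: det_mul)
    moreover have "det (S l) = det (simple A (of_real a') (of_real b') l)"
      unfolding S_def simple_matrix_eq A_def[symmetric]
        det_simple[OF cab(1) cube(1)[OF l]] det_simple[OF cab(2) cube(1)[OF l]] ..
    moreover have "det (F l) = 1"
      using Lambda_plusD(2)[OF F] l by simp
    ultimately show ?thesis
      unfolding fgen[OF l] det_mul by simp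
  qed
  have det: "det (f l) = 1" if "l \<in> - {0}" for l
    by (rule continuous_eq_off_finite[where g = "\<lambda>_. 1", OF opn fin cont_det continuous_on_const det_gen that])
  have cnj: "cnj_mat (f (cnj l)) = f l" if l: "l \<in> - {0}" for l
  proof -
    have gen: "cnj (f (cnj l) $ i $ j) = f l $ i $ j" if l: "l \<in> - {0} - ?Z" for i j l
    proof -
      have "P (cnj l) = cnj (P l)" by (simp add: P_def A_def)
      then have l': "cnj l \<in> - {0} - ?Z" using l by auto
      have "cnj_mat (F (cnj l)) = F l" using Lambda_plusD(3)[OF F, of l] l by auto
      then have "cnj_mat (f (cnj l)) = f l"
        unfolding fgen[OF l] fgen[OF l']
        by (simp add: cnj_mat_mult S_def R_def simple_matrix_eq A_def cnj_simple)
      then show ?thesis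
        by (simp add: cnj_mat_def vec_eq_iff)
    qed
    have "cnj (f (cnj l) $ i $ j) = f l $ i $ j" for i j
      by (rule continuous_eq_off_finite[OF opn fin continuous_on_cnj[OF cont_cnj] cont _ l]) (rule gen)
    then show ?thesis by (simp add: cnj_mat_def vec_eq_iff)
  qed
  have sig: "f (eps * l) ** T_mat ** transpose (f l) = T_mat" if l: "l \<in> - {0}" for l
  proof -
    have gen: "(f (eps * l) ** T_mat ** transpose (f l)) $ i $ j = T_mat $ i $ j" if l: "l \<in> - {0} - ?Z" for i j l
    proof -
      have "P (eps * l) = P l" unfolding P_def eps_mult_cube by (simp add: algebra_simps)
      then have l': "eps * l \<in> - {0} - ?Z" using l by auto
      have l0: "l \<noteq> 0" using l by auto
      have simple_sig: "simple A (of_real u) (of_real v) (eps * l) ** T_mat ** transpose (simple A (of_real u) (of_real v) l) = T_mat"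
        if "2 * complex_of_real u * of_real v \<noteq> 1" for u v
      proof -
        have "simple A (of_real u) (of_real v) (eps * l) ** T_mat ** transpose (simple A (of_real u) (of_real v) l)
          = T_mat ** transpose (simple A (of_real u) (of_real v) l ** simple_inv A (of_real u) (of_real v) l)"
          unfolding simple_eps matrix_transpose_mul by (simp only: matrix_mul_assoc)
        then show ?thesis
          unfolding simple_mult_inv[OF that cube[OF l]] by simp
      qed
      have S: "S (eps * l) ** T_mat ** transpose (S l) = T_mat"
        unfolding S_def simple_matrix_eq A_def[symmetric] by (rule simple_sig[OF cab(1)])
      \<comment> \<open>\<open>R\<close> inverts a twisted matrix; writing T as s T s^t for that
        matrix s makes the inverses cancel.\<close>
      have R: "R (eps * l) ** T_mat ** transpose (R l) = T_mat"
      proof -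
        let ?s = "simple A (of_real a') (of_real b')"
        have "R (eps * l) ** (?s (eps * l) ** T_mat ** transpose (?s l)) ** transpose (R l)
          = (R (eps * l) ** ?s (eps * l)) ** T_mat ** transpose (R l ** ?s l)"
          by (simp only: matrix_transpose_mul matrix_mul_assoc)
        then show ?thesis
          unfolding simple_sig[OF cab(2)] Sinv(2)[OF cube[OF l]] Sinv(2)[OF cube[OF l']] by simp
      qed
      have "f (eps * l) ** T_mat ** transpose (f l) =
          S (eps * l) ** (F (eps * l) ** (R (eps * l) ** T_mat ** transpose (R l)) ** transpose (F l)) ** transpose (S l)"
        unfolding fgen[OF l] fgen[OF l'] by (simp only: matrix_transpose_mul matrix_mul_assoc)
      then have "f (eps * l) ** T_mat ** transpose (f l) = T_mat"
        unfolding R Lambda_plusD(4)[OF F l0] S .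
      then show ?thesis by simp
    qed
    have c: "continuous_on (- {0}) (\<lambda>l. (f (eps * l) ** T_mat ** transpose (f l)) $ i $ j)" for i j
      unfolding matrix_matrix_mult_def transpose_def vec_lambda_beta
      by (intro continuous_on_sum continuous_on_mult continuous_on_const cont cont_eps)
    have "(f (eps * l) ** T_mat ** transpose (f l)) $ i $ j = T_mat $ i $ j" for i j
      by (rule continuous_eq_off_finite[OF opn fin c continuous_on_const _ l]) (rule gen)
    then show ?thesis by (simp add: vec_eq_iff)
  qed
  have finv: "\<forall>l\<in>- {0}. invertible (f l)"
    using det by (simp add: invertible_det_nz)
  have "f \<in> Lambda_plus_SL"
    unfolding Lambda_plus_SL_def mem_Collect_eq tau_sigma_on_iff[OF finv] using fhol det cnj sig by blast
  moreover have "simple_matrix \<alpha> a' b' \<in> Lambda_minus_GL r"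
    by (rule simple_in_Lambda_minus[OF r \<alpha> ab'])
  moreover have "S l ** F l = f l ** simple_matrix \<alpha> a' b' l" if l: "l \<in> near_0_inf r - {0}" for l
  proof -
    have k: "l^3 \<noteq> A^3" "l^3 \<noteq> - (A^3)"
      using near_0_inf_cube_neq[OF r(1) \<alpha>, of l] l by (auto simp: A_def)
    then have "l \<in> - {0} - ?Z" using l by (auto simp: P_def eq_neg_iff_add_eq_0)
    from fgen[OF this] show ?thesis
      unfolding simple_matrix_eq A_def[symmetric] using Sinv(2)[OF k] by (simp add: matrix_mul_assoc[symmetric])
  qed
  ultimately have "dressing_factor r (simple_matrix \<alpha> a b) F f"
    unfolding dressing_factor_def S_def by blast
  moreover have "f l = simple_matrix \<alpha> a b l ** F l ** simple_inv A (of_real a') (of_real b') l"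
    if "l \<noteq> 0" "l^3 \<noteq> A^3" "l^3 \<noteq> - (A^3)" for l
    using fgen[of l] that by (simp add: P_def eq_neg_iff_add_eq_0 S_def R_def)
  ultimately show thesis by (rule that)
qed

section \<open>Permutability\<close>

lemma isotropic_scale:
  fixes k x y z :: real
  assumes "k \<noteq> 0"
  shows "2 * (k * x) * (k * y) = (k * z)^2 \<longleftrightarrow> 2 * x * y = z^2"
proof -
  have "2 * (k * x) * (k * y) = k^2 * (2 * x * y)"
    by (simp add: power2_eq_square)
  then show ?thesis
    unfolding power_mult_distrib using assms by (simp only: mult_cancel_left) simp
qed

lemma span_subset_Delta0_iff: "span {v} \<subseteq> Delta0 \<longleftrightarrow> 2 * v $ 1 * v $ 2 = (v $ 3)^2 \<or> v $ 3 = 0"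
proof
  assume "span {v} \<subseteq> Delta0"
  then have "v \<in> Delta0" by (auto intro: span_base)
  then show "2 * v $ 1 * v $ 2 = (v $ 3)^2 \<or> v $ 3 = 0" by (simp add: Delta0_def)
next
  assume v: "2 * v $ 1 * v $ 2 = (v $ 3)^2 \<or> v $ 3 = 0"
  show "span {v} \<subseteq> Delta0"
  proof
    fix w assume "w \<in> span {v}"
    then obtain k where w: "w = k *\<^sub>R v" by (auto simp: span_singleton)
    with v show "w \<in> Delta0"
      using isotropic_scale[of k "v $ 1" "v $ 2" "v $ 3"] by (cases "k = 0") (auto simp: Delta0_def)
  qed
qed

lemma line_times_span: "line_times (span {v}) M = span {v v* M}"
  by (auto simp: line_times_def span_singleton scaleR_vector_matrix_assoc[symmetric] image_image)

lemma span_normalize: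
  fixes v :: "real^3"
  assumes "v $ 3 \<noteq> 0"
  shows "v = v $ 3 *s vector [v $ 1 / v $ 3, v $ 2 / v $ 3, 1]"
    and "span {v} = span {vector [v $ 1 / v $ 3, v $ 2 / v $ 3, 1]}"
proof -
  show *: "v = v $ 3 *s vector [v $ 1 / v $ 3, v $ 2 / v $ 3, 1]"
    using assms by (simp add: vec_eq_iff forall_3)
  have "span {k *s w} = span {w}" if "k \<noteq> 0" for k and w :: "real^3"
    using that span_image_scale[of "{w}" "\<lambda>_. k"] by (simp add: scalar_mult_eq_scaleR)
  from this[OF assms] * show "span {v} = span {vector [v $ 1 / v $ 3, v $ 2 / v $ 3, 1]}"
    by metis
qed

lemma simple_element_span: "simple_element \<alpha> (span {vector [a, b, 1]}) = simple_matrix \<alpha> a b"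
proof -
  have "a' = a \<and> b' = b" if "span {vector [a, b, 1]} = span {vector [a', b', 1] :: real^3}" for a' b'
  proof -
    have "vector [a, b, 1] \<in> span {vector [a', b', 1] :: real^3}"
      using that span_base by blast
    then obtain k where "vector [a, b, 1] = k *\<^sub>R (vector [a', b', 1] :: real^3)"
      by (auto simp: span_singleton)
    then show ?thesis by (simp add: vec_eq_iff forall_3)
  qed
  then have "(THE (a', b'). span {vector [a, b, 1]} = span {vector [a', b', 1] :: real^3}) = (a, b)"
    by (intro the_equality) auto
  then show ?thesis by (simp add: simple_element_def)
qed

lemma not_Delta0D:
  assumes "\<not> line_times (span {v}) M \<subseteq> Delta0"
  shows "(v v* M) $ 3 \<noteq> 0" and "2 * (v v* M) $ 1 * (v v* M) $ 2 \<noteq> ((v v* M) $ 3)^2"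
  using assms unfolding line_times_span span_subset_Delta0_iff by auto

lemma slopes_neq_1:
  fixes x y z :: real
  assumes "z \<noteq> 0" "2 * x * y \<noteq> z^2"
  shows "2 * (x / z) * (y / z) \<noteq> 1"
  using assms by (simp add: field_simps power2_eq_square)

lemma simple_line:
  assumes "\<not> line_times (span {v}) M \<subseteq> Delta0"
  obtains k a b where "k \<noteq> 0" "2 * a * b \<noteq> 1" "v v* M = k *s vector [a, b, 1]"
    "line_times (span {v}) M = span {vector [a, b, 1]}"
    "simple_element \<alpha> (line_times (span {v}) M) = simple_matrix \<alpha> a b"
proof -
  let ?w = "v v* M"
  note nd = not_Delta0D[OF assms]
  have line: "line_times (span {v}) M = span {vector [?w $ 1 / ?w $ 3, ?w $ 2 / ?w $ 3, 1]}"
    unfolding line_times_span by (rule span_normalize(2)[OF nd(1)])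
  show thesis
    by (rule that[OF nd(1) slopes_neq_1[OF nd] span_normalize(1)[OF nd(1)] line])
      (simp only: line simple_element_span)
qed

lemma of_real_simple:
  "simple (of_real \<alpha>) (of_real a) (of_real b) (of_real l) $ i $ j = complex_of_real (simple \<alpha> a b l $ i $ j)"
  "simple_inv (of_real \<alpha>) (of_real a) (of_real b) (of_real l) $ i $ j = complex_of_real (simple_inv \<alpha> a b l $ i $ j)"
proof -
  have "\<forall>i j. simple (of_real \<alpha>) (of_real a) (of_real b) (of_real l) $ i $ j = complex_of_real (simple \<alpha> a b l $ i $ j)"
    unfolding forall_3 by (simp add: simple_def simple_num_def Let_def mat_def)
  then show "simple (of_real \<alpha>) (of_real a) (of_real b) (of_real l) $ i $ j = complex_of_real (simple \<alpha> a b l $ i $ j)"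
    by blast
  have "\<forall>i j. simple_inv (of_real \<alpha>) (of_real a) (of_real b) (of_real l) $ i $ j = complex_of_real (simple_inv \<alpha> a b l $ i $ j)"
    unfolding forall_3 by (simp add: simple_inv_def simple_inv_num_def Let_def mat_def)
  then show "simple_inv (of_real \<alpha>) (of_real a) (of_real b) (of_real l) $ i $ j = complex_of_real (simple_inv \<alpha> a b l $ i $ j)"
    by blast
qed

lemma Re_mat_simple:
  "Re_mat (simple_matrix \<alpha> a b (of_real l)) = simple \<alpha> a b l"
  "Re_mat (simple_inv (of_real \<alpha>) (of_real a) (of_real b) (of_real l)) = simple_inv \<alpha> a b l"
  by (simp_all add: Re_mat_def vec_eq_iff simple_matrix_eq of_real_simple)

text \<open>Real entries in the left factor suffice for real parts to multiply.\<close>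

lemma Re_mat_mult:
  assumes "\<And>i j. A $ i $ j = of_real (Re_mat A $ i $ j)"
  shows "Re_mat (A ** B) = Re_mat A ** Re_mat B"
proof -
  have "Im (A $ i $ j) = 0" for i j
    by (subst assms) simp
  then show ?thesis
    by (simp add: Re_mat_def vec_eq_iff matrix_matrix_mult_def)
qed

text \<open>From g F = f k and g' f = f' k' follows g' g F = f' k' k, with k' k again in the minus
  group.\<close>

lemma dressing_factor_compose:
  assumes "dressing_factor r g F f" "dressing_factor r g' f f'"
  shows "dressing_factor r (loop_mult g' g) F f'"
proof -
  obtain k k' where k: "k \<in> Lambda_minus_GL r" "\<And>l. l \<in> near_0_inf r - {0} \<Longrightarrow> g l ** F l = f l ** k l"
    and k': "k' \<in> Lambda_minus_GL r" "\<And>l. l \<in> near_0_inf r - {0} \<Longrightarrow> g' l ** f l = f' l ** k' l"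
    using assms by (auto simp: dressing_factor_def)
  have "loop_mult g' g l ** F l = f' l ** loop_mult k' k l" if l: "l \<in> near_0_inf r - {0}" for l
  proof -
    have "g' l ** (g l ** F l) = (g' l ** f l) ** k l"
      unfolding k(2)[OF l] by (simp only: matrix_mul_assoc)
    then show ?thesis
      unfolding k'(2)[OF l] by (simp only: loop_mult_def matrix_mul_assoc)
  qed
  then show ?thesis
    using assms(2) Lambda_minus_mult[OF k'(1) k(1)] unfolding dressing_factor_def by blast
qed

lemma dressing_factor_cong:
  assumes "\<And>l. l \<in> near_0_inf r - {0} \<Longrightarrow> g l = g' l"
  shows "dressing_factor r g F f \<longleftrightarrow> dressing_factor r g' F f"
  unfolding dressing_factor_def using assms by simp

lemma dressing_factor_dress:
  assumes "dressing_factor r g (F p) f"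
  shows "dressing_factor r g (F p) (dress r g F p)"
  unfolding dress_def using assms by (rule someI[of "dressing_factor r g (F p)"])

text \<open>Uniqueness identifies the chosen value of \<open>dress\<close> with the constructed
  factor, which makes the explicit formula available for it.\<close>

lemma dress_simple:
  fixes \<alpha> a b :: real and F :: "real \<times> real \<Rightarrow> loop" and p :: "real \<times> real"
  defines "v \<equiv> vector [a, b, 1] v* Re_mat (F p (of_real \<alpha>))"
  assumes r: "0 < r" "r < 1" and \<alpha>: "r < \<bar>\<alpha>\<bar>" "\<bar>\<alpha>\<bar> < 1 / r"
    and F: "F p \<in> Lambda_plus_SL" and ab: "2 * a * b \<noteq> 1"
    and v: "v $ 3 \<noteq> 0" "2 * v $ 1 * v $ 2 \<noteq> (v $ 3)^2"
  shows "dressing_factor r (simple_matrix \<alpha> a b) (F p) (dress r (simple_matrix \<alpha> a b) F p)"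
    and "\<And>l. l \<noteq> 0 \<Longrightarrow> l^3 \<noteq> of_real \<alpha>^3 \<Longrightarrow> l^3 \<noteq> - (of_real \<alpha>^3) \<Longrightarrow>
      dress r (simple_matrix \<alpha> a b) F p l = simple_matrix \<alpha> a b l ** F p l
        ** simple_inv (of_real \<alpha>) (of_real (v $ 1 / v $ 3)) (of_real (v $ 2 / v $ 3)) l"
proof -
  have line: "vector [a, b, 1] v* Re_mat (F p (of_real \<alpha>)) = v $ 3 *s vector [v $ 1 / v $ 3, v $ 2 / v $ 3, 1]"
    unfolding v_def[symmetric] by (rule span_normalize(1)[OF v(1)])
  obtain f where f: "dressing_factor r (simple_matrix \<alpha> a b) (F p) f"
    "\<And>l. l \<noteq> 0 \<Longrightarrow> l^3 \<noteq> of_real \<alpha>^3 \<Longrightarrow> l^3 \<noteq> - (of_real \<alpha>^3) \<Longrightarrow>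
      f l = simple_matrix \<alpha> a b l ** F p l
        ** simple_inv (of_real \<alpha>) (of_real (v $ 1 / v $ 3)) (of_real (v $ 2 / v $ 3)) l"
    using dressing_simple[OF r \<alpha> F ab slopes_neq_1[OF v] v(1) line] by blast
  show df: "dressing_factor r (simple_matrix \<alpha> a b) (F p) (dress r (simple_matrix \<alpha> a b) F p)"
    by (rule dressing_factor_dress) (rule f(1))
  show "dress r (simple_matrix \<alpha> a b) F p l = simple_matrix \<alpha> a b l ** F p l
        ** simple_inv (of_real \<alpha>) (of_real (v $ 1 / v $ 3)) (of_real (v $ 2 / v $ 3)) l"
    if "l \<noteq> 0" "l^3 \<noteq> of_real \<alpha>^3" "l^3 \<noteq> - (of_real \<alpha>^3)" for l
    using dressing_factor_unique[OF r df f(1) that(1)] f(2)[OF that] by simp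
qed

text \<open>At real \<lambda> the frame is real, so the complex matrix system restricts to the real
  column system.\<close>

lemma affine_frame_frame:
  assumes D: "open D" and F: "affine_frame D h F" and l: "l \<noteq> 0"
  shows "frame D h l (\<lambda>j p. column j (Re_mat (F p (of_real l))))"
proof -
  let ?G = "\<lambda>p. F p (of_real l)"
  have plus: "F p \<in> Lambda_plus_SL" if "p \<in> D" for p
    using F that by (simp add: affine_frame_def)
  have smF: "smooth_on D ?G"
  proof -
    have "open (- {0 :: complex})" "of_real l \<in> - {0 :: complex}" using l by auto
    moreover have "smooth_on (D \<times> - {0}) (\<lambda>(p, l). F p l)"
      using F unfolding affine_frame_def by blast
    ultimately show ?thesis
      using smooth_on_slice[OF D, of "- {0}" "of_real l" "\<lambda>(p, l). F p l"] by simp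
  qed
  have lin: "bounded_linear (\<lambda>A::cmat. column j (Re_mat A))" for j
    unfolding linear_conv_bounded_linear[symmetric]
    by (rule linearI) (simp_all add: column_def Re_mat_def vec_eq_iff)
  have sm: "smooth_on D (\<lambda>p. column j (Re_mat (?G p)))" for j
    by (rule smooth_on_linear[OF lin D smF])
  have d: "dx (\<lambda>p. column j (Re_mat (?G p))) p = column j (Re_mat (dx ?G p))"
    "dy (\<lambda>p. column j (Re_mat (?G p))) p = column j (Re_mat (dy ?G p))" if "p \<in> D" for j p
    unfolding dx_def[of "\<lambda>p. column j (Re_mat (?G p))"] dy_def[of "\<lambda>p. column j (Re_mat (?G p))"]
    using bounded_linear.has_vector_derivative[OF lin smooth_on_has_partials(1)[OF smF that]]
      bounded_linear.has_vector_derivative[OF lin smooth_on_has_partials(2)[OF smF that]]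
    by (auto intro: vector_derivative_at)
  show ?thesis
    unfolding frame_def
  proof (intro conjI ballI allI l sm)
    fix p j assume p: "p \<in> D"
    have inv: "invertible (?G p)" using Lambda_plusD(1)[OF plus[OF p]] l by simp
    have re: "?G p $ i $ j = of_real (Re_mat (?G p) $ i $ j)" for i j
      by (rule of_real_Re_mat_Lambda_plus[OF plus[OF p] l])
    let ?A = "vector [vector [of_real (dx h p / h p), 0, of_real l],
        vector [of_real l, of_real (- dx h p / h p), 0], vector [0, of_real l, 0]] :: cmat"
    let ?B = "cscale (1 / of_real l) (vector [vector [0, of_real (1 / (h p)^2), 0],
        vector [0, 0, of_real (h p)], vector [of_real (h p), 0, 0]]) :: cmat"
    have AB: "matrix_inv (?G p) ** dx ?G p = ?A" "matrix_inv (?G p) ** dy ?G p = ?B"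
      using F p l unfolding affine_frame_def by auto
    \<comment> \<open>Multiplying back by F turns F^{-1} F_x = A into F_x = F A, and likewise in
      y.\<close>
    have "?G p ** (matrix_inv (?G p) ** dx ?G p) = dx ?G p" "?G p ** (matrix_inv (?G p) ** dy ?G p) = dy ?G p"
      using matrix_inv_mult(2)[OF inv] by (simp_all add: matrix_mul_assoc)
    then have GAB: "dx ?G p = ?G p ** ?A" "dy ?G p = ?G p ** ?B"
      unfolding AB by simp_all
    have "Re_mat ?A = frame_x (dx h p / h p) l"
      by (simp add: Re_mat_def frame_x_def vec_eq_iff forall_3)
    moreover have "Re_mat ?B = frame_y (h p) l"
      by (simp add: Re_mat_def frame_y_def vec_eq_iff forall_3 cscale_def)
    ultimately have GAB': "Re_mat (dx ?G p) = Re_mat (?G p) ** frame_x (dx h p / h p) l"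
      "Re_mat (dy ?G p) = Re_mat (?G p) ** frame_y (h p) l"
      unfolding GAB Re_mat_mult[OF re] by simp_all
    have col: "column j (M ** A) = (\<Sum>i\<in>UNIV. A $ i $ j *\<^sub>R column i M)" for M A :: "real^3^3"
      by (simp add: column_def matrix_matrix_mult_def vec_eq_iff mult.commute)
    show "dx (\<lambda>p. column j (Re_mat (?G p))) p =
        (\<Sum>i\<in>UNIV. frame_x (dx h p / h p) l $ i $ j *\<^sub>R column i (Re_mat (?G p)))"
      "dy (\<lambda>p. column j (Re_mat (?G p))) p =
        (\<Sum>i\<in>UNIV. frame_y (h p) l $ i $ j *\<^sub>R column i (Re_mat (?G p)))"
      unfolding d[OF p] GAB' col by simp_all
  qed
qed

text \<open>The transported line at the second pole is, up to scale, the line of the first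
  transform of the second scalar solution.\<close>

lemma second_line_nondegenerate:
  fixes \<alpha> \<beta> a b u v a' b' k :: real and F F' :: "real \<times> real \<Rightarrow> loop"
  defines "z \<equiv> \<lambda>j p. vector [a, b, 1] \<bullet> column j (Re_mat (F p (of_real \<alpha>)))"
    and "y \<equiv> \<lambda>j p. vector [u, v, 1] \<bullet> column j (Re_mat (F p (of_real \<beta>)))"
  assumes F: "F p \<in> Lambda_plus_SL" and ab: "2 * a * b \<noteq> 1"
    and neq: "\<beta> \<noteq> 0" "\<beta>^3 \<noteq> \<alpha>^3" "\<beta>^3 \<noteq> - (\<alpha>^3)"
    and F': "F' p (of_real \<beta>) = simple_matrix \<alpha> a b (of_real \<beta>) ** F p (of_real \<beta>)
        ** simple_inv (of_real \<alpha>) (of_real (slope1 z p)) (of_real (slope2 z p)) (of_real \<beta>)"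
    and k: "k \<noteq> 0" "vector [u, v, 1] v* simple_inv \<alpha> a b \<beta> = k *s vector [a', b', 1]"
    and nd: "\<not> line_times (span {vector [a', b', 1]}) (Re_mat (F' p (of_real \<beta>))) \<subseteq> Delta0"
  shows "new_frame \<alpha> z \<beta> y 3 p \<noteq> 0"
    and "2 * new_frame \<alpha> z \<beta> y 1 p * new_frame \<alpha> z \<beta> y 2 p \<noteq> (new_frame \<alpha> z \<beta> y 3 p)^2"
proof -
  let ?C = "simple_inv \<alpha> (slope1 z p) (slope2 z p) \<beta>"
  let ?G = "Re_mat (F p (of_real \<beta>))"
  let ?w = "vector [a', b', 1] v* Re_mat (F' p (of_real \<beta>))"
  have re: "F p (of_real \<beta>) $ i $ j = of_real (?G $ i $ j)" for i j
    by (rule of_real_Re_mat_Lambda_plus[OF F neq(1)])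
  have res: "simple_matrix \<alpha> a b (of_real \<beta>) $ i $ j = of_real (Re_mat (simple_matrix \<alpha> a b (of_real \<beta>)) $ i $ j)" for i j
    unfolding Re_mat_simple by (simp add: simple_matrix_eq of_real_simple)
  have rep: "(simple_matrix \<alpha> a b (of_real \<beta>) ** F p (of_real \<beta>)) $ i $ j
      = of_real (Re_mat (simple_matrix \<alpha> a b (of_real \<beta>) ** F p (of_real \<beta>)) $ i $ j)" for i j
    unfolding Re_mat_mult[OF res] using re res by (simp add: matrix_matrix_mult_def)
  have ReF': "Re_mat (F' p (of_real \<beta>)) = simple \<alpha> a b \<beta> ** ?G ** ?C"
    unfolding F' Re_mat_mult[OF rep] Re_mat_mult[OF res] Re_mat_simple ..
  \<comment> \<open>The inverse g(\<beta>)^{-1} hidden in (a', b', 1) cancels against the left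
    factor g(\<beta>) of F', leaving the original row times F(\<beta>) and the gauge.\<close>
  have "k *s ?w = (vector [u, v, 1] v* simple_inv \<alpha> a b \<beta>) v* (simple \<alpha> a b \<beta> ** ?G ** ?C)"
    unfolding k(2) ReF' by (simp add: scalar_vector_matrix_assoc)
  also have "\<dots> = vector [u, v, 1] v* ((simple_inv \<alpha> a b \<beta> ** simple \<alpha> a b \<beta>) ** ?G ** ?C)"
    by (simp only: vector_matrix_mul_assoc matrix_mul_assoc)
  also have "\<dots> = (vector [u, v, 1] v* ?G) v* ?C"
    unfolding invertible_simple(2)[OF ab neq(2,3)] by (simp add: vector_matrix_mul_assoc)
  finally have n: "new_frame \<alpha> z \<beta> y j p = k * ?w $ j" for j
    by (simp add: vec_eq_iff new_frame_def y_def vector_matrix_mult_def inner_vec_def column_def mult_ac)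
  have w: "?w $ 3 \<noteq> 0" "2 * ?w $ 1 * ?w $ 2 \<noteq> (?w $ 3)^2"
    using not_Delta0D[OF nd] by auto
  show "new_frame \<alpha> z \<beta> y 3 p \<noteq> 0"
    unfolding n using k(1) w(1) by simp
  show "2 * new_frame \<alpha> z \<beta> y 1 p * new_frame \<alpha> z \<beta> y 2 p \<noteq> (new_frame \<alpha> z \<beta> y 3 p)^2"
    unfolding n isotropic_scale[OF k(1)] by (rule w(2))
qed

lemma row_mult_eq_inner: "(v v* M) $ j = v \<bullet> column j M" for M :: "real^3^3"
  by (simp add: vector_matrix_mult_def inner_vec_def column_def mult.commute)

text \<open>Stated for one order of the two dressings; the theorem uses it once for each order, with
  the indices exchanged.\<close>

lemma two_step_dressing:
  fixes \<alpha> \<beta> a b u v a' b' k r :: real and F :: "real \<times> real \<Rightarrow> loop"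
  defines "z \<equiv> \<lambda>j p. vector [a, b, 1] \<bullet> column j (Re_mat (F p (of_real \<alpha>)))"
    and "y \<equiv> \<lambda>j p. vector [u, v, 1] \<bullet> column j (Re_mat (F p (of_real \<beta>)))"
    and "F' \<equiv> dress r (simple_matrix \<alpha> a b) F"
  assumes F: "\<forall>p\<in>D. F p \<in> Lambda_plus_SL" and r: "0 < r" "r < 1"
    and \<alpha>: "r < \<bar>\<alpha>\<bar>" "\<bar>\<alpha>\<bar> < 1 / r" and \<beta>: "r < \<bar>\<beta>\<bar>" "\<bar>\<beta>\<bar> < 1 / r"
    and neq: "\<beta>^3 \<noteq> \<alpha>^3" "\<beta>^3 \<noteq> - (\<alpha>^3)"
    and ab: "2 * a * b \<noteq> 1" and ab': "2 * a' * b' \<noteq> 1"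
    and line: "\<forall>p\<in>D. \<not> line_times (span {vector [a, b, 1]}) (Re_mat (F p (of_real \<alpha>))) \<subseteq> Delta0"
    and k: "k \<noteq> 0" "vector [u, v, 1] v* simple_inv \<alpha> a b \<beta> = k *s vector [a', b', 1]"
    and line': "\<forall>p\<in>D. \<not> line_times (span {vector [a', b', 1]}) (Re_mat (F' p (of_real \<beta>))) \<subseteq> Delta0"
  shows "dressing_defined r D (simple_matrix \<alpha> a b) F"
    and "dressing_defined r D (simple_matrix \<beta> a' b') F'"
    and "\<forall>p\<in>D. dressing_factor r (loop_mult (simple_matrix \<beta> a' b') (simple_matrix \<alpha> a b)) (F p)
      (dress r (simple_matrix \<beta> a' b') F' p)"
    and "nondegenerate D z"
    and "nondegenerate D (new_frame \<alpha> z \<beta> y)"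
proof -
  have \<beta>0: "\<beta> \<noteq> 0" using r \<beta> by auto
  have F': "dressing_factor r (simple_matrix \<alpha> a b) (F p) (F' p)" if p: "p \<in> D" for p
    unfolding F'_def using dress_simple(1)[where F = F and p = p, OF r \<alpha> _ ab not_Delta0D[OF line[rule_format, OF p]]] F p by blast
  then have F'_plus: "F' p \<in> Lambda_plus_SL" if "p \<in> D" for p
    using that by (auto simp: dressing_factor_def)
  have F'': "dressing_factor r (simple_matrix \<beta> a' b') (F' p) (dress r (simple_matrix \<beta> a' b') F' p)" if p: "p \<in> D" for p
    using dress_simple(1)[where F = F' and p = p, OF r \<beta> F'_plus[OF p] ab' not_Delta0D[OF line'[rule_format, OF p]]] .
  show "dressing_defined r D (simple_matrix \<alpha> a b) F" "dressing_defined r D (simple_matrix \<beta> a' b') F'"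
    unfolding dressing_defined_def
    using simple_in_Lambda_minus[OF r \<alpha> ab] simple_in_Lambda_minus[OF r \<beta> ab'] F' F'' by blast+
  show "\<forall>p\<in>D. dressing_factor r (loop_mult (simple_matrix \<beta> a' b') (simple_matrix \<alpha> a b)) (F p)
      (dress r (simple_matrix \<beta> a' b') F' p)"
    using dressing_factor_compose[OF F' F''] by blast
  show "nondegenerate D z"
    unfolding nondegenerate_def z_def row_mult_eq_inner[symmetric]
    using not_Delta0D[OF line[rule_format]] by blast
  show "nondegenerate D (new_frame \<alpha> z \<beta> y)"
    unfolding nondegenerate_def
  proof
    fix p assume p: "p \<in> D"
    have Fp: "F p \<in> Lambda_plus_SL" using F p by blast
    have "(of_real \<beta> :: complex)^3 \<noteq> of_real \<alpha>^3" "(of_real \<beta> :: complex)^3 \<noteq> - (of_real \<alpha>^3)"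
      using neq by (metis of_real_eq_iff of_real_power, metis of_real_eq_iff of_real_power of_real_minus)
    then have "F' p (of_real \<beta>) = simple_matrix \<alpha> a b (of_real \<beta>) ** F p (of_real \<beta>)
        ** simple_inv (of_real \<alpha>) (of_real (slope1 z p)) (of_real (slope2 z p)) (of_real \<beta>)"
      unfolding F'_def slope1_def slope2_def z_def row_mult_eq_inner[symmetric]
      using dress_simple(2)[where F = F and p = p, OF r \<alpha> Fp ab not_Delta0D[OF line[rule_format, OF p]], of "of_real \<beta>"] \<beta>0 by simp
    note second_line_nondegenerate[where F = F and F' = F' and p = p and u = u and v = v, OF Fp ab \<beta>0 neq this[unfolded z_def] k line'[rule_format, OF p]]
    then show "new_frame \<alpha> z \<beta> y 3 p \<noteq> 0 \<and>
        2 * new_frame \<alpha> z \<beta> y 1 p * new_frame \<alpha> z \<beta> y 2 p \<noteq> (new_frame \<alpha> z \<beta> y 3 p)^2"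
      unfolding z_def y_def by blast
  qed
qed

theorem theorem5p3:
  fixes D :: "(real \<times> real) set"
    and h h1 h2 h12 h21 \<phi>1 \<phi>2 \<phi>12 \<phi>21 :: "real \<times> real \<Rightarrow> real"
    and F F1 F2 F12 F21 :: "real \<times> real \<Rightarrow> loop"
    and g1 g2 g1' g2' :: loop
    and r \<alpha>1 \<alpha>2 a1 b1 a2 b2 \<gamma>1 \<gamma>2 :: real
    and l1 l2 :: "real^3"
    and L1 L2 L1' L2' :: "(real^3) set"
    and X X1 X2 X12 X21 :: "real \<Rightarrow> real \<times> real \<Rightarrow> real^3"
  assumes "open D" and "connected D"
    and "tzitzeica_solution D h" and "\<forall>p\<in>D. h p \<noteq> 0"
    and "affine_frame D h F"
    and "X = third_column F"
    and "\<alpha>1 \<noteq> 0" and "\<alpha>2 \<noteq> 0" and "\<alpha>1^3 \<noteq> \<alpha>2^3" and "\<alpha>1^3 \<noteq> - (\<alpha>2^3)"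
    and "0 < r" and "r < 1"
    and "r < \<bar>\<alpha>1\<bar>" and "\<bar>\<alpha>1\<bar> < 1 / r" and "r < \<bar>\<alpha>2\<bar>" and "\<bar>\<alpha>2\<bar> < 1 / r"
    and "l1 = vector [a1, b1, 1]" and "L1 = span {l1}" and "\<not> L1 \<subseteq> Delta0"
    and "l2 = vector [a2, b2, 1]" and "L2 = span {l2}" and "\<not> L2 \<subseteq> Delta0"
    and "g1 = simple_element \<alpha>1 L1" and "g2 = simple_element \<alpha>2 L2"
    and "L1' = line_times L1 (matrix_inv (Re_mat (g2 (of_real \<alpha>1))))" and "\<not> L1' \<subseteq> Delta0"
    and "L2' = line_times L2 (matrix_inv (Re_mat (g1 (of_real \<alpha>2))))" and "\<not> L2' \<subseteq> Delta0"
    and "g1' = simple_element \<alpha>1 L1'" and "g2' = simple_element \<alpha>2 L2'"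
    and "F1 = dress r g1 F" and "F2 = dress r g2 F"
    and "F12 = dress r g2' F1" and "F21 = dress r g1' F2"
    and "\<forall>p\<in>D. \<not> line_times L1 (Re_mat (F p (of_real \<alpha>1))) \<subseteq> Delta0"
    and "\<forall>p\<in>D. \<not> line_times L2 (Re_mat (F p (of_real \<alpha>2))) \<subseteq> Delta0"
    and "\<forall>p\<in>D. \<not> line_times L2' (Re_mat (F1 p (of_real \<alpha>2))) \<subseteq> Delta0"
    and "\<forall>p\<in>D. \<not> line_times L1' (Re_mat (F2 p (of_real \<alpha>1))) \<subseteq> Delta0"
    and "\<gamma>1 = \<alpha>1^3" and "\<gamma>2 = \<alpha>2^3"
    and "\<phi>1 = (\<lambda>p. l1 \<bullet> X \<alpha>1 p)" and "\<phi>2 = (\<lambda>p. l2 \<bullet> X \<alpha>2 p)"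
    and "h1 = transform_h h \<phi>1" and "h2 = transform_h h \<phi>2"
    and "X1 = (\<lambda>lam. transform_X h (lam^3) (X lam) \<gamma>1 \<phi>1)"
    and "X2 = (\<lambda>lam. transform_X h (lam^3) (X lam) \<gamma>2 \<phi>2)"
    and "\<phi>12 = transform_X h \<gamma>2 \<phi>2 \<gamma>1 \<phi>1" and "\<phi>21 = transform_X h \<gamma>1 \<phi>1 \<gamma>2 \<phi>2"
    and "h12 = transform_h h1 \<phi>12" and "h21 = transform_h h2 \<phi>21"
    and "X12 = (\<lambda>lam. transform_X h1 (lam^3) (X1 lam) \<gamma>2 \<phi>12)"
    and "X21 = (\<lambda>lam. transform_X h2 (lam^3) (X2 lam) \<gamma>1 \<phi>21)"
  shows "(\<forall>l. l^3 \<noteq> of_real (\<alpha>1^3) \<and> l^3 \<noteq> of_real (\<alpha>2^3) \<longrightarrow>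
            loop_mult g2' g1 l = loop_mult g1' g2 l)
       \<and> dressing_defined r D g1 F \<and> dressing_defined r D g2 F
       \<and> dressing_defined r D g2' F1 \<and> dressing_defined r D g1' F2
       \<and> dressing_defined r D (loop_mult g2' g1) F
       \<and> dressing_defined r D (loop_mult g1' g2) F
       \<and> (\<forall>p\<in>D. \<forall>l. l \<noteq> 0 \<longrightarrow>
            F12 p l = dress r (loop_mult g2' g1) F p l \<and>
            dress r (loop_mult g2' g1) F p l = dress r (loop_mult g1' g2) F p l \<and>
            dress r (loop_mult g1' g2) F p l = F21 p l)
       \<and> (\<forall>lam::real. lam \<noteq> 0 \<and> lam^3 \<noteq> - (\<alpha>1^3) \<and> lam^3 \<noteq> - (\<alpha>2^3) \<longrightarrow>
            transform_defined D h (lam^3) (X lam) \<gamma>1 \<phi>1 \<and>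
            transform_defined D h (lam^3) (X lam) \<gamma>2 \<phi>2 \<and>
            transform_defined D h \<gamma>2 \<phi>2 \<gamma>1 \<phi>1 \<and>
            transform_defined D h \<gamma>1 \<phi>1 \<gamma>2 \<phi>2 \<and>
            transform_defined D h1 (lam^3) (X1 lam) \<gamma>2 \<phi>12 \<and>
            transform_defined D h2 (lam^3) (X2 lam) \<gamma>1 \<phi>21 \<and>
            (\<forall>p\<in>D. X12 lam p = X21 lam p \<and> h12 p = h21 p))"
proof -
  note D = assms(1) and tz = assms(3) and h0 = assms(4) and r = assms(11,12)
    and \<alpha>1 = assms(13,14) and \<alpha>2 = assms(15,16)
  have F: "\<forall>p\<in>D. F p \<in> Lambda_plus_SL"
    using assms(5) unfolding affine_frame_def by blast
  have neq: "\<alpha>2^3 \<noteq> \<alpha>1^3" "\<alpha>2^3 \<noteq> - (\<alpha>1^3)" "\<alpha>1^3 \<noteq> \<alpha>2^3" "\<alpha>1^3 \<noteq> - (\<alpha>2^3)" "\<alpha>1^3 + \<alpha>2^3 \<noteq> 0"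
    using assms(9,10) by auto
  have ab1: "2 * a1 * b1 \<noteq> 1" and ab2: "2 * a2 * b2 \<noteq> 1"
    using assms(17-22) by (auto simp: span_subset_Delta0_iff)
  have g1: "g1 = simple_matrix \<alpha>1 a1 b1" and g2: "g2 = simple_matrix \<alpha>2 a2 b2"
    unfolding assms(17-24) by (rule simple_element_span)+
  have L1': "L1' = line_times (span {vector [a1, b1, 1]}) (simple_inv \<alpha>2 a2 b2 \<alpha>1)"
    unfolding assms(25,18,17) g2 Re_mat_simple matrix_inv_eqI[OF simple_mult_inv[OF ab2 neq(3,4)]] ..
  have L2': "L2' = line_times (span {vector [a2, b2, 1]}) (simple_inv \<alpha>1 a1 b1 \<alpha>2)"
    unfolding assms(27,21,20) g1 Re_mat_simple matrix_inv_eqI[OF simple_mult_inv[OF ab1 neq(1,2)]] ..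
  obtain k1 a1' b1' where k1: "k1 \<noteq> 0" "2 * a1' * b1' \<noteq> 1"
    "vector [a1, b1, 1] v* simple_inv \<alpha>2 a2 b2 \<alpha>1 = k1 *s vector [a1', b1', 1]"
    "L1' = span {vector [a1', b1', 1]}" "g1' = simple_matrix \<alpha>1 a1' b1'"
    using simple_line[of "vector [a1, b1, 1]" "simple_inv \<alpha>2 a2 b2 \<alpha>1" \<alpha>1] assms(26,29) unfolding L1' by metis
  obtain k2 a2' b2' where k2: "k2 \<noteq> 0" "2 * a2' * b2' \<noteq> 1"
    "vector [a2, b2, 1] v* simple_inv \<alpha>1 a1 b1 \<alpha>2 = k2 *s vector [a2', b2', 1]"
    "L2' = span {vector [a2', b2', 1]}" "g2' = simple_matrix \<alpha>2 a2' b2'"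
    using simple_line[of "vector [a2, b2, 1]" "simple_inv \<alpha>1 a1 b1 \<alpha>2" \<alpha>2] assms(28,30) unfolding L2' by metis

  have mult: "loop_mult g2' g1 l = loop_mult g1' g2 l"
    if l: "l^3 \<noteq> of_real (\<alpha>1^3)" "l^3 \<noteq> of_real (\<alpha>2^3)" for l
  proof -
    have c: "2 * complex_of_real x * of_real y \<noteq> 1" if "2 * x * y \<noteq> 1" for x y
      using that of_real_eq_iff[of "2 * x * y" 1, where 'a = complex] by simp
    have s: "(of_real \<alpha>1 :: complex)^3 + of_real \<alpha>2^3 \<noteq> 0"
      using neq(5) by (metis of_real_0 of_real_add of_real_eq_iff of_real_power)
    show ?thesis
      unfolding loop_mult_def g1 g2 k1(5) k2(5) simple_matrix_eq
      using k1(1) k2(1) l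
      by (intro simple_exchange[OF s c[OF ab1] c[OF ab2] c[OF k1(2)] _ _
            of_real_row_mult[OF of_real_simple(2) k1(3)] of_real_row_mult[OF of_real_simple(2) k2(3)]]) simp_all
  qed
  \<comment> \<open>The neighbourhood of 0 and infinity avoids every cube root of \<alpha>_1^3 and
    \<alpha>_2^3, so the exchange identity holds throughout it.\<close>
  have mult_near: "loop_mult g2' g1 l = loop_mult g1' g2 l" if "l \<in> near_0_inf r - {0}" for l
    using mult near_0_inf_cube_neq(1)[OF r(1) \<alpha>1, of l] near_0_inf_cube_neq(1)[OF r(1) \<alpha>2, of l] that by simp

  \<comment> \<open>\<open>u\<close> collects the columns of F at the spectral parameter of X; z and
    y are the rows l_i F at \<alpha>_i, with third entries \<phi>_1 and \<phi>_2.\<close>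
  define u where "u lam j p = column j (Re_mat (F p (of_real lam)))" for lam :: real and j p
  define z where "z j p = vector [a1, b1, 1] \<bullet> u \<alpha>1 j p" for j p
  define y where "y j p = vector [a2, b2, 1] \<bullet> u \<alpha>2 j p" for j p
  have zy_eq: "z = (\<lambda>j p. vector [a1, b1, 1] \<bullet> column j (Re_mat (F p (of_real \<alpha>1))))"
    "y = (\<lambda>j p. vector [a2, b2, 1] \<bullet> column j (Re_mat (F p (of_real \<alpha>2))))"
    by (simp_all add: z_def y_def u_def fun_eq_iff)
  have F1: "F1 = dress r (simple_matrix \<alpha>1 a1 b1) F" and F2: "F2 = dress r (simple_matrix \<alpha>2 a2 b2) F"
    using assms(31,32) g1 g2 by simp_all
  note d12 = two_step_dressing[OF F r \<alpha>1 \<alpha>2 neq(1,2) ab1 k2(2) assms(35)[unfolded assms(18,17)] k2(1,3)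
      assms(37)[unfolded F1 k2(4)], folded zy_eq F1 g1 k2(5) assms(33)]
  note d21 = two_step_dressing[OF F r \<alpha>2 \<alpha>1 neq(3,4) ab2 k1(2) assms(36)[unfolded assms(21,20)] k1(1,3)
      assms(38)[unfolded F2 k1(4)], folded zy_eq F2 g2 k1(5) assms(34)]
  \<comment> \<open>A dressing factor sees its loop only near 0 and infinity, where the two products
    coincide.\<close>
  have d21': "dressing_factor r (loop_mult g1' g2) (F p) f \<longleftrightarrow> dressing_factor r (loop_mult g2' g1) (F p) f" for p f
    by (rule dressing_factor_cong) (simp add: mult_near)
  have frames: "F12 p l = dress r (loop_mult g2' g1) F p l"
    "dress r (loop_mult g2' g1) F p l = dress r (loop_mult g1' g2) F p l"
    "dress r (loop_mult g1' g2) F p l = F21 p l" if p: "p \<in> D" and l: "l \<noteq> 0" for p l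
  proof -
    have f12: "dressing_factor r (loop_mult g2' g1) (F p) (F12 p)"
      using d12(3) p by blast
    have f21: "dressing_factor r (loop_mult g1' g2) (F p) (F21 p)"
      using d21(3) p by blast
    have g12: "dressing_factor r (loop_mult g2' g1) (F p) (dress r (loop_mult g2' g1) F p)"
      by (rule dressing_factor_dress) (rule f12)
    have g21: "dressing_factor r (loop_mult g1' g2) (F p) (dress r (loop_mult g1' g2) F p)"
      by (rule dressing_factor_dress) (rule f21)
    show "F12 p l = dress r (loop_mult g2' g1) F p l"
      by (rule dressing_factor_unique[OF r f12 g12 l])
    show "dress r (loop_mult g2' g1) F p l = dress r (loop_mult g1' g2) F p l"
      by (rule dressing_factor_unique[OF r g12 g21[unfolded d21'] l])
    show "dress r (loop_mult g1' g2) F p l = F21 p l"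
      by (rule dressing_factor_unique[OF r g21 f21 l])
  qed
  have defined: "dressing_defined r D (loop_mult g2' g1) F" "dressing_defined r D (loop_mult g1' g2) F"
    using d12(1-3) d21(1-3) Lambda_minus_mult unfolding dressing_defined_def by blast+

  have X: "X lam = u lam 3" for lam
    by (simp add: assms(6) third_column_def u_def fun_eq_iff)
  have fu: "frame D h lam (u lam)" if "lam \<noteq> 0" for lam
    unfolding u_def by (rule affine_frame_frame[OF D assms(5) that])
  have fz: "frame D h \<alpha>1 z" and fy: "frame D h \<alpha>2 y"
    unfolding z_def y_def by (rule frame_linear[OF D bounded_linear_inner_right fu] assms(7,8))+
  have \<phi>: "\<phi>1 = z 3" "\<phi>2 = y 3"
    using assms(41,42,17,20) by (simp_all add: X z_def y_def fun_eq_iff)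
  have transforms: "transform_defined D h (lam^3) (X lam) \<gamma>1 \<phi>1 \<and>
      transform_defined D h (lam^3) (X lam) \<gamma>2 \<phi>2 \<and>
      transform_defined D h \<gamma>2 \<phi>2 \<gamma>1 \<phi>1 \<and>
      transform_defined D h \<gamma>1 \<phi>1 \<gamma>2 \<phi>2 \<and>
      transform_defined D h1 (lam^3) (X1 lam) \<gamma>2 \<phi>12 \<and>
      transform_defined D h2 (lam^3) (X2 lam) \<gamma>1 \<phi>21 \<and>
      (\<forall>p\<in>D. X12 lam p = X21 lam p \<and> h12 p = h21 p)"
    if lam: "lam \<noteq> 0" "lam^3 \<noteq> - (\<alpha>1^3)" "lam^3 \<noteq> - (\<alpha>2^3)" for lam
  proof -
    have eqs: "h1 = transform_h h (z 3)" "h2 = transform_h h (y 3)"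
      "X1 lam = transform_X h (lam^3) (u lam 3) (\<alpha>1^3) (z 3)"
      "X2 lam = transform_X h (lam^3) (u lam 3) (\<alpha>2^3) (y 3)"
      "\<phi>12 = transform_X h (\<alpha>2^3) (y 3) (\<alpha>1^3) (z 3)"
      "\<phi>21 = transform_X h (\<alpha>1^3) (z 3) (\<alpha>2^3) (y 3)"
      unfolding assms(43-48) assms(39,40) \<phi> X by simp_all
    \<comment> \<open>Both two-step transforms become third columns of twice gauged frames, which is
      the form that \<open>permute_new_frames\<close> compares.\<close>
    note t12 = two_step_transform[OF D tz h0 fz d12(4) fy fu[OF lam(1)] neq(2) lam(2,3) d12(5), folded eqs assms(39,40)]
    note t21 = two_step_transform[OF D tz h0 fy d21(4) fz fu[OF lam(1)] neq(4) lam(3,2) d21(5), folded eqs assms(39,40)]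
    have "X12 lam p = X21 lam p \<and> h12 p = h21 p" if p: "p \<in> D" for p
    proof
      have nd: "z 3 p \<noteq> 0" "2 * z 1 p * z 2 p \<noteq> (z 3 p)^2" "y 3 p \<noteq> 0" "2 * y 1 p * y 2 p \<noteq> (y 3 p)^2"
        "new_frame \<alpha>1 z \<alpha>2 y 3 p \<noteq> 0"
        "2 * new_frame \<alpha>1 z \<alpha>2 y 1 p * new_frame \<alpha>1 z \<alpha>2 y 2 p \<noteq> (new_frame \<alpha>1 z \<alpha>2 y 3 p)^2"
        "new_frame \<alpha>2 y \<alpha>1 z 3 p \<noteq> 0"
        "2 * new_frame \<alpha>2 y \<alpha>1 z 1 p * new_frame \<alpha>2 y \<alpha>1 z 2 p \<noteq> (new_frame \<alpha>2 y \<alpha>1 z 3 p)^2"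
        using d12(4,5) d21(4,5) p unfolding nondegenerate_def by blast+
      note perm = permute_new_frames[OF neq(5) lam(2,3) nd]
      show "X12 lam p = X21 lam p"
        unfolding assms(51,52) t12(2)[OF p] t21(2)[OF p] by (rule perm(1))
      show "h12 p = h21 p"
        unfolding assms(49,50) t12(3)[OF p] t21(3)[OF p] by (rule perm(2)[OF assms(7,8)])
    qed
    moreover have "transform_defined D h (lam^3) (X lam) \<gamma>1 \<phi>1" "transform_defined D h (lam^3) (X lam) \<gamma>2 \<phi>2"
      "transform_defined D h \<gamma>2 \<phi>2 \<gamma>1 \<phi>1" "transform_defined D h \<gamma>1 \<phi>1 \<gamma>2 \<phi>2"
      unfolding X \<phi> assms(39,40)
      by (rule frame_transform_defined[OF D tz h0 fz d12(4) fu[OF lam(1)] lam(2)]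
          frame_transform_defined[OF D tz h0 fy d21(4) fu[OF lam(1)] lam(3)]
          frame_transform_defined[OF D tz h0 fz d12(4) fy neq(2)]
          frame_transform_defined[OF D tz h0 fy d21(4) fz neq(4)])+
    ultimately show ?thesis
      using t12(1) t21(1) by blast
  qed
  show ?thesis
    using mult d12(1,2) d21(1,2) defined frames transforms by blast
qed

end
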